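(* For every $n\ge2$, the topological closure of $\mathcal{PMV}(n,2)$ in $\mathbb R^{\binom n2}$ is a semialgebraic set.
   Context: $\mathcal K_2$ denotes the set of nonempty compact convex subsets of $\mathbb R^2$. The mixed area of $K,L\in\mathcal K_2$ is $\mathrm V(K,L)=\tfrac12\big(\mathrm{Vol}_2(K+L)-\mathrm{Vol}_2(K)-\mathrm{Vol}_2(L)\big)$. $\mathcal{PMV}(n,2)=\{(\mathrm V(K_i,K_j))_{\{i,j\}\subset[n]}\in\mathbb R^{\binom n2} : K_1,\dots,K_n\in\mathcal K_2\}$. *)

theory Defs
  imports "HOL-Analysis.Analysis"
begin

definition convex_bodies2 :: "(real^2) set set" where
  "convex_bodies2 = {K. K \<noteq> {} \<and> compact K \<and> convex K}"

definition minkowski_sum :: "(real^2) set \<Rightarrow> (real^2) set \<Rightarrow> (real^2) set" where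
  "minkowski_sum K L = {a + b | a b. a \<in> K \<and> b \<in> L}"

definition mixed_area :: "(real^2) set \<Rightarrow> (real^2) set \<Rightarrow> real" where
  "mixed_area K L = (measure lebesgue (minkowski_sum K L) - measure lebesgue K - measure lebesgue L) / 2"

text \<open>Index set of R^(n choose 2): the 2-element subsets of [n] = {1..n}.
  Points of R^(n choose 2) are represented as functions on nat set vanishing off this index set.\<close>
definition pair_index :: "nat \<Rightarrow> nat set set" where
  "pair_index n = {S. S \<subseteq> {1..n} \<and> card S = 2}"

definition PMV2 :: "nat \<Rightarrow> (nat set \<Rightarrow> real) set" where
  "PMV2 n = {x. \<exists>K :: nat \<Rightarrow> (real^2) set.
      (\<forall>i\<in>{1..n}. K i \<in> convex_bodies2) \<and>
      (\<forall>i\<in>{1..n}. \<forall>j\<in>{1..n}. i \<noteq> j \<longrightarrow> x {i, j} = mixed_area (K i) (K j)) \<and>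
      (\<forall>S. S \<notin> pair_index n \<longrightarrow> x S = 0)}"

inductive_set poly_funs :: "(('i \<Rightarrow> real) \<Rightarrow> real) set" where
  const: "(\<lambda>x. c) \<in> poly_funs"
| var: "(\<lambda>x. x i) \<in> poly_funs"
| add: "p \<in> poly_funs \<Longrightarrow> q \<in> poly_funs \<Longrightarrow> (\<lambda>x. p x + q x) \<in> poly_funs"
| mult: "p \<in> poly_funs \<Longrightarrow> q \<in> poly_funs \<Longrightarrow> (\<lambda>x. p x * q x) \<in> poly_funs"

text \<open>A subset A of R^I (functions vanishing outside the finite index set I) is semialgebraic
  if it is a finite union of basic sets {x. p x = 0 \<and> (\<forall>q\<in>Q. q x > 0)}, p, q polynomials,
  Q finite.  (Every semialgebraic set has such a representation.)\<close>
definition semialgebraic_in :: "'i set \<Rightarrow> ('i \<Rightarrow> real) set \<Rightarrow> bool" where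
  "semialgebraic_in I A \<longleftrightarrow>
     (\<exists>F. finite F \<and>
        (\<forall>(p, Q) \<in> F. p \<in> poly_funs \<and> finite Q \<and> Q \<subseteq> poly_funs) \<and>
        A = {x. (\<forall>i. i \<notin> I \<longrightarrow> x i = 0) \<and>
                (\<exists>(p, Q) \<in> F. p x = 0 \<and> (\<forall>q\<in>Q. q x > 0))})"

end

theory Submission
  imports Defs "HOL-Library.Multiset" "HOL-Computational_Algebra.Polynomial"
begin

text \<open>For a polygon \<open>P\<close> the map \<open>K \<mapsto> V(K, P)\<close> is a nonnegative combination of support values of \<open>K\<close> at the
  outer normals of \<open>P\<close>, and these weighted normals sum to zero. A balanced system of weighted normals
  is a sum of balanced systems of at most three, so \<open>V(\<cdot>, P) = \<Sum>\<^sub>a V(\<cdot>, T\<^sub>a)\<close> for finitely many triangles or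
  segments \<open>T\<^sub>a\<close>. If only the values at the other \<open>n - 1\<close> bodies matter, the conic Caratheodory theorem reduces
  the number of triangles to at most \<open>n\<close>. Replacing the bodies one at a time shows that the vectors of
  mixed areas of \<open>n\<close> sums of \<open>n\<close> triangles are dense in \<open>PMV2 n\<close>. These depend on finitely many real parameters, and the
  mixed area of two triangles is a piecewise polynomial function of the vertices, so the closure is
  semialgebraic by the Tarski-Seidenberg theorem, which is proved by Cohen-Hoermander elimination.\<close>

subsection \<open>Functions determined by finitely many signs\<close>

text \<open>A polygon close to a body may need arbitrarily many vertices, so density of polygons
  alone gives no bounded description. The bound comes from linearity: the diagonal values V(K_i,
  K_i) are not recorded, so with the other bodies held fixed the data see K_i only through n - 1
  functionals, and these are additive in the triangles; the value vectors span a cone in R^(n-1).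
  This forces the replacement of one body at a time, and the triangles chosen for a body depend on
  all the others. The decomposition is exact for polygons; the only error is that of passing to an
  inscribed polygon, and it is the reason for the closure. No general theory of mixed volumes
  enters: additivity is derived for sums of triangles only, from the formula that gives the mixed
  area with a triangle by three support values. On the algebraic side there is no syntax of
  formulas: a predicate is admissible if finitely many polynomial signs determine it, which makes
  Boolean combinations trivial and leaves the existential quantifier as the one real step.\<close>

lemma poly_funs_sum:
  "finite A \<Longrightarrow> (\<And>a. a \<in> A \<Longrightarrow> f a \<in> poly_funs) \<Longrightarrow> (\<lambda>x. \<Sum>a\<in>A. f a x) \<in> poly_funs"
  by (induction A rule: finite_induct) (auto intro: poly_funs.intros)

lemma poly_funs_uminus: "p \<in> poly_funs \<Longrightarrow> (\<lambda>x. - p x) \<in> poly_funs"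
  using poly_funs.mult[OF poly_funs.const[of "-1"], of p] by simp

lemma poly_funs_diff: "p \<in> poly_funs \<Longrightarrow> q \<in> poly_funs \<Longrightarrow> (\<lambda>x. p x - q x) \<in> poly_funs"
  using poly_funs.add[OF _ poly_funs_uminus, of p q] by simp

text \<open>For a predicate this says that it defines a semialgebraic set; allowing arbitrary codomains
  lets the words of signs below be treated in the same way.\<close>

definition sign_determined :: "(('i \<Rightarrow> real) \<Rightarrow> 'b) \<Rightarrow> bool" where
  "sign_determined F \<longleftrightarrow>
     (\<exists>ps \<subseteq> poly_funs. finite ps \<and> (\<forall>x y. (\<forall>p\<in>ps. sgn (p x) = sgn (p y)) \<longrightarrow> F x = F y))"

lemma sign_determined_const: "sign_determined (\<lambda>x. c)"
  unfolding sign_determined_def by (rule exI[of _ "{}"]) auto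

lemma sign_determined_sgn: "p \<in> poly_funs \<Longrightarrow> sign_determined (\<lambda>x. sgn (p x))"
  unfolding sign_determined_def by (rule exI[of _ "{p}"]) auto

text \<open>The union of the finitely many witnessing families works. The target \<open>G\<close> is
  arbitrary and has only to be a function of the values \<open>F a x\<close>, which avoids tuples
  over \<open>A\<close>.\<close>

lemma sign_determined_family:
  assumes "finite A" "\<And>a. a \<in> A \<Longrightarrow> sign_determined (F a)"
    and dep: "\<And>x y. (\<And>a. a \<in> A \<Longrightarrow> F a x = F a y) \<Longrightarrow> G x = G y"
  shows "sign_determined G"
proof -
  have "\<forall>a\<in>A. \<exists>ps. ps \<subseteq> poly_funs \<and> finite ps \<and> (\<forall>x y. (\<forall>p\<in>ps. sgn (p x) = sgn (p y)) \<longrightarrow> F a x = F a y)"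
    using assms(2) unfolding sign_determined_def by blast
  then obtain ps where ps: "\<And>a. a \<in> A \<Longrightarrow> ps a \<subseteq> poly_funs \<and> finite (ps a) \<and>
      (\<forall>x y. (\<forall>p\<in>ps a. sgn (p x) = sgn (p y)) \<longrightarrow> F a x = F a y)"
    by metis
  show ?thesis
    unfolding sign_determined_def
  proof (intro exI[of _ "\<Union>(ps ` A)"] conjI allI impI)
    show "\<Union>(ps ` A) \<subseteq> poly_funs" "finite (\<Union>(ps ` A))" using ps assms(1) by auto
    fix x y assume "\<forall>p\<in>\<Union>(ps ` A). sgn (p x) = sgn (p y)"
    then show "G x = G y" using ps by (intro dep) auto
  qed
qed

lemma sign_determined_comp: "sign_determined F \<Longrightarrow> sign_determined (\<lambda>x. G (F x))"
  unfolding sign_determined_def by metis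

lemma sign_determined_comp2:
  assumes "sign_determined F" "sign_determined G"
  shows "sign_determined (\<lambda>x. H (F x) (G x))"
proof -
  obtain ps qs where
    "ps \<subseteq> poly_funs" "finite ps" "\<And>x y. (\<forall>p\<in>ps. sgn (p x) = sgn (p y)) \<Longrightarrow> F x = F y"
    "qs \<subseteq> poly_funs" "finite qs" "\<And>x y. (\<forall>p\<in>qs. sgn (p x) = sgn (p y)) \<Longrightarrow> G x = G y"
    using assms unfolding sign_determined_def by metis
  then show ?thesis
    unfolding sign_determined_def by (intro exI[of _ "ps \<union> qs"]) (metis Un_iff finite_Un le_sup_iff)
qed

lemma sign_determined_ball:
  "finite A \<Longrightarrow> (\<And>a. a \<in> A \<Longrightarrow> sign_determined (P a)) \<Longrightarrow> sign_determined (\<lambda>x. \<forall>a\<in>A. P a x)"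
  by (rule sign_determined_family[of A P]) auto

subsection \<open>Univariate polynomials with polynomial coefficients\<close>

definition ppoly :: "(('i \<Rightarrow> real) \<Rightarrow> real poly) set" where
  "ppoly = {P. (\<forall>k. (\<lambda>x. coeff (P x) k) \<in> poly_funs) \<and> (\<exists>n. \<forall>x. \<forall>k\<ge>n. coeff (P x) k = 0)}"

text \<open>A bound on the number of coefficients that is uniform in the parameters: at points where the
  leading coefficient vanishes the degree is smaller than \<open>lv P - 1\<close>.\<close>

definition lv :: "(('i \<Rightarrow> real) \<Rightarrow> real poly) \<Rightarrow> nat" where
  "lv P = (LEAST n. \<forall>x. \<forall>k\<ge>n. coeff (P x) k = 0)"

lemma ppolyI:
  "(\<And>k. (\<lambda>x. coeff (P x) k) \<in> poly_funs) \<Longrightarrow> (\<And>x k. k \<ge> n \<Longrightarrow> coeff (P x) k = 0) \<Longrightarrow> P \<in> ppoly"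
  unfolding ppoly_def by blast

lemma ppoly_coeff: "P \<in> ppoly \<Longrightarrow> (\<lambda>x. coeff (P x) k) \<in> poly_funs"
  unfolding ppoly_def by blast

lemma lv_le: "(\<And>x k. k \<ge> n \<Longrightarrow> coeff (P x) k = 0) \<Longrightarrow> lv P \<le> n"
  unfolding lv_def by (rule Least_le) auto

lemma lv_coeff: 
  assumes "P \<in> ppoly" "k \<ge> lv P" shows "coeff (P x) k = 0"
proof -
  have "\<exists>n. \<forall>x. \<forall>k\<ge>n. coeff (P x) k = 0" using assms(1) unfolding ppoly_def by blast
  from LeastI_ex[OF this] show ?thesis using assms(2) unfolding lv_def by blast
qed

lemma ppoly_add: "P \<in> ppoly \<Longrightarrow> Q \<in> ppoly \<Longrightarrow> (\<lambda>x. P x + Q x) \<in> ppoly"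
  by (rule ppolyI[of _ "max (lv P) (lv Q)"]) (auto intro: poly_funs.add ppoly_coeff simp: lv_coeff)

lemma ppoly_diff: "P \<in> ppoly \<Longrightarrow> Q \<in> ppoly \<Longrightarrow> (\<lambda>x. P x - Q x) \<in> ppoly"
  by (rule ppolyI[of _ "max (lv P) (lv Q)"]) (auto intro: poly_funs_diff ppoly_coeff simp: lv_coeff)

lemma ppoly_mult: 
  assumes "P \<in> ppoly" "Q \<in> ppoly" shows "(\<lambda>x. P x * Q x) \<in> ppoly"
proof (rule ppolyI[of _ "lv P + lv Q"])
  fix k show "(\<lambda>x. coeff (P x * Q x) k) \<in> poly_funs"
    unfolding coeff_mult by (intro poly_funs_sum poly_funs.mult ppoly_coeff assms) auto
next
  fix x k assume k: "k \<ge> lv P + lv Q"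
  have "coeff (P x) i * coeff (Q x) (k - i) = 0" if "i \<le> k" for i
    using k lv_coeff[OF assms(1), of i x] lv_coeff[OF assms(2), of "k-i" x] by (cases "i \<ge> lv P") auto
  then show "coeff (P x * Q x) k = 0" unfolding coeff_mult by (intro sum.neutral) auto
qed

lemma ppoly_monom: "c \<in> poly_funs \<Longrightarrow> (\<lambda>x. monom (c x) k) \<in> ppoly"
proof (rule ppolyI[of _ "Suc k"])
  fix j assume "c \<in> poly_funs"
  then show "(\<lambda>x. coeff (monom (c x) k) j) \<in> poly_funs"
    using poly_funs.const[of 0] by (cases "j = k") auto
qed auto

lemma ppoly_pderiv: 
  assumes "P \<in> ppoly" shows "(\<lambda>x. pderiv (P x)) \<in> ppoly"
proof (rule ppolyI[of _ "lv P"])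
  fix k show "(\<lambda>x. coeff (pderiv (P x)) k) \<in> poly_funs"
    unfolding coeff_pderiv by (intro poly_funs.mult poly_funs.const ppoly_coeff assms)
qed (auto simp: coeff_pderiv lv_coeff assms)

lemma lv_pderiv: 
  assumes "P \<in> ppoly" "lv P \<ge> 1" shows "lv (\<lambda>x. pderiv (P x)) < lv P"
proof -
  have "lv (\<lambda>x. pderiv (P x)) \<le> lv P - 1"
    by (rule lv_le) (simp add: coeff_pderiv lv_coeff[OF assms(1)])
  then show ?thesis using assms(2) by linarith
qed

text \<open>Coordinate \<open>i\<close> becomes the indeterminate and every other coordinate a
  coefficient of degree 0. Quantifying over one coordinate thus becomes a question about univariate
  polynomials with parameters.\<close>

lemma poly_fun_as_ppoly:
  "p \<in> poly_funs \<Longrightarrow> \<exists>P\<in>ppoly. \<forall>x t. p (x(i:=t)) = poly (P x) t"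
proof (induction rule: poly_funs.induct)
  case (const c)
  show ?case using ppoly_monom[OF poly_funs.const, of c 0]
    by (intro bexI[of _ "\<lambda>x. monom c 0"]) (auto simp: poly_monom)
next
  case (var j)
  show ?case
  proof (cases "j = i")
    case True
    then show ?thesis using ppoly_monom[OF poly_funs.const, of 1 1]
      by (intro bexI[of _ "\<lambda>x. monom 1 1"]) (auto simp: poly_monom)
  next
    case False
    then show ?thesis using ppoly_monom[OF poly_funs.var, of j 0]
      by (intro bexI[of _ "\<lambda>x. monom (x j) 0"]) (auto simp: poly_monom)
  qed
next
  case (add p q)
  then obtain P Q where "P \<in> ppoly" "\<forall>x t. p (x(i:=t)) = poly (P x) t" 
     "Q \<in> ppoly" "\<forall>x t. q (x(i:=t)) = poly (Q x) t" by blast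
  then show ?case by (intro bexI[OF _ ppoly_add[of P Q]]) (auto simp del: fun_upd_apply)
next
  case (mult p q)
  then obtain P Q where "P \<in> ppoly" "\<forall>x t. p (x(i:=t)) = poly (P x) t" 
     "Q \<in> ppoly" "\<forall>x t. q (x(i:=t)) = poly (Q x) t" by blast
  then show ?case by (intro bexI[OF _ ppoly_mult[of P Q]]) (auto simp del: fun_upd_apply)
qed

text \<open>The pseudo-remainder of \<open>P\<close> by \<open>Q\<close>; multiplying by the square of the leading coefficient
  in every division step keeps the sign.\<close>

lemma prem_exists:
  assumes "P \<in> ppoly" "Q \<in> ppoly" "lv Q \<ge> 1"
  shows "\<exists>S\<in>ppoly. lv S < lv Q \<and> (\<forall>x t. coeff (Q x) (lv Q - 1) \<noteq> 0 \<longrightarrow> poly (Q x) t = 0 \<longrightarrow>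
           sgn (poly (S x) t) = sgn (poly (P x) t))"
  using assms(1)
proof (induction "lv P" arbitrary: P rule: less_induct)
  case less
  show ?case
  proof (cases "lv P < lv Q")
    case True then show ?thesis using less.prems by blast
  next
    case False
    define m l where "m = lv P - 1" and "l = lv Q - 1"
    have ml: "l \<le> m" "lv P = Suc m" "lv Q = Suc l" using False assms(3) by (auto simp: m_def l_def)
    define q p where "q = (\<lambda>x. coeff (Q x) l)" and "p = (\<lambda>x. coeff (P x) m)"
    have qp: "q \<in> poly_funs" "p \<in> poly_funs" unfolding q_def p_def using assms less.prems ppoly_coeff by auto
    \<comment> \<open>The two products have the same coefficient \<open>q x * q x * p x\<close> at
      degree \<open>m\<close>, so the top term cancels and \<open>lv\<close> drops; at a zero of
      \<open>Q\<close> only \<open>q x * q x\<close> times \<open>P\<close> survives.\<close>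
    define P1 where "P1 = (\<lambda>x. monom (q x * q x) 0 * P x - monom (q x * p x) (m - l) * Q x)"
    have P1: "P1 \<in> ppoly" unfolding P1_def
      by (intro ppoly_diff ppoly_mult ppoly_monom poly_funs.mult qp less.prems assms(2))
    have "lv P1 \<le> m"
    proof (rule lv_le)
      fix x k assume k: "m \<le> k"
      have "coeff (P1 x) k = q x * q x * coeff (P x) k - q x * p x * coeff (Q x) (k - (m - l))"
        unfolding P1_def using k by (simp add: coeff_monom_mult monom_0)
      also have "\<dots> = 0"
      proof (cases "k = m")
        case True then show ?thesis using ml by (simp add: q_def p_def)
      next
        case False
        then have "k \<ge> lv P" "k - (m - l) \<ge> lv Q" using k ml by auto
        then show ?thesis using lv_coeff[OF less.prems] lv_coeff[OF assms(2)] by simp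
      qed
      finally show "coeff (P1 x) k = 0" .
    qed
    then have "lv P1 < lv P" using ml by simp
    from less.hyps[OF this P1] obtain S where S: "S \<in> ppoly" "lv S < lv Q"
      "\<And>x t. coeff (Q x) (lv Q - 1) \<noteq> 0 \<Longrightarrow> poly (Q x) t = 0 \<Longrightarrow> sgn (poly (S x) t) = sgn (poly (P1 x) t)"
      by blast
    have "sgn (poly (P1 x) t) = sgn (poly (P x) t)"
      if "coeff (Q x) (lv Q - 1) \<noteq> 0" "poly (Q x) t = 0" for x t
    proof -
      have "q x \<noteq> 0" using that(1) ml by (simp add: q_def)
      then have "q x * q x > 0" by (metis not_real_square_gt_zero)
      then show ?thesis using that(2) \<open>q x \<noteq> 0\<close>
        by (auto simp: P1_def poly_monom sgn_mult)
    qed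
    then show ?thesis using S by (metis (no_types, lifting))
  qed
qed

subsection \<open>Sign words\<close>

text \<open>The list alternates between the constant values on open intervals and the values at the
  breakpoints separating them.\<close>

fun word :: "(real \<Rightarrow> 'l) \<Rightarrow> ereal \<Rightarrow> ereal \<Rightarrow> 'l list \<Rightarrow> bool" where
  "word s a b [] = False"
| "word s a b [c] = (a < b \<and> (\<forall>t. a < ereal t \<and> ereal t < b \<longrightarrow> s t = c))"
| "word s a b (c # d # w) =
     (\<exists>z. a < ereal z \<and> (\<forall>t. a < ereal t \<and> t < z \<longrightarrow> s t = c) \<and> s z = d \<and> word s (ereal z) b w)"

lemma word_cover: "word s a b w \<Longrightarrow> a < ereal t \<Longrightarrow> ereal t < b \<Longrightarrow> s t \<in> set w"
proof (induction s a b w rule: word.induct)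
  case (3 s a b c d w)
  then obtain z where z: "\<forall>t. a < ereal t \<and> t < z \<longrightarrow> s t = c" "s z = d" "word s (ereal z) b w" by auto
  show ?case using 3 z by (cases t z rule: linorder_cases) auto
qed auto

text \<open>Every open interval in a word is nonempty, so no letter is idle. Over the whole line
  this and \<open>word_cover\<close> identify the letters with the values taken, which turns an
  existential quantifier over the reals into a search through a finite list.\<close>

lemma word_attained: "word s a b w \<Longrightarrow> c \<in> set w \<Longrightarrow> \<exists>t. s t = c"
proof (induction s a b w rule: word.induct)
  case (2 s a b c')
  then obtain t where "a < ereal t" "ereal t < b" using ereal_dense2[of a b] by auto
  then show ?case using 2 by auto
next
  case (3 s a b c' d w)
  then obtain z where z: "a < ereal z" "\<forall>t. a < ereal t \<and> t < z \<longrightarrow> s t = c'" "s z = d" "word s (ereal z) b w" by auto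
  obtain t where "a < ereal t" "ereal t < ereal z" using ereal_dense2 z(1) by blast
  then have "s t = c'" using z by auto
  then show ?case using 3 z by auto
qed auto

lemma word_append:
  "word s a (ereal z) u \<Longrightarrow> s z = d \<Longrightarrow> word s (ereal z) b v \<Longrightarrow> word s a b (u @ d # v)"
proof (induction s a "ereal z" u rule: word.induct)
  case (3 s a c d' w)
  then show ?case by fastforce
qed auto

lemma word_map: "word s a b w \<Longrightarrow> word (\<lambda>t. f (s t)) a b (map f w)"
proof (induction s a b w rule: word.induct)
  case (3 s a b c d w)
  then obtain z where "a < ereal z" "\<forall>t. a < ereal t \<and> t < z \<longrightarrow> s t = c" "s z = d" "word s (ereal z) b w" by auto
  then show ?case using 3 by (auto intro!: exI[of _ z])
qed auto

text \<open>The sign on the extended real line: at the infinities it is the eventual sign.\<close>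

definition psgn :: "real poly \<Rightarrow> ereal \<Rightarrow> real" where
  "psgn p e = (case e of ereal t \<Rightarrow> sgn (poly p t) | PInfty \<Rightarrow> sgn (lead_coeff p)
                 | MInfty \<Rightarrow> sgn (lead_coeff p) * (-1) ^ degree p)"

lemma psgn_real [simp]: "psgn p (ereal t) = sgn (poly p t)"
  and psgn_PInf [simp]: "psgn p \<infinity> = sgn (lead_coeff p)"
  and psgn_MInf [simp]: "psgn p (-\<infinity>) = sgn (lead_coeff p) * (-1) ^ degree p"
  by (simp_all add: psgn_def flip: MInfty_eq_minfinity)

section \<open>Signs of a polynomial on an interval and at its ends\<close>

lemma sgn_at_PInf:
  fixes p :: "real poly" assumes "p \<noteq> 0"
  shows "\<exists>n. \<forall>x\<ge>n. sgn (poly p x) = sgn (lead_coeff p)"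
proof (cases "lead_coeff p > 0")
  case True
  then obtain n where "\<forall>x\<ge>n. poly p x \<ge> lead_coeff p" using poly_pinfty_gt_lc by blast
  then show ?thesis using True by (intro exI[of _ n]) (auto simp: sgn_if intro: less_le_trans)
next
  case False
  then have neg: "lead_coeff (-p) > 0" using assms by (simp add: less_le)
  then obtain n where "\<forall>x\<ge>n. poly (-p) x \<ge> lead_coeff (-p)" using poly_pinfty_gt_lc by blast
  then have "\<forall>x\<ge>n. poly p x < 0" using neg by fastforce
  then show ?thesis using neg by (intro exI[of _ n]) (auto simp: sgn_if)
qed

lemma sgn_at_MInf:
  fixes p :: "real poly" assumes "p \<noteq> 0"
  shows "\<exists>n. \<forall>x\<le>n. sgn (poly p x) = sgn (lead_coeff p) * (-1) ^ degree p"
proof -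
  define q where "q = pcompose p [:0, -1:]"
  have "q \<noteq> 0" using assms by (simp add: q_def pcompose_eq_0_iff)
  from sgn_at_PInf[OF this] obtain n where n: "\<forall>x\<ge>n. sgn (poly q x) = sgn (lead_coeff q)" by blast
  have lc: "lead_coeff q = lead_coeff p * (-1) ^ degree p"
    by (simp add: q_def lead_coeff_comp)
  have "sgn (poly p x) = sgn (lead_coeff p) * (-1) ^ degree p" if "x \<le> -n" for x
  proof -
    have "poly p x = poly q (-x)" by (simp add: q_def poly_pcompose)
    then show ?thesis using n that lc by (simp add: sgn_mult)
  qed
  then show ?thesis by blast
qed

lemma less_ereal_trans: "a < ereal u \<Longrightarrow> u \<le> x \<Longrightarrow> a < ereal x"
  and ereal_less_trans: "x \<le> v \<Longrightarrow> ereal v < b \<Longrightarrow> ereal x < b"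
  by (metis ereal_less_eq(3) less_le_trans) (metis ereal_less_eq(3) le_less_trans)

text \<open>Intermediate values force one sign \<open>c\<close> inside. A finite end point may
  itself be a root, since a limit of values of sign \<open>c\<close> has sign \<open>c\<close> or 0;
  at an infinite end the eventual sign is compared at a point beyond the threshold that still lies
  in the interval.\<close>

lemma sgn_const_no_root:
  fixes p :: "real poly"
  assumes "a < b" "\<And>t. a < ereal t \<Longrightarrow> ereal t < b \<Longrightarrow> poly p t \<noteq> 0"
  obtains c where "c \<noteq> 0" "\<And>t. a < ereal t \<Longrightarrow> ereal t < b \<Longrightarrow> sgn (poly p t) = c"
    "psgn p a \<in> {0, c}" "psgn p b \<in> {0, c}"
proof -
  have same: "sgn (poly p u) = sgn (poly p v)"
    if "a < ereal u" "ereal v < b" "u < v" for u v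
  proof (rule ccontr)
    assume ne: "\<not> ?thesis"
    have "poly p u \<noteq> 0" "poly p v \<noteq> 0" 
      using assms(2) that less_ereal_trans[of a u v] ereal_less_trans[of u v b] by auto
    then have "poly p u * poly p v < 0" using ne by (auto simp: sgn_if mult_less_0_iff split: if_splits)
    from poly_IVT[OF that(3) this] obtain x where x: "u < x" "x < v" "poly p x = 0" by blast
    have "a < ereal x" "ereal x < b" using x that less_ereal_trans[of a u x] ereal_less_trans[of x v b] by auto
    then show False using assms(2) x by blast
  qed
  obtain t0 where t0: "a < ereal t0" "ereal t0 < b" using ereal_dense2[OF assms(1)] by auto
  define c where "c = sgn (poly p t0)"
  have c0: "c \<noteq> 0" using assms(2)[OF t0] by (simp add: c_def sgn_0_0)
  have c: "sgn (poly p t) = c" if "a < ereal t" "ereal t < b" for t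
  proof (cases t t0 rule: linorder_cases)
    case less then show ?thesis using same[of t t0] that t0 by (simp add: c_def)
  next
    case greater then show ?thesis using same[of t0 t] that t0 by (simp add: c_def)
  qed (simp add: c_def)
  have p0: "p \<noteq> 0" using assms(2)[OF t0] by auto
  have lim: "sgn (poly p r) \<in> {0, c}" 
    if F: "\<forall>\<^sub>F x in F. sgn (poly p x) = c" "F \<noteq> bot" "(poly p \<longlongrightarrow> poly p r) F" for F r
  proof (cases "c = 1")
    case True
    then have "\<forall>\<^sub>F x in F. poly p x \<ge> 0" using F(1) by (auto elim!: eventually_mono simp: sgn_if split: if_splits)
    then have "poly p r \<ge> 0" using F tendsto_lowerbound by blast
    then show ?thesis using True by (auto simp: sgn_if)
  next
    case False
    then have cm: "c = -1" using c0 by (auto simp: c_def sgn_if split: if_splits)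
    then have "\<forall>\<^sub>F x in F. poly p x \<le> 0" using F(1) by (auto elim!: eventually_mono simp: sgn_if split: if_splits)
    then have "poly p r \<le> 0" using F tendsto_upperbound by blast
    then show ?thesis using cm by (auto simp: sgn_if)
  qed
  have tend: "(poly p \<longlongrightarrow> poly p r) (at r within S)" for r S
    by (intro tendsto_intros)
  have "psgn p a \<in> {0, c}"
  proof (cases a)
    case (real r)
    have "r < t0" using real t0 by simp
    have "\<forall>\<^sub>F x in at_right r. x \<in> {r<..<t0}" using \<open>r < t0\<close> by (rule eventually_at_right_real)
    then have "\<forall>\<^sub>F x in at_right r. sgn (poly p x) = c"
    proof (rule eventually_mono)
      fix x assume "x \<in> {r<..<t0}"
      then show "sgn (poly p x) = c" using c[of x] real t0(2) ereal_less_trans[of x t0 b] by simp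
    qed
    then show ?thesis using lim[OF _ _ tend] real by simp
  next
    case PInf then show ?thesis using t0 by simp
  next
    case MInf
    from sgn_at_MInf[OF p0]
    obtain n where n: "\<forall>x\<le>n. sgn (poly p x) = sgn (lead_coeff p) * (-1) ^ degree p" ..
    have n2: "sgn (poly p (min n t0)) = c"
      by (rule c) (use t0 MInf ereal_less_trans[of "min n t0" t0 b] in auto)
    have n1: "sgn (poly p (min n t0)) = sgn (lead_coeff p) * (-1) ^ degree p"
      by (rule n[rule_format]) simp
    have "psgn p a = c" unfolding MInf psgn_MInf by (rule trans[OF n1[symmetric] n2])
    then show ?thesis by blast
  qed
  moreover have "psgn p b \<in> {0, c}"
  proof (cases b)
    case (real r)
    have "t0 < r" using real t0 by simp
    have "\<forall>\<^sub>F x in at_left r. x \<in> {t0<..<r}" using \<open>t0 < r\<close> by (rule eventually_at_left_real)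
    then have "\<forall>\<^sub>F x in at_left r. sgn (poly p x) = c"
    proof (rule eventually_mono)
      fix x assume "x \<in> {t0<..<r}"
      then show "sgn (poly p x) = c" using c[of x] real t0(1) less_ereal_trans[of a t0 x] by simp
    qed
    then show ?thesis using lim[OF _ _ tend] real by simp
  next
    case MInf then show ?thesis using t0 by simp
  next
    case PInf
    from sgn_at_PInf[OF p0]
    obtain n where n: "\<forall>x\<ge>n. sgn (poly p x) = sgn (lead_coeff p)" ..
    have n2: "sgn (poly p (max n t0)) = c"
      by (rule c) (use t0 PInf less_ereal_trans[of a t0 "max n t0"] in \<open>auto simp: max_def\<close>)
    have n1: "sgn (poly p (max n t0)) = sgn (lead_coeff p)"
      by (rule n[rule_format]) simp
    have "psgn p b = c" unfolding PInf psgn_PInf by (rule trans[OF n1[symmetric] n2])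
    then show ?thesis by blast
  qed
  ultimately show ?thesis using that[OF c0 c] by blast
qed

text \<open>Two zeros in the closed interval would produce a zero of the derivative, so there is at
  most one. The end signs therefore decide everything: opposite signs mean exactly one zero inside,
  otherwise the nonzero end sign prevails. Both end signs cannot vanish, and at an infinite end the
  sign is never 0.\<close>

lemma sgn_piece:
  fixes p :: "real poly"
  assumes ab: "a < b" and nr: "\<And>t. a < ereal t \<Longrightarrow> ereal t < b \<Longrightarrow> poly (pderiv p) t \<noteq> 0"
  shows "if psgn p a * psgn p b < 0
         then \<exists>z. a < ereal z \<and> ereal z < b \<and> sgn (poly p z) = 0 \<and>
                (\<forall>t. a < ereal t \<and> t < z \<longrightarrow> sgn (poly p t) = psgn p a) \<and>
                (\<forall>t. z < t \<and> ereal t < b \<longrightarrow> sgn (poly p t) = psgn p b)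
         else (\<forall>t. a < ereal t \<and> ereal t < b \<longrightarrow>
                 sgn (poly p t) = (if psgn p a \<noteq> 0 then psgn p a else psgn p b))"
proof -
  have rolle: False if "a \<le> ereal u" and uv: "u < v" and "ereal v \<le> b" and "poly p u = 0" "poly p v = 0" for u v
  proof -
    obtain x where x: "u < x" "x < v" "poly p v - poly p u = (v - u) * poly (pderiv p) x"
      using poly_MVT[OF uv] by blast
    have "a < ereal x" "ereal x < b" 
      using x that(1,3) le_less_trans[of a "ereal u" "ereal x"] less_le_trans[of "ereal x" "ereal v" b] by auto
    then show False using nr x that by auto
  qed
  obtain t0 where t0: "a < ereal t0" "ereal t0 < b" using ereal_dense2[OF ab] by auto
  have p0: "p \<noteq> 0" using nr[OF t0] by auto
  have lc0: "psgn p \<infinity> \<noteq> 0" "psgn p (-\<infinity>) \<noteq> 0" using p0 by (auto simp: sgn_0_0)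
  show ?thesis
  proof (cases "\<exists>z. a < ereal z \<and> ereal z < b \<and> poly p z = 0")
    case True
    then obtain z where z: "a < ereal z" "ereal z < b" "poly p z = 0" by blast
    have n1: "poly p t \<noteq> 0" if "a < ereal t" "ereal t < ereal z" for t
      using rolle[of t z] that z by (auto simp: less_imp_le)
    have n2: "poly p t \<noteq> 0" if "ereal z < ereal t" "ereal t < b" for t
      using rolle[of z t] that z by (auto simp: less_imp_le)
    obtain c1 where c1: "c1 \<noteq> 0" "\<And>t. a < ereal t \<Longrightarrow> ereal t < ereal z \<Longrightarrow> sgn (poly p t) = c1"
      "psgn p a \<in> {0, c1}" using sgn_const_no_root[OF z(1) n1] by metis
    obtain c2 where c2: "c2 \<noteq> 0" "\<And>t. ereal z < ereal t \<Longrightarrow> ereal t < b \<Longrightarrow> sgn (poly p t) = c2"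
      "psgn p b \<in> {0, c2}" using sgn_const_no_root[OF z(2) n2] by metis
    have "psgn p a \<noteq> 0"
      using rolle[of _ z] z lc0 by (cases a) (auto simp: less_imp_le sgn_0_0)
    then have a1: "psgn p a = c1" using c1 by simp
    have "psgn p b \<noteq> 0"
      using rolle[of z] z lc0 by (cases b) (auto simp: less_imp_le sgn_0_0)
    then have b2: "psgn p b = c2" using c2 by simp
    obtain u where u: "a < ereal u" "ereal u < ereal z" using ereal_dense2[OF z(1)] by auto
    obtain v where v: "ereal z < ereal v" "ereal v < b" using ereal_dense2[OF z(2)] by auto
    have uv: "u < z" "z < v" using u v by auto
    \<comment> \<open>The derivative keeps one sign across \<open>z\<close>, which makes the signs
      of \<open>p\<close> on the two sides of \<open>z\<close> opposite.\<close>
    obtain d where d: "\<And>t. a < ereal t \<Longrightarrow> ereal t < b \<Longrightarrow> sgn (poly (pderiv p) t) = d"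
      using sgn_const_no_root[OF ab nr] by metis
    obtain x where x: "u < x" "x < z" "poly p z - poly p u = (z - u) * poly (pderiv p) x"
      using poly_MVT[OF uv(1)] by blast
    obtain y where y: "z < y" "y < v" "poly p v - poly p z = (v - z) * poly (pderiv p) y"
      using poly_MVT[OF uv(2)] by blast
    have "a < ereal x" "ereal x < b" "a < ereal y" "ereal y < b"
      using x y u v z less_ereal_trans[of a u x] less_ereal_trans[of a z y]
        ereal_less_trans[of x z b] ereal_less_trans[of y v b] by auto
    then have "sgn (poly (pderiv p) x) = sgn (poly (pderiv p) y)" using d by simp
    moreover have "sgn (poly p u) = - sgn (poly (pderiv p) x)"
    proof -
      have "poly p u = - ((z - u) * poly (pderiv p) x)" using x(3) z by simp
      then show ?thesis using uv by (simp add: sgn_mult sgn_minus)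
    qed
    moreover have "sgn (poly p v) = sgn (poly (pderiv p) y)"
      using y z uv by (simp add: sgn_mult)
    ultimately have "c1 = - c2" using c1(2)[OF u] c2(2)[OF v] by simp
    moreover have "c2 * c2 > 0" using c2(1) by (metis not_real_square_gt_zero)
    ultimately have "psgn p a * psgn p b < 0" using a1 b2 by simp
    then show ?thesis using z c1 c2 a1 b2 by auto
  next
    case False
    then have "\<And>t. a < ereal t \<Longrightarrow> ereal t < b \<Longrightarrow> poly p t \<noteq> 0" by blast
    from sgn_const_no_root[OF ab this] obtain c where c: "c \<noteq> 0"
      "\<And>t. a < ereal t \<Longrightarrow> ereal t < b \<Longrightarrow> sgn (poly p t) = c" "psgn p a \<in> {0, c}" "psgn p b \<in> {0, c}"
      by metis
    have "c * c > 0" using c(1) by (metis not_real_square_gt_zero)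
    then have "\<not> psgn p a * psgn p b < 0" using c by auto
    moreover have "\<not> (psgn p a = 0 \<and> psgn p b = 0)"
    proof
      assume z: "psgn p a = 0 \<and> psgn p b = 0"
      then obtain u v where "a = ereal u" "b = ereal v" using ab lc0 by (cases a; cases b) auto
      then show False using rolle[of u v] ab z by (auto simp: sgn_0_0)
    qed
    ultimately show ?thesis using c by auto
  qed
qed

section \<open>Refining a sign word by one further polynomial\<close>

definition piece :: "(real \<Rightarrow> 'b) \<Rightarrow> real \<Rightarrow> real \<Rightarrow> 'b list" where
  "piece e sa sb = (if sa * sb < 0 then [e sa, e 0, e sb] else [e (if sa \<noteq> 0 then sa else sb)])"

text \<open>Here \<open>V\<close> recognises letters at which one of the known polynomials vanishes, \<open>S\<close> reads off the sign
  of the new polynomial there, and \<open>N\<close> adds this sign to the letter. Breakpoints that are not zeros are dropped.\<close>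

fun expand :: "('a \<Rightarrow> bool) \<Rightarrow> ('a \<Rightarrow> real) \<Rightarrow> ('a \<Rightarrow> real \<Rightarrow> 'b) \<Rightarrow> real \<Rightarrow> 'a list \<Rightarrow> real \<Rightarrow> 'b list" where
  "expand V S N sa [] sb = []"
| "expand V S N sa [c] sb = piece (N c) sa sb"
| "expand V S N sa (c # d # w) sb =
     (if V d then piece (N c) sa (S d) @ N d (S d) # expand V S N (S d) w sb else expand V S N sa w sb)"

lemma infinite_ereal_interval:
  assumes "a < b" shows "infinite {t. a < ereal t \<and> ereal t < b}"
proof -
  obtain u where u: "a < ereal u" "ereal u < b" using ereal_dense2[OF assms] by auto
  obtain v where v: "ereal u < ereal v" "ereal v < b" using ereal_dense2[OF u(2)] by auto
  have "{u<..<v} \<subseteq> {t. a < ereal t \<and> ereal t < b}"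
    using u v less_ereal_trans[of a u] ereal_less_trans[of _ v b] by auto
  moreover have "infinite {u<..<v}" using v by simp
  ultimately show ?thesis using finite_subset by blast
qed

context
  fixes p :: "real poly" and \<sigma> :: "real \<Rightarrow> 'a" and \<tau> :: "real \<Rightarrow> 'b" and V S N
  assumes S: "\<And>t. V (\<sigma> t) \<Longrightarrow> S (\<sigma> t) = sgn (poly p t)"
    and \<tau>: "\<And>t. \<tau> t = N (\<sigma> t) (sgn (poly p t))"
    and fin: "finite {t. V (\<sigma> t)}"
    and crit: "\<And>t. poly (pderiv p) t = 0 \<Longrightarrow> V (\<sigma> t)"
    and N: "\<And>u v. u < v \<Longrightarrow> (\<And>t. u \<le> t \<Longrightarrow> t \<le> v \<Longrightarrow> \<not> V (\<sigma> t)) \<Longrightarrow> N (\<sigma> u) = N (\<sigma> v)"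
begin

text \<open>Without letters in \<open>V\<close> the derivative has no zero, by \<open>crit\<close>,
  so \<open>sgn_piece\<close> applies; the old part of the letter is constant by the assumption
  \<open>N\<close>. Hence only the sign of \<open>p\<close> varies, in the pattern listed by
  \<open>piece\<close>.\<close>

lemma word_piece:
  assumes ab: "a < b" and nV: "\<And>t. a < ereal t \<Longrightarrow> ereal t < b \<Longrightarrow> \<not> V (\<sigma> t)"
    and t0: "a < ereal t0" "ereal t0 < b"
  shows "word \<tau> a b (piece (N (\<sigma> t0)) (psgn p a) (psgn p b))"
proof -
  have "poly (pderiv p) t \<noteq> 0" if "a < ereal t" "ereal t < b" for t
    using crit nV that by blast
  note * = sgn_piece[OF ab this]
  have N': "N (\<sigma> t) = N (\<sigma> t0)" if t: "a < ereal t" "ereal t < b" for t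
  proof (cases t t0 rule: linorder_cases)
    case less
    then show ?thesis using t t0 
      by (intro N nV) (auto intro: less_ereal_trans[of a t] ereal_less_trans[of _ t0 b])
  next
    case greater
    then show ?thesis using t t0 
      by (intro N[symmetric] nV) (auto intro: less_ereal_trans[of a t0] ereal_less_trans[of _ t b])
  qed simp
  show ?thesis
  proof (cases "psgn p a * psgn p b < 0")
    case True
    then obtain z where z: "a < ereal z" "ereal z < b" "sgn (poly p z) = 0"
       "\<And>t. a < ereal t \<Longrightarrow> t < z \<Longrightarrow> sgn (poly p t) = psgn p a"
       "\<And>t. z < t \<Longrightarrow> ereal t < b \<Longrightarrow> sgn (poly p t) = psgn p b"
      using * by auto
    have "\<tau> t = N (\<sigma> t0) (psgn p a)" if "a < ereal t" "t < z" for t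
      using N'[of t] z(4)[of t] that \<tau> ereal_less_trans[of t z b] z(2) by auto
    moreover have "\<tau> t = N (\<sigma> t0) (psgn p b)" if "z < t" "ereal t < b" for t
      using N'[of t] z(5)[of t] that \<tau> less_ereal_trans[of a z t] z(1) by auto
    moreover have "\<tau> z = N (\<sigma> t0) 0" using N'[of z] z \<tau> by simp
    ultimately show ?thesis using True z(1,2) by (auto simp: piece_def intro!: exI[of _ z])
  next
    case False
    then show ?thesis using * N' \<tau> ab by (auto simp: piece_def)
  qed
qed

text \<open>\<open>\<alpha>\<close> is the last breakpoint that was kept and \<open>a\<close> the
  current position in the old word. Skipped breakpoints let \<open>a\<close> run ahead of
  \<open>\<alpha>\<close>, so the induction has to carry both.\<close>

lemma word_expand:
  "word \<sigma> a b w \<Longrightarrow> \<alpha> \<le> a \<Longrightarrow> (\<And>t. \<alpha> < ereal t \<Longrightarrow> ereal t \<le> a \<Longrightarrow> \<not> V (\<sigma> t)) \<Longrightarrow>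
    word \<tau> \<alpha> b (expand V S N (psgn p \<alpha>) w (psgn p b))"
proof (induction w arbitrary: a \<alpha> rule: induct_list012)
  case 1 then show ?case by simp
next
  case (2 c)
  then have ab: "a < b" and c: "\<And>t. a < ereal t \<Longrightarrow> ereal t < b \<Longrightarrow> \<sigma> t = c" by auto
  \<comment> \<open>Otherwise \<open>V\<close> would hold on a whole nonempty open interval, but it
    holds at finitely many points only.\<close>
  have "\<not> V c"
    using finite_subset[OF _ fin] infinite_ereal_interval[OF ab] c by (metis (mono_tags, lifting) mem_Collect_eq subsetI)
  then have nV: "\<not> V (\<sigma> t)" if "\<alpha> < ereal t" "ereal t < b" for t
    using 2(3)[of t] c[of t] that by (cases "ereal t \<le> a") auto
  obtain t0 where t0: "a < ereal t0" "ereal t0 < b" using ereal_dense2[OF ab] by auto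
  have "\<alpha> < b" "\<alpha> < ereal t0" using 2(2) ab t0 by auto
  from word_piece[OF this(1) nV this(2) t0(2)] show ?case using c[OF t0] by simp
next
  case (3 c d w)
  then obtain z where z: "a < ereal z" "\<And>t. a < ereal t \<Longrightarrow> t < z \<Longrightarrow> \<sigma> t = c" "\<sigma> z = d" "word \<sigma> (ereal z) b w" by auto
  have "\<not> V c"
    using finite_subset[OF _ fin] infinite_ereal_interval[OF z(1)] z(2) 
    by (metis (mono_tags, lifting) mem_Collect_eq subsetI less_ereal.simps(1))
  then have nV: "\<not> V (\<sigma> t)" if "\<alpha> < ereal t" "ereal t < ereal z" for t
    using 3(5)[of t] z(2)[of t] that by (cases "ereal t \<le> a") auto
  have \<alpha>z: "\<alpha> < ereal z" using 3(4) z by auto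
  show ?case
  proof (cases "V d")
    case True
    obtain t0 where t0: "a < ereal t0" "ereal t0 < ereal z" using ereal_dense2[OF z(1)] by auto
    have "\<alpha> < ereal t0" using 3(4) t0 by auto
    from word_piece[OF \<alpha>z nV this t0(2)]
    have "word \<tau> \<alpha> (ereal z) (piece (N c) (psgn p \<alpha>) (psgn p (ereal z)))" using z(2)[of t0] t0 by simp
    moreover have "S d = sgn (poly p z)" using S[of z] True z by simp
    moreover have "\<tau> z = N d (S d)" using \<tau> z(3) calculation by simp
    moreover have "word \<tau> (ereal z) b (expand V S N (psgn p (ereal z)) w (psgn p b))"
      by (rule 3(1)[OF z(4)]) auto
    ultimately show ?thesis using True by (auto intro!: word_append)
  next
    case False
    have "\<not> V (\<sigma> t)" if "\<alpha> < ereal t" "ereal t \<le> ereal z" for t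
      using nV[of t] False z(3) that by (cases "t = z") auto
    then show ?thesis using 3(1)[OF z(4), of \<alpha>] \<alpha>z False by simp
  qed
qed

end

section \<open>Cohen-Hoermander elimination\<close>

definition sv :: "(('i \<Rightarrow> real) \<Rightarrow> real poly) set \<Rightarrow> ('i \<Rightarrow> real) \<Rightarrow> real \<Rightarrow> (('i \<Rightarrow> real) \<Rightarrow> real poly) \<Rightarrow> real" where
  "sv L x t = (\<lambda>P. if P \<in> L then sgn (poly (P x) t) else 0)"

text \<open>The termination order of the elimination: one entry of the multiset of formal degrees is
  replaced by finitely many smaller ones. Members of \<open>S\<close> that already lie in
  \<open>L - {P}\<close> must not be counted twice, hence the set difference in the proof.\<close>

lemma lv_mult_decrease:
  assumes "finite L" "P \<in> L" "finite S" "\<And>Q. Q \<in> S \<Longrightarrow> lv Q < lv P"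
  shows "(image_mset lv (mset_set (L - {P} \<union> S)), image_mset lv (mset_set L)) \<in> mult less_than"
proof -
  have "mset_set L = mset_set (L - {P}) + {#P#}"
    using assms(1,2) mset_set.remove by (metis add_mset_add_single)
  moreover have "mset_set (L - {P} \<union> S) = mset_set (L - {P}) + mset_set (S - (L - {P}))"
    using assms by (subst mset_set_Union[symmetric]) auto
  moreover have "(image_mset lv (mset_set (L - {P})) + image_mset lv (mset_set (S - (L - {P}))),
     image_mset lv (mset_set (L - {P})) + image_mset lv {#P#}) \<in> mult less_than"
    by (rule one_step_implies_mult) (use assms in auto)
  ultimately show ?thesis by simp
qed

lemma sgn_eq_no_root:
  fixes p :: "real poly"
  assumes "u < v" "\<And>t. u \<le> t \<Longrightarrow> t \<le> v \<Longrightarrow> poly p t \<noteq> 0"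
  shows "sgn (poly p u) = sgn (poly p v)"
proof (rule ccontr)
  assume "\<not> ?thesis"
  then have "poly p u * poly p v < 0" using assms(2)[of u] assms(2)[of v] assms(1)
    by (auto simp: sgn_if mult_less_0_iff split: if_splits)
  from poly_IVT[OF assms(1) this] show False using assms(2) by (auto simp: less_imp_le)
qed

text \<open>Cohen-Hoermander step for a polynomial \<open>p\<close> of maximal degree. Replace \<open>p\<close> by its derivative and by its
  remainders modulo the other polynomials: at a zero of \<open>q\<close> the sign of \<open>p\<close> is that of the remainder,
  and between consecutive zeros \<open>p\<close> is strictly monotone.\<close>

lemma sign_word_exists_lead:
  fixes L :: "(('i \<Rightarrow> real) \<Rightarrow> real poly) set"
  assumes fin: "finite L" and sub: "L \<subseteq> ppoly" and lv1: "\<And>P. P \<in> L \<Longrightarrow> lv P \<ge> 1"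
    and IH: "\<And>P S. P \<in> L \<Longrightarrow> finite S \<Longrightarrow> S \<subseteq> ppoly \<Longrightarrow> (\<And>Q. Q \<in> S \<Longrightarrow> lv Q < lv P) \<Longrightarrow>
       \<exists>F. sign_determined F \<and> (\<forall>x. word (sv (L - {P} \<union> S) x) (-\<infinity>) \<infinity> (F x))"
  shows "\<exists>F. sign_determined F \<and> (\<forall>x. (\<forall>P\<in>L. coeff (P x) (lv P - 1) \<noteq> 0) \<longrightarrow> word (sv L x) (-\<infinity>) \<infinity> (F x))"
proof (cases "\<exists>P\<in>L. lv P \<ge> 2")
  case False
  define F where "F = (\<lambda>x. [\<lambda>P::('i \<Rightarrow> real) \<Rightarrow> real poly. if P \<in> L then sgn (coeff (P x) 0) else 0])"
  have "sign_determined F"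
    by (rule sign_determined_family[OF fin, of "\<lambda>P x. sgn (coeff (P x) 0)"])
       (use sub ppoly_coeff in \<open>auto intro!: sign_determined_sgn simp: F_def fun_eq_iff\<close>)
  moreover have "poly (P x) t = coeff (P x) 0" if "P \<in> L" for P x t
  proof -
    have "degree (P x) = 0"
    proof (rule ccontr)
      assume "degree (P x) \<noteq> 0"
      then have "coeff (P x) (degree (P x)) \<noteq> 0" by (metis degree_0 leading_coeff_0_iff)
      moreover have "degree (P x) \<ge> lv P" using False that \<open>degree (P x) \<noteq> 0\<close> by force
      ultimately show False using lv_coeff sub that by blast
    qed
    then show ?thesis by (metis coeff_pCons_0 degree_0_id degree_eq_zeroE poly_pCons mult_zero_right poly_0 add.right_neutral)
  qed
  then have "word (sv L x) (-\<infinity>) \<infinity> (F x)" for x by (auto simp: F_def sv_def fun_eq_iff)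
  ultimately show ?thesis by blast
next
  case True
  then have "Max (lv ` L) \<in> lv ` L" using fin by (intro Max_in) auto
  then obtain p where p: "p \<in> L" "lv p = Max (lv ` L)" by force
  have pmax: "lv q \<le> lv p" if "q \<in> L" for q using that fin p(2) by simp
  have p2: "lv p \<ge> 2" using True pmax by force
  have pp: "p \<in> ppoly" using p sub by blast
  define p' where "p' = (\<lambda>x. pderiv (p x))"
  have p': "p' \<in> ppoly" "lv p' < lv p" unfolding p'_def
    using ppoly_pderiv[OF pp] lv_pderiv[OF pp] p2 by auto
  define Q where "Q = L - {p} \<union> {p'}"
  have Qpp: "q \<in> ppoly" if "q \<in> Q" for q using that sub p' by (auto simp: Q_def)
  have "\<exists>R\<in>ppoly. lv R < lv p \<and> (\<forall>x t. coeff (q x) (lv q - 1) \<noteq> 0 \<longrightarrow> poly (q x) t = 0 \<longrightarrow>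
           sgn (poly (R x) t) = sgn (poly (p x) t))" if q: "q \<in> Q" for q
  proof (cases "lv q \<ge> 1")
    case True
    have "lv q \<le> lv p" using q pmax p' by (auto simp: Q_def)
    then show ?thesis using prem_exists[OF pp Qpp[OF q] True] by (meson less_le_trans)
  next
    \<comment> \<open>Here \<open>lv q = 0\<close>, so \<open>q\<close> is identically zero. Since
      \<open>lv q - 1\<close> is 0 in the natural numbers, the premise on the leading coefficient
      fails, and any choice with a small \<open>lv\<close> will do.\<close>
    case False
    then show ?thesis using lv_coeff[OF Qpp[OF q]] p2 Qpp[OF q] by (intro bexI[of _ q]) auto
  qed
  then obtain R where R: "\<And>q. q \<in> Q \<Longrightarrow> R q \<in> ppoly" "\<And>q. q \<in> Q \<Longrightarrow> lv (R q) < lv p"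
    "\<And>q x t. q \<in> Q \<Longrightarrow> coeff (q x) (lv q - 1) \<noteq> 0 \<Longrightarrow> poly (q x) t = 0 \<Longrightarrow>
           sgn (poly (R q x) t) = sgn (poly (p x) t)"
    by metis
  define T where "T = {p'} \<union> R ` Q"
  have T: "finite T" "T \<subseteq> ppoly" "\<And>q. q \<in> T \<Longrightarrow> lv q < lv p"
    using R p' fin by (auto simp: T_def Q_def)
  define L' where "L' = L - {p} \<union> T"
  obtain F' where F': "sign_determined F'" "\<And>x. word (sv L' x) (-\<infinity>) \<infinity> (F' x)"
    using IH[OF p(1) T] unfolding L'_def by blast
  \<comment> \<open>A letter is a sign vector for \<open>L'\<close>, which contains \<open>Q\<close>
    and all the remainders. Where some \<open>q\<close> in \<open>Q\<close> vanishes, the sign of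
    \<open>p\<close> is that of \<open>R q\<close>; the choice of \<open>q\<close> depends on the
    letter alone, which makes \<open>S\<close> a function of letters.\<close>
  define V where "V = (\<lambda>d::(('i \<Rightarrow> real) \<Rightarrow> real poly) \<Rightarrow> real. \<exists>q\<in>Q. d q = 0)"
  define S where "S = (\<lambda>d::(('i \<Rightarrow> real) \<Rightarrow> real poly) \<Rightarrow> real. d (R (SOME q. q \<in> Q \<and> d q = 0)))"
  define N where "N = (\<lambda>(d::(('i \<Rightarrow> real) \<Rightarrow> real poly) \<Rightarrow> real) s P. if P = p then s else if P \<in> L then d P else 0)"
  define lp where "lp = (\<lambda>x. sgn (coeff (p x) (lv p - 1)))"
  \<comment> \<open>Where the formal leading coefficient does not vanish, the degree of
    \<open>p x\<close> is exactly \<open>lv p - 1\<close>, so these are the signs of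
    \<open>p x\<close> at the two infinities.\<close>
  define F where "F = (\<lambda>x. expand V S N (lp x * (-1) ^ (lv p - 1)) (F' x) (lp x))"
  have "sign_determined lp" unfolding lp_def by (intro sign_determined_sgn ppoly_coeff pp)
  then have "sign_determined F" unfolding F_def
    using sign_determined_comp2[OF F'(1), of lp "\<lambda>w s. expand V S N (s * (-1) ^ (lv p - 1)) w s"] by simp
  moreover have "word (sv L x) (-\<infinity>) \<infinity> (F x)" if x: "\<forall>P\<in>L. coeff (P x) (lv P - 1) \<noteq> 0" for x
  proof -
    have deg: "degree (p x) = lv p - 1"
    proof (rule antisym)
      show "degree (p x) \<le> lv p - 1" using lv_coeff[OF pp] p2 by (intro degree_le) auto
      show "lv p - 1 \<le> degree (p x)" using x p(1) by (intro le_degree) auto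
    qed
    \<comment> \<open>The derivative inherits a nonvanishing formal leading coefficient, so the
      remainder modulo \<open>p'\<close> is usable at this \<open>x\<close> as well.\<close>
    have p'c: "coeff (p' x) (lv p - 2) \<noteq> 0"
    proof -
      have "Suc (lv p - 2) = lv p - 1" using p2 by simp
      moreover have "coeff (p x) (lv p - 1) \<noteq> 0" using x p(1) by blast
      ultimately show ?thesis by (simp add: p'_def coeff_pderiv)
    qed
    have lvp': "lv p' - 1 = lv p - 2" 
    proof -
      have "\<not> lv p - 2 \<ge> lv p'" using lv_coeff[OF p'(1)] p'c by blast
      then show ?thesis using p'(2) by linarith
    qed
    have qx: "coeff (q x) (lv q - 1) \<noteq> 0" if "q \<in> Q" for q
      using that x p'c lvp' by (auto simp: Q_def)
    have QL': "q \<in> L'" "R q \<in> L'" if "q \<in> Q" for q using that by (auto simp: L'_def T_def Q_def)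
    have V: "V (sv L' x t) \<longleftrightarrow> (\<exists>q\<in>Q. poly (q x) t = 0)" for t
      using QL' by (auto simp: V_def sv_def sgn_0_0)
    have "word (sv L x) (-\<infinity>) \<infinity> (expand V S N (psgn (p x) (-\<infinity>)) (F' x) (psgn (p x) \<infinity>))"
    proof (rule word_expand[where \<sigma> = "sv L' x" and a = "-\<infinity>"])
      fix t assume "V (sv L' x t)"
      then have "\<exists>q. q \<in> Q \<and> sv L' x t q = 0" by (auto simp: V_def)
      from someI_ex[OF this] obtain q where q: "q = (SOME q. q \<in> Q \<and> sv L' x t q = 0)"
        "q \<in> Q" "sv L' x t q = 0" by blast
      then show "S (sv L' x t) = sgn (poly (p x) t)"
        unfolding S_def q(1)[symmetric] using R(3)[OF q(2) qx[OF q(2)]] QL'[OF q(2)] by (simp add: sv_def sgn_0_0)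
    next
      fix t show "sv L x t = N (sv L' x t) (sgn (poly (p x) t))"
        using p(1) by (intro ext) (auto simp: sv_def N_def L'_def)
    next
      have "{t. V (sv L' x t)} = (\<Union>q\<in>Q. {t. poly (q x) t = 0})" using V by auto
      moreover have "finite {t. poly (q x) t = 0}" if "q \<in> Q" for q
        using qx[OF that] by (intro poly_roots_finite) auto
      ultimately show "finite {t. V (sv L' x t)}" using fin by (auto simp: Q_def)
    next
      fix t assume "poly (pderiv (p x)) t = 0"
      then show "V (sv L' x t)" unfolding V by (intro bexI[of _ p']) (auto simp: Q_def p'_def)
    next
      fix u v :: real assume uv: "u < v" "\<And>t. u \<le> t \<Longrightarrow> t \<le> v \<Longrightarrow> \<not> V (sv L' x t)"
      have "sgn (poly (P x) u) = sgn (poly (P x) v)" if "P \<in> L - {p}" for P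
        using uv that V by (intro sgn_eq_no_root) (auto simp: Q_def)
      then show "N (sv L' x u) = N (sv L' x v)" by (auto simp: N_def sv_def fun_eq_iff)
    qed (use F' in auto)
    then show ?thesis by (simp add: F_def deg lp_def)
  qed
  ultimately show ?thesis by blast
qed

text \<open>Well-founded induction on the multiset of formal degrees. If some leading coefficient
  vanishes at \<open>x\<close>, the polynomial may be replaced by its truncation there; if none
  does, the preceding lemma applies. Which case holds is itself decided by signs of the leading
  coefficients, so the combined word is still sign determined.\<close>

lemma sign_word_exists:
  fixes L :: "(('i \<Rightarrow> real) \<Rightarrow> real poly) set"
  shows "finite L \<Longrightarrow> L \<subseteq> ppoly \<Longrightarrow> \<exists>F. sign_determined F \<and> (\<forall>x. word (sv L x) (-\<infinity>) \<infinity> (F x))"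
proof (induction L rule: wf_induct_rule[OF wf_inv_image[OF wf_mult[OF wf_less_than], of "\<lambda>L. image_mset lv (mset_set L)"]])
  case (1 L)
  have IH: "\<exists>F. sign_determined F \<and> (\<forall>x. word (sv (L - {P} \<union> S) x) (-\<infinity>) \<infinity> (F x))"
    if "P \<in> L" "finite S" "S \<subseteq> ppoly" "\<And>Q. Q \<in> S \<Longrightarrow> lv Q < lv P" for P S
    using that 1(2,3) lv_mult_decrease[OF 1(2) that(1,2,4)] by (intro 1(1)) auto
  show ?case
  proof (cases "\<exists>P\<in>L. lv P = 0")
    case True
    then obtain P where P: "P \<in> L" "lv P = 0" by blast
    then have "P x = 0" for x using lv_coeff[of P] 1(3) by (auto intro!: poly_eqI)
    \<comment> \<open>The default value 0 of \<open>sv\<close> off the set agrees with the sign of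
      the zero polynomial, so dropping \<open>P\<close> leaves the sign vector unchanged.\<close>
    then have "sv (L - {P} \<union> {}) = sv L" by (auto simp: sv_def fun_eq_iff)
    then show ?thesis using IH[OF P(1), of "{}"] by auto
  next
    case False
    define ld where "ld = (\<lambda>(P::('i \<Rightarrow> real) \<Rightarrow> real poly) x. coeff (P x) (lv P - 1))"
    define tr where "tr = (\<lambda>(P::('i \<Rightarrow> real) \<Rightarrow> real poly) x. P x - monom (ld P x) (lv P - 1))"
    have tr: "tr P \<in> ppoly \<and> lv (tr P) < lv P" if "P \<in> L" for P
    proof
      have P: "P \<in> ppoly" "lv P \<ge> 1" using that 1(3) False by auto
      show "tr P \<in> ppoly" unfolding tr_def ld_def by (intro ppoly_diff ppoly_monom ppoly_coeff P)
      have "lv (tr P) \<le> lv P - 1"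
      proof (rule lv_le)
        fix x k assume "lv P - 1 \<le> k"
        then have "k = lv P - 1 \<or> k \<ge> lv P" by auto
        then show "coeff (tr P x) k = 0" using lv_coeff[OF P(1)] P(2) by (auto simp: tr_def ld_def)
      qed
      then show "lv (tr P) < lv P" using P by linarith
    qed
    have "\<exists>F. sign_determined F \<and> (\<forall>x. word (sv (L - {P} \<union> {tr P}) x) (-\<infinity>) \<infinity> (F x))" if "P \<in> L" for P
      using tr[OF that] by (intro IH that) auto
    then obtain Fd where Fd: "\<And>P. P \<in> L \<Longrightarrow> sign_determined (Fd P)"
      "\<And>P x. P \<in> L \<Longrightarrow> word (sv (L - {P} \<union> {tr P}) x) (-\<infinity>) \<infinity> (Fd P x)" by metis
    have "1 \<le> lv P" if "P \<in> L" for P using False that by force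
    from sign_word_exists_lead[OF 1(2,3) this IH] obtain F0 where F0: "sign_determined F0"
      "\<And>x. (\<forall>P\<in>L. ld P x \<noteq> 0) \<Longrightarrow> word (sv L x) (-\<infinity>) \<infinity> (F0 x)" unfolding ld_def by blast
    \<comment> \<open>\<open>G P\<close> copies the sign of the truncation back to \<open>P\<close>
      and clears entries off \<open>L\<close>. In \<open>D\<close>, the default
      \<open>undefined\<close> makes the table depend on the finitely many members of
      \<open>L\<close> only.\<close>
    define G where "G = (\<lambda>P (c::(('i \<Rightarrow> real) \<Rightarrow> real poly) \<Rightarrow> real) M. if M = P then c (tr P) else if M \<in> L then c M else 0)"
    define D where "D = (\<lambda>x P. if P \<in> L then (sgn (ld P x), Fd P x) else undefined)"
    define F where "F = (\<lambda>x. if \<exists>P\<in>L. fst (D x P) = 0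
        then let P = SOME P. P \<in> L \<and> fst (D x P) = 0 in map (G P) (snd (D x P)) else F0 x)"
    have "sign_determined (\<lambda>x. (sgn (ld P x), Fd P x))" if "P \<in> L" for P
      using that 1(3) Fd(1) unfolding ld_def
      by (intro sign_determined_comp2[where H = Pair] sign_determined_sgn ppoly_coeff) auto
    then have "sign_determined D"
      by (rule sign_determined_family[OF 1(2)]) (auto simp: D_def fun_eq_iff)
    from sign_determined_comp2[OF this F0(1)] have "sign_determined F"
      unfolding F_def .
    moreover have "word (sv L x) (-\<infinity>) \<infinity> (F x)" for x
    proof (cases "\<exists>P\<in>L. fst (D x P) = 0")
      case True
      define P where "P = (SOME P. P \<in> L \<and> fst (D x P) = 0)"
      have "\<exists>P. P \<in> L \<and> fst (D x P) = 0" using True by blast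
      from someI_ex[OF this] have P: "P \<in> L" "ld P x = 0" unfolding P_def[symmetric] by (auto simp: D_def sgn_0_0)
      have "sv L x = (\<lambda>t. G P (sv (L - {P} \<union> {tr P}) x t))"
        using P by (intro ext) (auto simp: sv_def G_def tr_def)
      moreover have "F x = map (G P) (Fd P x)"
        unfolding F_def P_def[symmetric] Let_def using True P(1) by (simp add: D_def)
      ultimately show ?thesis using word_map[OF Fd(2)[OF P(1), of x], where f = "G P"] by simp
    next
      case False
      then show ?thesis using F0(2)[of x] by (auto simp: F_def D_def sgn_0_0)
    qed
    ultimately show ?thesis by blast
  qed
qed

text \<open>The Tarski-Seidenberg theorem.\<close>

theorem sign_determined_ex:
  assumes "sign_determined B"
  shows "sign_determined (\<lambda>x. \<exists>t. B (x(i := t)))"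
proof -
  obtain ps where ps: "ps \<subseteq> poly_funs" "finite ps" 
    "\<And>x y. (\<forall>p\<in>ps. sgn (p x) = sgn (p y)) \<Longrightarrow> B x = B y"
    using assms unfolding sign_determined_def by auto
  obtain P where P: "\<And>p. p \<in> ps \<Longrightarrow> P p \<in> ppoly" "\<And>p x t. p \<in> ps \<Longrightarrow> p (x(i := t)) = poly (P p x) t"
    using poly_fun_as_ppoly[of _ i] ps(1) by (metis subsetD)
  obtain F where F: "sign_determined F" "\<And>x. word (sv (P ` ps) x) (-\<infinity>) \<infinity> (F x)"
    using sign_word_exists[of "P ` ps"] P(1) ps(2) by auto
  \<comment> \<open>Truth of \<open>B\<close> read from a letter: some point with these signs
    satisfies \<open>B\<close>. As the signs determine \<open>B\<close>, any such point gives the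
    same answer as \<open>x(i := t)\<close>.\<close>
  define \<Psi> where "\<Psi> = (\<lambda>c. \<exists>y. B y \<and> (\<forall>p\<in>ps. sgn (p y) = c (P p)))"
  have \<Psi>: "\<Psi> (sv (P ` ps) x t) \<longleftrightarrow> B (x(i := t))" for x t
  proof
    assume "\<Psi> (sv (P ` ps) x t)"
    then obtain y where y: "B y" "\<forall>p\<in>ps. sgn (p y) = sgn (p (x(i := t)))" 
      unfolding \<Psi>_def sv_def using P(2) by auto
    then show "B (x(i := t))" using ps(3) by blast
  next
    assume "B (x(i := t))"
    then show "\<Psi> (sv (P ` ps) x t)" unfolding \<Psi>_def sv_def using P(2) by auto
  qed
  have "(\<exists>t. B (x(i := t))) \<longleftrightarrow> (\<exists>c\<in>set (F x). \<Psi> c)" for x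
    using word_cover[OF F(2)[of x]] word_attained[OF F(2)[of x]] \<Psi>[of x] by (metis MInfty_neq_ereal(1) ereal_infty_less(1) ereal_infty_less(2) PInfty_neq_ereal(1))
  then show ?thesis using sign_determined_comp[OF F(1), of "\<lambda>w. \<exists>c\<in>set w. \<Psi> c"] by simp
qed

lemma sign_determined_ex_finite:
  assumes "finite J" "sign_determined B"
  shows "sign_determined (\<lambda>x. \<exists>y. (\<forall>i. i \<notin> J \<longrightarrow> y i = x i) \<and> B y)"
  using assms(1)
proof (induction J rule: finite_induct)
  case empty
  have "(\<lambda>x. \<exists>y. (\<forall>i. i \<notin> {} \<longrightarrow> y i = x i) \<and> B y) = B" 
    by (intro ext) (metis empty_iff ext)
  then show ?case using assms(2) by simp
next
  case (insert j J)
  have "(\<exists>y. (\<forall>i. i \<notin> insert j J \<longrightarrow> y i = x i) \<and> B y) \<longleftrightarrow>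
        (\<exists>t. \<exists>y. (\<forall>i. i \<notin> J \<longrightarrow> y i = (x(j := t)) i) \<and> B y)" for x
  proof
    assume "\<exists>y. (\<forall>i. i \<notin> insert j J \<longrightarrow> y i = x i) \<and> B y"
    then obtain y where "\<forall>i. i \<notin> insert j J \<longrightarrow> y i = x i" "B y" by blast
    then show "\<exists>t. \<exists>y. (\<forall>i. i \<notin> J \<longrightarrow> y i = (x(j := t)) i) \<and> B y"
      by (intro exI[of _ "y j"] exI[of _ y]) auto
  next
    assume "\<exists>t. \<exists>y. (\<forall>i. i \<notin> J \<longrightarrow> y i = (x(j := t)) i) \<and> B y"
    then obtain t y where "\<forall>i. i \<notin> J \<longrightarrow> y i = (x(j := t)) i" "B y" by blast
    then show "\<exists>y. (\<forall>i. i \<notin> insert j J \<longrightarrow> y i = x i) \<and> B y"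
      by (intro exI[of _ y]) auto
  qed
  then show ?case using sign_determined_ex[OF insert.IH, of j] by simp
qed

text \<open>Each sign vector attained on the set gives one basic set, and there are finitely many
  vectors because each of finitely many polynomials has three possible signs.\<close>

lemma sign_determined_imp_semialgebraic:
  assumes "sign_determined B"
  shows "semialgebraic_in I {x. (\<forall>i. i \<notin> I \<longrightarrow> x i = 0) \<and> B x}"
proof -
  obtain ps where ps: "ps \<subseteq> poly_funs" "finite ps" 
    "\<And>x y. (\<forall>p\<in>ps. sgn (p x) = sgn (p y)) \<Longrightarrow> B x = B y"
    using assms unfolding sign_determined_def by auto
  define \<sigma> where "\<sigma> = (\<lambda>x. restrict (\<lambda>p. sgn (p x)) ps)"
  \<comment> \<open>A basic set has a single equation, so the polynomials that must vanish are
    combined into a sum of squares.\<close>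
  define eq where "eq = (\<lambda>s x. \<Sum>p\<in>{p\<in>ps. s p = (0::real)}. p x * p x)"
  define ineq where "ineq = (\<lambda>s::(('a \<Rightarrow> real) \<Rightarrow> real) \<Rightarrow> real. {p\<in>ps. s p = 1} \<union> (\<lambda>p x. - p x) ` {p\<in>ps. s p = -1})"
  define F where "F = (\<lambda>s. (eq s, ineq s)) ` \<sigma> ` {x. B x}"
  have sgn3: "sgn r \<in> {-1, 0, 1}" for r :: real by (auto simp: sgn_if)
  then have "\<sigma> ` {x. B x} \<subseteq> ps \<rightarrow>\<^sub>E {-1, 0, 1}" 
    unfolding \<sigma>_def by (intro image_subsetI) (simp only: restrict_PiE_iff, blast)
  moreover have "finite (ps \<rightarrow>\<^sub>E {-1, 0, 1::real})" using ps(2) by (intro finite_PiE) auto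
  ultimately have "finite F" unfolding F_def using finite_subset by blast
  moreover have "eq s \<in> poly_funs" for s
    unfolding eq_def using ps by (intro poly_funs_sum) (auto intro!: poly_funs.mult)
  moreover have "finite (ineq s) \<and> ineq s \<subseteq> poly_funs" for s
    using ps poly_funs_uminus by (auto simp: ineq_def)
  moreover have iff: "eq (\<sigma> y) x = 0 \<and> (\<forall>q\<in>ineq (\<sigma> y). q x > 0) \<longleftrightarrow> (\<forall>p\<in>ps. sgn (p x) = sgn (p y))" for x y
  proof -
    have "eq (\<sigma> y) x = 0 \<longleftrightarrow> (\<forall>p\<in>ps. sgn (p y) = 0 \<longrightarrow> sgn (p x) = 0)"
      unfolding eq_def using ps(2) by (subst sum_nonneg_eq_0_iff) (auto simp: \<sigma>_def sgn_0_0)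
    moreover have "(\<forall>q\<in>ineq (\<sigma> y). q x > 0) \<longleftrightarrow>
       (\<forall>p\<in>ps. (sgn (p y) = 1 \<longrightarrow> sgn (p x) = 1) \<and> (sgn (p y) = -1 \<longrightarrow> sgn (p x) = -1))"
      unfolding ineq_def ball_Un ball_simps(9) by (auto simp: \<sigma>_def sgn_1_pos sgn_1_neg)
    moreover have "(\<forall>p\<in>ps. sgn (p x) = sgn (p y)) \<longleftrightarrow> (\<forall>p\<in>ps. (sgn (p y) = 0 \<longrightarrow> sgn (p x) = 0) \<and>
       (sgn (p y) = 1 \<longrightarrow> sgn (p x) = 1) \<and> (sgn (p y) = -1 \<longrightarrow> sgn (p x) = -1))"
      using sgn3 by (intro ball_cong refl) (metis empty_iff insert_iff)
    ultimately show ?thesis by blast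
  qed
  have "(\<exists>(p, Q)\<in>F. p x = 0 \<and> (\<forall>q\<in>Q. q x > 0)) \<longleftrightarrow> B x" for x
  proof -
    have "(\<exists>(p, Q)\<in>F. p x = 0 \<and> (\<forall>q\<in>Q. q x > 0)) \<longleftrightarrow> (\<exists>y. B y \<and> (\<forall>p\<in>ps. sgn (p x) = sgn (p y)))"
      unfolding F_def using iff by auto
    also have "\<dots> \<longleftrightarrow> B x" using ps(3) by blast
    finally show ?thesis .
  qed
  then show ?thesis
    unfolding semialgebraic_in_def using calculation by (intro exI[of _ F]) (auto simp: F_def)
qed

text \<open>Piecewise polynomial functions with semialgebraic pieces.\<close>

definition sa_fun :: "(('i \<Rightarrow> real) \<Rightarrow> real) \<Rightarrow> bool" where
  "sa_fun f \<longleftrightarrow> (\<exists>g G. sign_determined g \<and> finite G \<and> G \<subseteq> poly_funs \<and> (\<forall>x. g x \<in> G \<and> f x = g x x))"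

lemma sa_fun_poly: "p \<in> poly_funs \<Longrightarrow> sa_fun p"
  unfolding sa_fun_def by (intro exI[of _ "\<lambda>x. p"] exI[of _ "{p}"]) (auto intro: sign_determined_const)

text \<open>The signs of all candidate polynomials form a finite table; the selector
  \<open>g\<close> then picks the right entry, and both are sign determined.\<close>

lemma sign_determined_sgn_sa_fun:
  assumes "sa_fun f" shows "sign_determined (\<lambda>x. sgn (f x))"
proof -
  obtain g G where g: "sign_determined g" "finite G" "G \<subseteq> poly_funs" "\<And>x. g x \<in> G" "\<And>x. f x = g x x"
    using assms unfolding sa_fun_def by blast
  have "sign_determined (\<lambda>x. (\<lambda>p. if p \<in> G then sgn (p x) else 0))"
    by (rule sign_determined_family[OF g(2), of "\<lambda>p x. sgn (p x)"])
       (use g(3) in \<open>auto simp: fun_eq_iff intro: sign_determined_sgn\<close>)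
  from sign_determined_comp2[OF this g(1), of "\<lambda>D p. D p"]
  show ?thesis using g(4,5) by simp
qed

lemma sa_fun_comp2:
  fixes f1 f2 :: "('i \<Rightarrow> real) \<Rightarrow> real"
  assumes "sa_fun f1" "sa_fun f2" 
    and op: "\<And>p q :: ('i \<Rightarrow> real) \<Rightarrow> real. p \<in> poly_funs \<Longrightarrow> q \<in> poly_funs \<Longrightarrow> (\<lambda>x. h (p x) (q x)) \<in> poly_funs"
  shows "sa_fun (\<lambda>x. h (f1 x) (f2 x))"
proof -
  obtain g1 G1 where g1: "sign_determined g1" "finite G1" "G1 \<subseteq> poly_funs" "\<And>x. g1 x \<in> G1" "\<And>x. f1 x = g1 x x"
    using assms(1) unfolding sa_fun_def by blast
  obtain g2 G2 where g2: "sign_determined g2" "finite G2" "G2 \<subseteq> poly_funs" "\<And>x. g2 x \<in> G2" "\<And>x. f2 x = g2 x x"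
    using assms(2) unfolding sa_fun_def by blast
  define H where "H = (\<lambda>p q (x::'i \<Rightarrow> real). h (p x :: real) (q x :: real) :: real)"
  show ?thesis
    unfolding sa_fun_def
  proof (intro exI[of _ "\<lambda>x. H (g1 x) (g2 x)"] exI[of _ "(\<lambda>(p, q). H p q) ` (G1 \<times> G2)"] conjI allI)
    show "sign_determined (\<lambda>x. H (g1 x) (g2 x))" 
      by (rule sign_determined_comp2[OF g1(1) g2(1)])
    show "(\<lambda>(p, q). H p q) ` (G1 \<times> G2) \<subseteq> poly_funs" 
      unfolding H_def by (auto intro!: op dest: subsetD[OF g1(3)] subsetD[OF g2(3)])
  qed (use g1 g2 in \<open>auto simp: H_def\<close>)
qed

lemmas sa_fun_add = sa_fun_comp2[where h = "(+)", OF _ _ poly_funs.add]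
  and sa_fun_diff = sa_fun_comp2[where h = "(-)", OF _ _ poly_funs_diff]
  and sa_fun_mult = sa_fun_comp2[where h = "(*)", OF _ _ poly_funs.mult]

text \<open>This is where pieces arise: the support value of a triangle is a maximum over its
  vertices. The selector is chosen by the sign of the difference.\<close>

lemma sa_fun_max:
  assumes "sa_fun f1" "sa_fun f2" shows "sa_fun (\<lambda>x. max (f1 x) (f2 x))"
proof -
  obtain g1 G1 where g1: "sign_determined g1" "finite G1" "G1 \<subseteq> poly_funs" "\<And>x. g1 x \<in> G1" "\<And>x. f1 x = g1 x x"
    using assms(1) unfolding sa_fun_def by blast
  obtain g2 G2 where g2: "sign_determined g2" "finite G2" "G2 \<subseteq> poly_funs" "\<And>x. g2 x \<in> G2" "\<And>x. f2 x = g2 x x"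
    using assms(2) unfolding sa_fun_def by blast
  define g where "g = (\<lambda>x. if sgn (f1 x - f2 x) = 1 then g1 x else g2 x)"
  have "sign_determined (\<lambda>x. (g1 x, g2 x))" using sign_determined_comp2[OF g1(1) g2(1), of Pair] .
  from sign_determined_comp2[OF sign_determined_sgn_sa_fun[OF sa_fun_diff[OF assms]] this, 
      of "\<lambda>s pq. if s = 1 then fst pq else snd pq"]
  have "sign_determined g" unfolding g_def fst_conv snd_conv .
  moreover have "g x \<in> G1 \<union> G2 \<and> max (f1 x) (f2 x) = g x x" for x
  proof (cases "f1 x > f2 x")
    case True
    then have "g x = g1 x" by (simp add: g_def)
    moreover have "max (f1 x) (f2 x) = f1 x" using True by simp
    ultimately show ?thesis using g1(4) g1(5)[of x] by simp
  next
    case False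
    then have "g x = g2 x" by (simp add: g_def sgn_1_pos)
    moreover have "max (f1 x) (f2 x) = f2 x" using False by simp
    ultimately show ?thesis using g2(4) g2(5)[of x] by simp
  qed
  ultimately show ?thesis
    unfolding sa_fun_def using g1(2,3) g2(2,3) by (intro exI[of _ g] exI[of _ "G1 \<union> G2"]) auto
qed

lemma sa_fun_sum: "finite A \<Longrightarrow> (\<And>a. a \<in> A \<Longrightarrow> sa_fun (f a)) \<Longrightarrow> sa_fun (\<lambda>x. \<Sum>a\<in>A. f a x)"
proof (induction A rule: finite_induct)
  case empty
  show ?case using sa_fun_poly[OF poly_funs.const[of 0]] by simp
next
  case (insert a A)
  have "sa_fun (\<lambda>x. f a x + (\<Sum>a\<in>A. f a x))"
    by (rule sa_fun_add) (use insert in auto)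
  then show ?case using insert by simp
qed

lemma sign_determined_less_sa_fun:
  assumes "sa_fun f1" "sa_fun f2" shows "sign_determined (\<lambda>x. f1 x < f2 x)"
proof -
  have "sign_determined (\<lambda>x. sgn (f2 x - f1 x) = 1)"
    by (rule sign_determined_comp[OF sign_determined_sgn_sa_fun[OF sa_fun_diff[OF assms(2,1)]], of "\<lambda>s. s = 1"])
  then show ?thesis by (simp add: sgn_1_pos)
qed

section \<open>Coordinates in the plane\<close>

abbreviation vec2 :: "real \<Rightarrow> real \<Rightarrow> real^2" where "vec2 x y \<equiv> vector [x, y]"

abbreviation area :: "(real^2) set \<Rightarrow> real" where "area \<equiv> measure lebesgue"

lemma vec2_eta: "vec2 (v$1) (v$2) = v"
  by (simp add: vec_eq_iff forall_2)

lemma inner_real2: "(u::real^2) \<bullet> v = u$1 * v$1 + u$2 * v$2"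
  by (simp add: inner_vec_def sum_2)

lemma vec2_arith: 
  "vec2 a b + vec2 c d = vec2 (a + c) (b + d)" "vec2 a b - vec2 c d = vec2 (a - c) (b - d)"
  "r *\<^sub>R vec2 a b = vec2 (r * a) (r * b)"
  by (simp_all add: vec_eq_iff forall_2)

subsection \<open>Support functions and Minkowski sums\<close>

definition supp :: "(real^2) set \<Rightarrow> real^2 \<Rightarrow> real" where
  "supp K u = (SUP x\<in>K. x \<bullet> u)"

lemma convex_bodies2D:
  assumes "K \<in> convex_bodies2" shows "K \<noteq> {}" "compact K" "convex K"
  using assms by (auto simp: convex_bodies2_def)

lemma lmeasurable_body: "K \<in> convex_bodies2 \<Longrightarrow> K \<in> lmeasurable"
  by (simp add: convex_bodies2D lmeasurable_compact)

lemma supp_attained: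
  assumes "K \<in> convex_bodies2"
  obtains x where "x \<in> K" "x \<bullet> u = supp K u" "\<And>y. y \<in> K \<Longrightarrow> y \<bullet> u \<le> supp K u"
proof -
  have "\<exists>x\<in>K. \<forall>y\<in>K. y \<bullet> u \<le> x \<bullet> u"
    using convex_bodies2D[OF assms] by (intro continuous_attains_sup continuous_intros) auto
  then obtain x where x: "x \<in> K" "\<forall>y\<in>K. y \<bullet> u \<le> x \<bullet> u" by blast
  then have "supp K u = x \<bullet> u" unfolding supp_def by (intro cSup_eq_maximum) auto
  then show ?thesis using that[of x] x by auto
qed

lemma supp_ge: "K \<in> convex_bodies2 \<Longrightarrow> x \<in> K \<Longrightarrow> x \<bullet> u \<le> supp K u"
  by (metis supp_attained)

lemma supp_eqI: "x \<in> K \<Longrightarrow> x \<bullet> u = m \<Longrightarrow> (\<And>y. y \<in> K \<Longrightarrow> y \<bullet> u \<le> m) \<Longrightarrow> supp K u = m"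
  unfolding supp_def by (intro cSup_eq_maximum) auto

lemma minkowski_sumI: "x \<in> K \<Longrightarrow> y \<in> L \<Longrightarrow> x + y \<in> minkowski_sum K L"
  by (auto simp: minkowski_sum_def)

lemma minkowski_sum_body:
  assumes "K \<in> convex_bodies2" "L \<in> convex_bodies2" shows "minkowski_sum K L \<in> convex_bodies2"
proof -
  have "minkowski_sum K L = {x + y |x y. x \<in> K \<and> y \<in> L}" by (simp add: minkowski_sum_def)
  moreover have "minkowski_sum K L = (\<Union>x\<in>K. \<Union>y\<in>L. {x + y})" by (auto simp: minkowski_sum_def)
  ultimately show ?thesis
    using convex_bodies2D[OF assms(1)] convex_bodies2D[OF assms(2)] compact_sums[of K L] convex_sums[of K L]
    by (auto simp: convex_bodies2_def minkowski_sum_def)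
qed

lemma supp_minkowski_sum:
  assumes "K \<in> convex_bodies2" "L \<in> convex_bodies2"
  shows "supp (minkowski_sum K L) u = supp K u + supp L u"
proof -
  obtain x where x: "x \<in> K" "x \<bullet> u = supp K u" using supp_attained[OF assms(1)] by metis
  obtain y where y: "y \<in> L" "y \<bullet> u = supp L u" using supp_attained[OF assms(2)] by metis
  show ?thesis
  proof (rule supp_eqI[of "x + y"])
    show "x + y \<in> minkowski_sum K L" using x y by (auto simp: minkowski_sum_def)
    show "(x + y) \<bullet> u = supp K u + supp L u" using x y by (simp add: inner_add_left)
  next
    fix z assume "z \<in> minkowski_sum K L"
    then show "z \<bullet> u \<le> supp K u + supp L u"
      by (auto simp: minkowski_sum_def inner_add_left intro!: add_mono supp_ge assms)
  qed
qed

lemma supp_scaleR: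
  assumes "K \<in> convex_bodies2" "c \<ge> 0" shows "supp K (c *\<^sub>R u) = c * supp K u"
proof -
  obtain x where x: "x \<in> K" "x \<bullet> u = supp K u" "\<And>y. y \<in> K \<Longrightarrow> y \<bullet> u \<le> supp K u"
    using supp_attained[OF assms(1)] by metis
  show ?thesis by (rule supp_eqI[of x]) (use x assms(2) in \<open>auto intro: mult_left_mono\<close>)
qed

lemma supp_zero: "K \<in> convex_bodies2 \<Longrightarrow> supp K 0 = 0"
  using supp_scaleR[of K 0 0] by simp

lemma minkowski_sum_commute: "minkowski_sum K L = minkowski_sum L K"
  by (auto simp: minkowski_sum_def) (metis add.commute)+

lemma minkowski_sum_assoc: "minkowski_sum (minkowski_sum K L) M = minkowski_sum K (minkowski_sum L M)"
  by (auto simp: minkowski_sum_def) (metis add.assoc)+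

lemma minkowski_sum_translate: "minkowski_sum K ((+) t ` L) = (+) t ` minkowski_sum K L"
  by (force simp: minkowski_sum_def image_iff algebra_simps)

lemma minkowski_sum_mono: "K \<subseteq> K' \<Longrightarrow> L \<subseteq> L' \<Longrightarrow> minkowski_sum K L \<subseteq> minkowski_sum K' L'"
  by (auto simp: minkowski_sum_def)

lemma mixed_area_commute: "mixed_area K L = mixed_area L K"
  by (simp add: mixed_area_def minkowski_sum_commute[of K L])

lemma body_translate: "K \<in> convex_bodies2 \<Longrightarrow> (+) t ` K \<in> convex_bodies2"
  by (auto simp: convex_bodies2_def compact_translation convex_translation)

lemma mixed_area_translate: "mixed_area K ((+) t ` L) = mixed_area K L"
  by (simp add: mixed_area_def minkowski_sum_translate measure_translation)

subsection \<open>Area by vertical slices\<close>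

lemma continuous_on_vec2:
  assumes "continuous_on S f" "continuous_on S g"
  shows "continuous_on S (\<lambda>x. vec2 (f x) (g x))"
proof -
  have eq: "vec2 (f x) (g x) = f x *\<^sub>R vec2 1 0 + g x *\<^sub>R vec2 0 1" for x
    by (simp add: vec2_arith)
  show ?thesis unfolding eq by (intro continuous_intros assms)
qed

lemma vec2_measurable: "(\<lambda>(x, y). vec2 x y) \<in> borel_measurable (borel :: (real \<times> real) measure)"
  unfolding case_prod_beta'
  by (intro borel_measurable_continuous_onI continuous_on_vec2 continuous_intros)

text \<open>Agreement on boxes determines Lebesgue measure. Writing it as an image of the measure on
  pairs makes the product measure, and with it slicing, available.\<close>

lemma lborel_real2: "(lborel :: (real^2) measure) = distr lborel borel (\<lambda>(x, y). vec2 x y)"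
proof (rule lborel_eqI)
  have meas: "(\<lambda>(x, y). vec2 x y) \<in> borel_measurable (lborel :: (real \<times> real) measure)"
    using vec2_measurable by simp
  show "sets (distr lborel borel (\<lambda>(x, y). vec2 x y)) = sets borel" by simp
  fix l u :: "real^2" assume lu: "\<And>b. b \<in> Basis \<Longrightarrow> l \<bullet> b \<le> u \<bullet> b"
  have Basis: "(Basis :: (real^2) set) = {axis 1 1, axis 2 1}"
    unfolding Basis_vec_def by (auto simp: UNIV_2)
  have ne: "axis 1 1 \<noteq> (axis 2 1 :: real^2)" by (simp add: axis_eq_axis)
  have le: "l$1 \<le> u$1" "l$2 \<le> u$2" 
    using lu[of "axis 1 1"] lu[of "axis 2 1"] by (auto simp: Basis inner_axis)
  have "emeasure (distr lborel borel (\<lambda>(x, y). vec2 x y)) (box l u)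
      = emeasure (lborel \<Otimes>\<^sub>M lborel) ({l$1<..<u$1} \<times> {l$2<..<u$2})"
    unfolding lborel_prod
    by (subst emeasure_distr[OF meas]) (auto simp: box_def Basis inner_axis intro!: arg_cong[where f="emeasure lborel"])
  also have "\<dots> = ennreal (u$1 - l$1) * ennreal (u$2 - l$2)"
    using le by (subst lborel.emeasure_pair_measure_Times) auto
  also have "\<dots> = (\<Prod>b\<in>Basis. (u - l) \<bullet> b)"
    using le ne by (simp add: Basis inner_axis ennreal_mult'')
  finally show "emeasure (distr lborel borel (\<lambda>(x, y). vec2 x y)) (box l u) = (\<Prod>b\<in>Basis. (u - l) \<bullet> b)" .
qed

text \<open>Cavalieri's principle. Measurability of the length of the slices is obtained from that
  of the sections of \<open>K\<close>, so \<open>f\<close> and \<open>g\<close> need no regularity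
  beyond the given integral.\<close>

lemma area_by_slices:
  assumes K: "compact K"
    and sl: "\<And>x y. vec2 x y \<in> K \<longleftrightarrow> a \<le> x \<and> x \<le> b \<and> f x \<le> y \<and> y \<le> g x"
    and fg: "\<And>x. a \<le> x \<Longrightarrow> x \<le> b \<Longrightarrow> f x \<le> g x"
    and I: "((\<lambda>x. g x - f x) has_integral I) {a..b}"
  shows "area K = I"
proof -
  have KB: "K \<in> sets borel" using K by (simp add: borel_compact)
  define X where "X = {(x, y). vec2 x y \<in> K}"
  have X: "X \<in> sets (lborel \<Otimes>\<^sub>M lborel)"
  proof -
    have "X = (\<lambda>(x, y). vec2 x y) -` K \<inter> space borel" by (auto simp: X_def)
    then have "X \<in> sets borel" using measurable_sets[OF vec2_measurable KB] by simp
    then show ?thesis unfolding lborel_prod by simp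
  qed
  define \<phi> where "\<phi> = (\<lambda>x. if x \<in> {a..b} then g x - f x else 0)"
  have sl': "emeasure lborel (Pair x -` X) = ennreal (\<phi> x)" for x
  proof (cases "x \<in> {a..b}")
    case True
    then have "Pair x -` X = {f x..g x}" by (auto simp: X_def sl)
    then show ?thesis using True fg[of x] by (simp add: \<phi>_def)
  next
    case False
    then have "Pair x -` X = {}" by (auto simp: X_def sl)
    then show ?thesis using False by (auto simp: \<phi>_def)
  qed
  have \<phi>0: "0 \<le> \<phi> x" for x using fg[of x] by (auto simp: \<phi>_def)
  have "(\<lambda>x. emeasure lborel (Pair x -` X)) \<in> borel_measurable lborel"
    using X by (rule lborel.measurable_emeasure_Pair)
  then have "(\<lambda>x. ennreal (\<phi> x)) \<in> borel_measurable borel" by (simp add: sl')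
  then have "(\<lambda>x. enn2real (ennreal (\<phi> x))) \<in> borel_measurable borel" by measurable
  then have \<phi>m: "\<phi> \<in> borel_measurable borel" using \<phi>0 by simp
  have "(\<phi> has_integral I) UNIV" 
    using I has_integral_restrict_UNIV[of "{a..b}" "\<lambda>x. g x - f x" I] by (simp add: \<phi>_def)
  then have "integral\<^sup>N lborel \<phi> = I" using \<phi>m \<phi>0 by (intro nn_integral_has_integral_lborel)
  moreover have I0: "I \<ge> 0" using I fg by (intro has_integral_nonneg[OF I]) auto
  moreover have "emeasure lborel K = (\<integral>\<^sup>+x. ennreal (\<phi> x) \<partial>lborel)"
  proof -
    have "emeasure lborel K = emeasure (lborel \<Otimes>\<^sub>M lborel) X"
      using KB vec2_measurable unfolding lborel_real2 lborel_prod
      by (subst emeasure_distr) (auto simp: X_def intro!: arg_cong[where f="emeasure lborel"])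
    also have "\<dots> = (\<integral>\<^sup>+x. emeasure lborel (Pair x -` X) \<partial>lborel)"
      using X by (rule lborel.emeasure_pair_measure_alt)
    finally show ?thesis by (simp add: sl')
  qed
  ultimately have "measure lborel K = I" by (simp add: measure_def)
  then show ?thesis using KB by (simp add: measure_completion)
qed

text \<open>A vertical slice of a compact convex set is a compact interval, and convexity of
  \<open>K\<close> passes to its lower boundary and, with reversed sign, to its upper
  boundary.\<close>

lemma body_slices:
  assumes K: "K \<in> convex_bodies2"
  obtains a b f g where "a \<le> b" "supp K (vec2 1 0) = b" "supp K (vec2 (-1) 0) = -a"
    "\<And>x y. vec2 x y \<in> K \<longleftrightarrow> a \<le> x \<and> x \<le> b \<and> f x \<le> y \<and> y \<le> g x"
    "\<And>x. a \<le> x \<Longrightarrow> x \<le> b \<Longrightarrow> f x \<le> g x"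
    "convex_on {a..b} f" "convex_on {a..b} (\<lambda>x. - g x)"
proof -
  note KD = convex_bodies2D[OF K]
  have conv: "vec2 ((1-t)*x + t*x') ((1-t)*y + t*y') \<in> K" 
    if "vec2 x y \<in> K" "vec2 x' y' \<in> K" "0 \<le> t" "t \<le> 1" for x y x' y' t
    using convexD_alt[OF KD(3) that] by (simp add: vec2_arith)
  obtain p where p: "p \<in> K" "p \<bullet> vec2 1 0 = supp K (vec2 1 0)" "\<And>y. y \<in> K \<Longrightarrow> y \<bullet> vec2 1 0 \<le> supp K (vec2 1 0)"
    using supp_attained[OF K] by metis
  obtain q where q: "q \<in> K" "q \<bullet> vec2 (-1) 0 = supp K (vec2 (-1) 0)" "\<And>y. y \<in> K \<Longrightarrow> y \<bullet> vec2 (-1) 0 \<le> supp K (vec2 (-1) 0)"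
    using supp_attained[OF K] by metis
  define a b where "a = q$1" and "b = p$1"
  have ab: "supp K (vec2 1 0) = b" "supp K (vec2 (-1) 0) = -a" using p q by (auto simp: a_def b_def inner_real2)
  have rng: "a \<le> x \<and> x \<le> b" if "vec2 x y \<in> K" for x y
    using p(3)[OF that] q(3)[OF that] ab by (auto simp: inner_real2)
  have "a \<le> b" using rng[of "p$1" "p$2"] p(1) by (auto simp: vec2_eta b_def)
  have ex: "\<exists>c d. c \<le> d \<and> (\<forall>y. vec2 x y \<in> K \<longleftrightarrow> c \<le> y \<and> y \<le> d)" if x: "a \<le> x" "x \<le> b" for x
  proof -
    define S where "S = {y. vec2 x y \<in> K}"
    have cont: "continuous_on UNIV (\<lambda>y. vec2 x y)"
      by (intro continuous_on_vec2 continuous_intros)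
    have "closed S" unfolding S_def
      using continuous_closed_preimage[OF cont _ compact_imp_closed[OF KD(2)]] by (simp add: vimage_def)
    moreover have "bounded S"
    proof -
      obtain B where B: "\<And>v. v \<in> K \<Longrightarrow> norm v \<le> B" using compact_imp_bounded[OF KD(2)] by (auto simp: bounded_iff)
      have "\<bar>y\<bar> \<le> B" if "y \<in> S" for y
        using B[of "vec2 x y"] component_le_norm_cart[of "vec2 x y" 2] that by (simp add: S_def)
      then show ?thesis by (auto simp: bounded_iff)
    qed
    moreover have "convex S" unfolding convex_alt
    proof (intro ballI allI impI)
      fix y y' t assume "y \<in> S" "y' \<in> S" "0 \<le> t \<and> (t::real) \<le> 1"
      then show "(1 - t) *\<^sub>R y + t *\<^sub>R y' \<in> S"
        using conv[of x y x y' t] by (simp add: S_def algebra_simps)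
    qed
    moreover have "S \<noteq> {}"
    proof (cases "a = b")
      case True
      then have "vec2 x (p$2) \<in> K" using p(1) x vec2_eta[of p] by (simp add: b_def)
      then show ?thesis by (auto simp: S_def)
    next
      case False
      \<comment> \<open>Slices in between are nonempty because the segment from a leftmost point
        \<open>q\<close> to a rightmost point \<open>p\<close> passes over \<open>x\<close>.\<close>
      define t where "t = (x - a) / (b - a)"
      have "vec2 ((1-t)*a + t*b) ((1-t)*(q$2) + t*(p$2)) \<in> K"
        by (rule conv) (use p q x \<open>a \<le> b\<close> False in \<open>auto simp: a_def b_def vec2_eta t_def divide_simps\<close>)
      moreover have "t * (b - a) = x - a" using False by (simp add: t_def)
      then have "(1-t)*a + t*b = x" by (simp add: algebra_simps)
      ultimately show ?thesis by (auto simp: S_def)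
    qed
    ultimately have S: "connected S" "compact S" "S \<noteq> {}"
      by (simp_all add: convex_connected compact_eq_bounded_closed)
    then have "\<exists>c d. S = cbox c d" using connected_compact_interval_1[of S] by simp
    then obtain c d where cd: "S = {c..d}" by (auto simp: cbox_interval)
    have "vec2 x y \<in> K \<longleftrightarrow> c \<le> y \<and> y \<le> d" for y
      using eqset_imp_iff[OF cd, of y] unfolding S_def by simp
    moreover have "c \<le> d" using S(3) unfolding cd by simp
    ultimately show ?thesis by blast
  qed
  have "\<forall>x\<in>{a..b}. \<exists>cd. fst cd \<le> snd cd \<and> (\<forall>y. vec2 x y \<in> K \<longleftrightarrow> fst cd \<le> y \<and> y \<le> snd cd)"
  proof
    fix x assume "x \<in> {a..b}"
    then obtain c d where "c \<le> d" "\<forall>y. vec2 x y \<in> K \<longleftrightarrow> c \<le> y \<and> y \<le> d" using ex[of x] by auto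
    then show "\<exists>cd. fst cd \<le> snd cd \<and> (\<forall>y. vec2 x y \<in> K \<longleftrightarrow> fst cd \<le> y \<and> y \<le> snd cd)"
      by (intro exI[of _ "(c, d)"]) simp
  qed
  from bchoice[OF this] obtain h where h: "\<forall>x\<in>{a..b}. fst (h x) \<le> snd (h x) \<and>
    (\<forall>y. vec2 x y \<in> K \<longleftrightarrow> fst (h x) \<le> y \<and> y \<le> snd (h x))" by blast
  define f g where "f = (\<lambda>x. fst (h x))" and "g = (\<lambda>x. snd (h x))"
  have fg: "f x \<le> g x" "vec2 x y \<in> K \<longleftrightarrow> f x \<le> y \<and> y \<le> g x" if "a \<le> x" "x \<le> b" for x y
    using h that by (auto simp: f_def g_def)
  have comb: "f ((1-t)*x + t*x') \<le> (1-t)*f x + t*f x' \<and> (1-t)*g x + t*g x' \<le> g ((1-t)*x + t*x')"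
    if "x \<in> {a..b}" "x' \<in> {a..b}" "0 \<le> t" "t \<le> 1" for x x' t
  proof -
    have e: "vec2 x (f x) \<in> K" "vec2 x (g x) \<in> K" if "x \<in> {a..b}" for x
      using fg(2)[of x "f x"] fg(2)[of x "g x"] fg(1)[of x] that by auto
    note F = conv[OF e(1)[OF that(1)] e(1)[OF that(2)] that(3,4)]
    note G = conv[OF e(2)[OF that(1)] e(2)[OF that(2)] that(3,4)]
    have "a \<le> (1-t)*x + t*x'" "(1-t)*x + t*x' \<le> b" using rng[OF F] by auto
    then show ?thesis using F G fg(2)[of "(1-t)*x + t*x'"] by blast
  qed
  have cv1: "convex_on {a..b} f"
  proof (rule convex_onI)
    fix t x y :: real assume "0 < t" "t < 1" "x \<in> {a..b}" "y \<in> {a..b}"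
    then show "f ((1 - t) *\<^sub>R x + t *\<^sub>R y) \<le> (1 - t) * f x + t * f y"
      using comb[of x y t] by auto
  qed auto
  have cv2: "convex_on {a..b} (\<lambda>x. - g x)"
  proof (rule convex_onI)
    fix t x y :: real assume "0 < t" "t < 1" "x \<in> {a..b}" "y \<in> {a..b}"
    then show "- g ((1 - t) *\<^sub>R x + t *\<^sub>R y) \<le> (1 - t) * - g x + t * - g y"
      using comb[of x y t] by auto
  qed auto
  have sl: "vec2 x y \<in> K \<longleftrightarrow> a \<le> x \<and> x \<le> b \<and> f x \<le> y \<and> y \<le> g x" for x y
    using rng[of x y] fg(2)[of x y] by blast
  show ?thesis by (rule that[OF \<open>a \<le> b\<close> ab sl fg(1) cv1 cv2])
qed

subsection \<open>Adding a trapezoid\<close>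

text \<open>The minimum over the window \<open>[x - w, x]\<close> of a function that decreases up to \<open>m\<close> and increases afterwards.\<close>

definition window_min :: "(real \<Rightarrow> real) \<Rightarrow> real \<Rightarrow> real \<Rightarrow> real \<Rightarrow> real" where
  "window_min f m w x = (if x \<le> m then f x else if x \<le> m + w then f m else f (x - w))"

context
  fixes f :: "real \<Rightarrow> real" and a b m w :: real
  assumes conv: "convex_on {a..b} f" and m: "a \<le> m" "m \<le> b" and w: "0 \<le> w"
    and min: "\<forall>x\<in>{a..b}. f m \<le> f x"
begin

text \<open>On \<open>{s..m}\<close> a convex function is bounded by the larger of its end values,
  and \<open>f m\<close> is the smaller one.\<close>

lemma convex_antimono_left: "a \<le> s \<Longrightarrow> s \<le> t \<Longrightarrow> t \<le> m \<Longrightarrow> f t \<le> f s"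
  using convex_on_le_max[of s m f t] convex_on_subset[OF conv, of "{s..m}"] min m by auto

lemma convex_mono_right: "m \<le> s \<Longrightarrow> s \<le> t \<Longrightarrow> t \<le> b \<Longrightarrow> f s \<le> f t"
  using convex_on_le_max[of m t f s] convex_on_subset[OF conv, of "{m..t}"] min m by auto

text \<open>Together with \<open>window_min_attained\<close> this shows that
  \<open>window_min\<close> is the minimum of \<open>f s\<close> over the \<open>s\<close> in
  \<open>{a..b}\<close> with \<open>0 \<le> x - s \<le> w\<close>, that is, the infimal convolution
  of \<open>f\<close> with the indicator of \<open>{0..w}\<close>.\<close>

lemma window_min_le: 
  assumes "a \<le> s" "s \<le> b" "0 \<le> t" "t \<le> w"
  shows "window_min f m w (s + t) \<le> f s"
proof -
  consider "s + t \<le> m" | "m < s + t" "s + t \<le> m + w" | "m + w < s + t" by linarith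
  then show ?thesis
  proof cases
    case 1 then show ?thesis using convex_antimono_left[of s "s + t"] assms by (simp add: window_min_def)
  next
    case 2 then show ?thesis using min assms by (simp add: window_min_def)
  next
    case 3 then show ?thesis using convex_mono_right[of "s + t - w" s] assms w by (simp add: window_min_def)
  qed
qed

lemma window_min_attained:
  assumes "a \<le> x" "x \<le> b + w"
  obtains s where "a \<le> s" "s \<le> b" "0 \<le> x - s" "x - s \<le> w" "window_min f m w x = f s"
proof -
  consider "x \<le> m" | "m < x" "x \<le> m + w" | "m + w < x" by linarith
  then show ?thesis
  proof cases
    case 1 then show ?thesis using that[of x] assms m w by (auto simp: window_min_def)
  next
    case 2 then show ?thesis using that[of m] assms m w by (auto simp: window_min_def)
  next
    case 3 then show ?thesis using that[of "x - w"] assms m w by (auto simp: window_min_def)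
  qed
qed

text \<open>Convexity gives no continuity at the ends of the closed interval, but monotonicity on
  either side of \<open>m\<close> suffices.\<close>

lemma unimodal_integrable: "f integrable_on {a..b}"
proof (rule Henstock_Kurzweil_Integration.integrable_combine[OF m])
  have "(\<lambda>x. - f x) integrable_on {a..m}"
    by (intro integrable_on_mono_on mono_onI) (use convex_antimono_left in auto)
  then show "f integrable_on {a..m}" using integrable_neg[of "\<lambda>x. - f x"] by simp
  show "f integrable_on {m..b}"
    by (intro integrable_on_mono_on mono_onI) (use convex_mono_right in auto)
qed

text \<open>The graph is cut at its minimum, the right part is moved by \<open>w\<close>, and the
  gap is bridged at height \<open>f m\<close>.\<close>

lemma window_min_integral:
  "(window_min f m w has_integral (integral {a..b} f + w * f m)) {a..b + w}"
proof -
  have i1: "f integrable_on {a..m}" and i2: "f integrable_on {m..b}"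
    using integrable_subinterval_real[OF unimodal_integrable] m by auto
  have "(window_min f m w has_integral integral {a..m} f) {a..m}"
    using integrable_integral[OF i1] by (rule has_integral_eq[rotated]) (simp add: window_min_def)
  moreover have "(window_min f m w has_integral w * f m) {m..m + w}"
  proof (rule has_integral_eq)
    show "((\<lambda>x. f m) has_integral w * f m) {m..m + w}"
      using has_integral_const_real[of "f m" m "m + w"] w by simp
  qed (auto simp: window_min_def)
  ultimately have *: "(window_min f m w has_integral (integral {a..m} f + w * f m)) {a..m + w}"
    using m w by (intro has_integral_combine[of a m "m + w"]) auto
  have "((\<lambda>x. f (x - w)) has_integral integral {m..b} f) {m + w..b + w}"
    using has_integral_shift_real_ivl[OF integrable_integral[OF i2], of "-w"] by (simp add: algebra_simps)
  then have "(window_min f m w has_integral integral {m..b} f) {m + w..b + w}"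
    by (rule has_integral_eq[rotated]) (use w in \<open>auto simp: window_min_def\<close>)
  then have "(window_min f m w has_integral (integral {a..m} f + w * f m + integral {m..b} f)) {a..b + w}"
    using m w * by (intro has_integral_combine[of a "m + w" "b + w"]) auto
  moreover have "integral {a..b} f = integral {a..m} f + integral {m..b} f"
    using Henstock_Kurzweil_Integration.integral_combine[OF m unimodal_integrable] by simp
  ultimately show ?thesis by (simp add: algebra_simps)
qed

end

text \<open>The lower left corner is the origin, the left side has length \<open>c\<close>, and
  \<open>\<alpha>\<close> and \<open>\<beta>\<close> are the slopes of bottom and top, so the right
  side has length \<open>c + (\<beta> - \<alpha>) * w\<close>. Triangles and vertical segments are
  the cases \<open>c = 0\<close> and \<open>w = 0\<close>.\<close>

definition trapezoid :: "real \<Rightarrow> real \<Rightarrow> real \<Rightarrow> real \<Rightarrow> (real^2) set" where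
  "trapezoid w c \<alpha> \<beta> = {v. 0 \<le> v$1 \<and> v$1 \<le> w \<and> \<alpha> * v$1 \<le> v$2 \<and> v$2 \<le> c + \<beta> * v$1}"

lemma vec2_trapezoid: 
  "vec2 x y \<in> trapezoid w c \<alpha> \<beta> \<longleftrightarrow> 0 \<le> x \<and> x \<le> w \<and> \<alpha> * x \<le> y \<and> y \<le> c + \<beta> * x"
  by (simp add: trapezoid_def)

lemma trapezoid_height:
  assumes "0 \<le> c" "0 \<le> c + (\<beta> - \<alpha>) * w" "0 \<le> x" "x \<le> w"
  shows "\<alpha> * x \<le> c + \<beta> * (x::real)"
proof (cases "\<beta> \<ge> \<alpha>")
  case True then show ?thesis using assms by (smt (verit) mult_right_mono)
next
  case False
  then have "(\<alpha> - \<beta>) * x \<le> (\<alpha> - \<beta>) * w" using assms by (intro mult_left_mono) auto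
  then show ?thesis using assms by (simp add: algebra_simps)
qed

lemma trapezoid_body:
  assumes "0 \<le> w" "0 \<le> c" "0 \<le> c + (\<beta> - \<alpha>) * w"
  shows "trapezoid w c \<alpha> \<beta> \<in> convex_bodies2"
proof -
  have hs: "trapezoid w c \<alpha> \<beta> = {v. vec2 (-1) 0 \<bullet> v \<le> 0} \<inter> {v. vec2 1 0 \<bullet> v \<le> w} \<inter>
      {v. vec2 \<alpha> (-1) \<bullet> v \<le> 0} \<inter> {v. vec2 (-\<beta>) 1 \<bullet> v \<le> c}"
    by (auto simp: trapezoid_def inner_real2)
  have "closed (trapezoid w c \<alpha> \<beta>)" "convex (trapezoid w c \<alpha> \<beta>)"
    unfolding hs by (intro closed_Int closed_halfspace_le convex_Int convex_halfspace_le)+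
  moreover have "bounded (trapezoid w c \<alpha> \<beta>)"
  proof -
    have "norm v \<le> w + ((\<bar>\<alpha>\<bar> + \<bar>\<beta>\<bar>) * w + c)" if "v \<in> trapezoid w c \<alpha> \<beta>" for v
    proof -
      have v: "0 \<le> v$1" "v$1 \<le> w" "\<alpha> * v$1 \<le> v$2" "v$2 \<le> c + \<beta> * v$1" using that by (auto simp: trapezoid_def)
      have "\<bar>\<alpha> * v$1\<bar> \<le> \<bar>\<alpha>\<bar> * w" "\<bar>\<beta> * v$1\<bar> \<le> \<bar>\<beta>\<bar> * w"
        using v by (auto simp: abs_mult intro!: mult_left_mono)
      then have "\<bar>v$2\<bar> \<le> (\<bar>\<alpha>\<bar> + \<bar>\<beta>\<bar>) * w + c" using v assms by (simp add: algebra_simps)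
      then show ?thesis using norm_le_l1_cart[of v] v by (simp add: sum_2)
    qed
    then show ?thesis by (auto simp: bounded_iff)
  qed
  moreover have "vec2 0 0 \<in> trapezoid w c \<alpha> \<beta>" using assms by (simp add: vec2_trapezoid)
  ultimately show ?thesis by (auto simp: convex_bodies2_def compact_eq_bounded_closed)
qed

text \<open>The support value in direction \<open>vec2 \<alpha> (-1)\<close> is minus the minimum of
  the lower boundary tilted by \<open>\<alpha>\<close>; the minimiser \<open>m\<close> is the point
  at which the window minimum is flat.\<close>

lemma supp_slope:
  assumes K: "K \<in> convex_bodies2"
    and sl: "\<And>x y. vec2 x y \<in> K \<longleftrightarrow> a \<le> x \<and> x \<le> b \<and> f x \<le> y \<and> y \<le> g x"
    and fg: "\<And>x. a \<le> x \<Longrightarrow> x \<le> b \<Longrightarrow> f x \<le> (g x::real)"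
  obtains m where "a \<le> m" "m \<le> b" "\<And>x. a \<le> x \<Longrightarrow> x \<le> b \<Longrightarrow> f m - \<alpha> * m \<le> f x - \<alpha> * x"
    "supp K (vec2 \<alpha> (-1)) = - (f m - \<alpha> * m)"
proof -
  obtain p where p: "p \<in> K" "p \<bullet> vec2 \<alpha> (-1) = supp K (vec2 \<alpha> (-1))" "\<And>y. y \<in> K \<Longrightarrow> y \<bullet> vec2 \<alpha> (-1) \<le> supp K (vec2 \<alpha> (-1))"
    using supp_attained[OF K] by metis
  have pK: "a \<le> p$1" "p$1 \<le> b" "f (p$1) \<le> p$2" using sl[of "p$1" "p$2"] p(1) by (auto simp: vec2_eta)
  have le: "\<alpha> * x - f x \<le> supp K (vec2 \<alpha> (-1))" if "a \<le> x" "x \<le> b" for x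
    using p(3)[of "vec2 x (f x)"] sl[of x "f x"] fg[of x] that by (simp add: inner_real2 algebra_simps)
  have "supp K (vec2 \<alpha> (-1)) = - (f (p$1) - \<alpha> * p$1)"
    using le[OF pK(1,2)] p(2) pK(3) by (simp add: inner_real2 algebra_simps)
  then show ?thesis using that[of "p$1"] pK le by (force simp: algebra_simps)
qed

lemma convex_on_minus_linear:
  fixes f :: "real \<Rightarrow> real"
  assumes "convex_on S f" shows "convex_on S (\<lambda>x. f x - \<alpha> * x)"
proof (rule convex_onI)
  show "convex S" using assms by (rule convex_on_imp_convex)
  fix t x y :: real assume "0 < t" "t < 1" "x \<in> S" "y \<in> S"
  then have "f ((1 - t) *\<^sub>R x + t *\<^sub>R y) \<le> (1 - t) * f x + t * f y"
    using convex_onD[OF assms, of t x y] by simp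
  then show "f ((1 - t) *\<^sub>R x + t *\<^sub>R y) - \<alpha> * ((1 - t) *\<^sub>R x + t *\<^sub>R y) \<le> (1 - t) * (f x - \<alpha> * x) + t * (f y - \<alpha> * y)"
    by (simp add: algebra_simps)
qed

lemma has_integral_linear_real:
  fixes p q :: real assumes "p \<le> q"
  shows "((\<lambda>x. \<alpha> * x) has_integral \<alpha> * (q^2 - p^2) / 2) {p..q}"
proof -
  have "((\<lambda>x. \<alpha> * x) has_integral (\<alpha> * q^2 / 2 - \<alpha> * p^2 / 2)) {p..q}"
    using assms by (intro fundamental_theorem_of_calculus)
      (auto simp: has_real_derivative_iff_has_vector_derivative[symmetric] intro!: derivative_eq_intros)
  then show ?thesis by (simp add: algebra_simps diff_divide_distrib)
qed

lemma has_integral_constant_real: "p \<le> q \<Longrightarrow> ((\<lambda>x. c) has_integral c * (q - p)) {p..q::real}" for c :: real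
  using has_integral_const_real[of c p q] by (simp add: mult.commute)

text \<open>The lower boundary of the Minkowski sum is, up to a linear function, the window minimum of that of \<open>K\<close>.\<close>

theorem mixed_area_trapezoid:
  assumes K: "K \<in> convex_bodies2" and wc: "0 \<le> w" "0 \<le> c" "0 \<le> c + (\<beta> - \<alpha>) * w"
  shows "2 * mixed_area K (trapezoid w c \<alpha> \<beta>) =
     supp K (vec2 (w * \<alpha>) (- w)) + supp K (vec2 (- (w * \<beta>)) w) +
     (c + (\<beta> - \<alpha>) * w) * supp K (vec2 1 0) + c * supp K (vec2 (-1) 0)"
proof -
  define T where "T = trapezoid w c \<alpha> \<beta>"
  have T: "T \<in> convex_bodies2" unfolding T_def using trapezoid_body[OF wc] .
  obtain a b f g where ab: "a \<le> b" "supp K (vec2 1 0) = b" "supp K (vec2 (-1) 0) = -a"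
    and sl: "\<And>x y. vec2 x y \<in> K \<longleftrightarrow> a \<le> x \<and> x \<le> b \<and> f x \<le> y \<and> y \<le> g x"
    and fg: "\<And>x. a \<le> x \<Longrightarrow> x \<le> b \<Longrightarrow> f x \<le> g x"
    and cv: "convex_on {a..b} f" "convex_on {a..b} (\<lambda>x. - g x)"
    by (rule body_slices[OF K]) (rule that; assumption)
  \<comment> \<open>Tilting makes the bottom and the top of the trapezoid horizontal. The upper
    boundary enters with reversed sign, so both functions are convex and are minimised.\<close>
  define f0 g0 where "f0 = (\<lambda>x. f x - \<alpha> * x)" and "g0 = (\<lambda>x. - g x - (- \<beta>) * x)"
  obtain m where m: "a \<le> m" "m \<le> b" "\<And>x. a \<le> x \<Longrightarrow> x \<le> b \<Longrightarrow> f0 m \<le> f0 x"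
    "supp K (vec2 \<alpha> (-1)) = - f0 m" unfolding f0_def using supp_slope[OF K sl fg] by metis
  obtain p where p: "p \<in> K" "p \<bullet> vec2 (-\<beta>) 1 = supp K (vec2 (-\<beta>) 1)" "\<And>y. y \<in> K \<Longrightarrow> y \<bullet> vec2 (-\<beta>) 1 \<le> supp K (vec2 (-\<beta>) 1)"
    using supp_attained[OF K] by metis
  define m' where "m' = p$1"
  have pK: "a \<le> m'" "m' \<le> b" "p$2 \<le> g m'" using sl[of "p$1" "p$2"] p(1) by (auto simp: vec2_eta m'_def)
  have le: "- g0 x \<le> supp K (vec2 (-\<beta>) 1)" if "a \<le> x" "x \<le> b" for x
    using p(3)[of "vec2 x (g x)"] sl[of x "g x"] fg[of x] that by (simp add: inner_real2 algebra_simps g0_def)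
  have m'2: "supp K (vec2 (-\<beta>) 1) = - g0 m'"
    using le[OF pK(1,2)] p(2) pK(3) by (simp add: inner_real2 algebra_simps g0_def m'_def)
  then have m'3: "g0 m' \<le> g0 x" if "a \<le> x" "x \<le> b" for x using le[OF that] by simp
  have min_f: "\<forall>x\<in>{a..b}. f0 m \<le> f0 x" and min_g: "\<forall>x\<in>{a..b}. g0 m' \<le> g0 x"
    using m(3) m'3 by auto
  have cv0: "convex_on {a..b} f0" "convex_on {a..b} g0"
    unfolding f0_def g0_def using cv by (intro convex_on_minus_linear; simp)+
  note wf = window_min_le[OF cv0(1) m(1,2) wc(1) min_f] window_min_attained[OF cv0(1) m(1,2) wc(1) min_f]
    unimodal_integrable[OF cv0(1) m(1,2) wc(1) min_f] window_min_integral[OF cv0(1) m(1,2) wc(1) min_f]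
  note wg = window_min_le[OF cv0(2) pK(1,2) wc(1) min_g] window_min_attained[OF cv0(2) pK(1,2) wc(1) min_g]
    unimodal_integrable[OF cv0(2) pK(1,2) wc(1) min_g] window_min_integral[OF cv0(2) pK(1,2) wc(1) min_g]
  \<comment> \<open>Over \<open>x\<close> the lower boundary of the sum is the least
    \<open>f s + \<alpha> * (x - s)\<close>, that is \<open>f0 s + \<alpha> * x\<close>, over the
    admissible \<open>s\<close>; the upper boundary is the largest value in the same way.\<close>
  define F G where "F = (\<lambda>x. window_min f0 m w x + \<alpha> * x)" and "G = (\<lambda>x. c + \<beta> * x - window_min g0 m' w x)"
  have KT: "minkowski_sum K T \<in> convex_bodies2" using minkowski_sum_body[OF K T] .
  have in_sum: "vec2 (s + t) (y + z) \<in> minkowski_sum K T" 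
    if "a \<le> s" "s \<le> b" "f s \<le> y" "y \<le> g s" "0 \<le> t" "t \<le> w" "\<alpha> * t \<le> z" "z \<le> c + \<beta> * t" for s t y z
  proof -
    have "vec2 s y \<in> K" "vec2 t z \<in> T" using that sl[of s y] by (auto simp: T_def vec2_trapezoid)
    from minkowski_sumI[OF this] show ?thesis by (simp add: vec2_arith)
  qed
  have inF: "vec2 x (F x) \<in> minkowski_sum K T" if x: "a \<le> x" "x \<le> b + w" for x
  proof -
    obtain s where s: "a \<le> s" "s \<le> b" "0 \<le> x - s" "x - s \<le> w" "window_min f0 m w x = f0 s"
      by (rule wf(2)[OF x]) (rule that; assumption)
    have "vec2 (s + (x - s)) (f s + \<alpha> * (x - s)) \<in> minkowski_sum K T"
      using s fg trapezoid_height[OF wc(2,3), of "x - s"] by (intro in_sum) auto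
    moreover have "F x = f s + \<alpha> * (x - s)" unfolding F_def s(5) by (simp add: f0_def algebra_simps)
    ultimately show ?thesis by simp
  qed
  have inG: "vec2 x (G x) \<in> minkowski_sum K T" if x: "a \<le> x" "x \<le> b + w" for x
  proof -
    obtain s where s: "a \<le> s" "s \<le> b" "0 \<le> x - s" "x - s \<le> w" "window_min g0 m' w x = g0 s"
      by (rule wg(2)[OF x]) (rule that; assumption)
    have "vec2 (s + (x - s)) (g s + (c + \<beta> * (x - s))) \<in> minkowski_sum K T"
      using s fg trapezoid_height[OF wc(2,3), of "x - s"] by (intro in_sum) auto
    moreover have "G x = g s + (c + \<beta> * (x - s))" unfolding G_def s(5) by (simp add: g0_def algebra_simps)
    ultimately show ?thesis by simp
  qed
  have sumI: "a \<le> x \<and> x \<le> b + w \<and> F x \<le> y \<and> y \<le> G x" if xy: "vec2 x y \<in> minkowski_sum K T" for x y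
  proof -
    obtain k t where kt: "k \<in> K" "t \<in> T" "vec2 x y = k + t" using xy by (auto simp: minkowski_sum_def)
    have xy': "x = k$1 + t$1" "y = k$2 + t$2" using kt(3) by (metis vector_2 vector_add_component)+
    have k: "a \<le> k$1" "k$1 \<le> b" "f (k$1) \<le> k$2" "k$2 \<le> g (k$1)" using sl[of "k$1" "k$2"] kt(1) by (auto simp: vec2_eta)
    have t: "0 \<le> t$1" "t$1 \<le> w" "\<alpha> * t$1 \<le> t$2" "t$2 \<le> c + \<beta> * t$1" using kt(2) by (auto simp: T_def trapezoid_def)
    have W: "window_min f0 m w x \<le> f (k$1) - \<alpha> * k$1" "window_min g0 m' w x \<le> - g (k$1) + \<beta> * k$1"
      using wf(1)[OF k(1,2) t(1,2)] wg(1)[OF k(1,2) t(1,2)]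
      unfolding xy' f0_def[THEN fun_cong, of "k$1"] g0_def[THEN fun_cong, of "k$1"] by auto
    have "\<alpha> * x = \<alpha> * k$1 + \<alpha> * t$1" "\<beta> * x = \<beta> * k$1 + \<beta> * t$1" by (simp_all add: xy' algebra_simps)
    then show ?thesis using k t xy' W unfolding F_def G_def by linarith
  qed
  \<comment> \<open>Both boundary points over \<open>x\<close> lie in the sum, so convexity fills
    the slice between them.\<close>
  have slKT: "vec2 x y \<in> minkowski_sum K T \<longleftrightarrow> a \<le> x \<and> x \<le> b + w \<and> F x \<le> y \<and> y \<le> G x" for x y
  proof
    assume *: "a \<le> x \<and> x \<le> b + w \<and> F x \<le> y \<and> y \<le> G x"
    show "vec2 x y \<in> minkowski_sum K T"
    proof (cases "F x = G x")
      case True then show ?thesis using * inF[of x] by auto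
    next
      case False
      define r where "r = (y - F x) / (G x - F x)"
      have r: "0 \<le> r" "r \<le> 1" using * False by (auto simp: r_def divide_simps)
      have "(1 - r) *\<^sub>R vec2 x (F x) + r *\<^sub>R vec2 x (G x) \<in> minkowski_sum K T"
        using convexD_alt[OF convex_bodies2D(3)[OF KT] inF inG r, of x x] * by auto
      moreover have "(1 - r) * x + r * x = x" "(1 - r) * F x + r * G x = y"
        using False by (simp_all add: r_def divide_simps) (simp_all add: algebra_simps)
      ultimately show ?thesis by (simp add: vec2_arith)
    qed
  qed (rule sumI)
  have FG: "F x \<le> G x" if "a \<le> x" "x \<le> b + w" for x using sumI[OF inF[OF that]] by simp
  have lin: "((\<lambda>x. \<alpha> * x) has_integral \<alpha> * ((b + w)^2 - a^2) / 2) {a..b + w}"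
     "((\<lambda>x. \<beta> * x) has_integral \<beta> * ((b + w)^2 - a^2) / 2) {a..b + w}"
     "((\<lambda>x. c) has_integral c * (b + w - a)) {a..b + w}"
    using ab(1) wc(1) by (intro has_integral_linear_real has_integral_constant_real; simp)+
  define If Ig where "If = integral {a..b} f0" and "Ig = integral {a..b} g0"
  have "((\<lambda>x. G x - F x) has_integral (c * (b + w - a) + \<beta> * ((b + w)^2 - a^2) / 2 - (Ig + w * g0 m')
     - (If + w * f0 m + \<alpha> * ((b + w)^2 - a^2) / 2))) {a..b + w}"
    unfolding F_def G_def If_def Ig_def
    by (intro has_integral_diff has_integral_add lin wf(4) wg(4))
  from area_by_slices[OF convex_bodies2D(2)[OF KT] slKT FG this]
  have A1: "area (minkowski_sum K T) = c * (b + w - a) + \<beta> * ((b + w)^2 - a^2) / 2 - (Ig + w * g0 m')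
     - (If + w * f0 m + \<alpha> * ((b + w)^2 - a^2) / 2)" .
  have lin': "((\<lambda>x. \<alpha> * x) has_integral \<alpha> * (b^2 - a^2) / 2) {a..b}"
     "((\<lambda>x. \<beta> * x) has_integral \<beta> * (b^2 - a^2) / 2) {a..b}"
    by (rule has_integral_linear_real[OF ab(1)])+
  have "((\<lambda>x. (\<beta> * x - g0 x) - (f0 x + \<alpha> * x)) has_integral (\<beta> * (b^2 - a^2) / 2 - Ig - (If + \<alpha> * (b^2 - a^2) / 2))) {a..b}"
    unfolding If_def Ig_def
    by (intro has_integral_diff has_integral_add lin' integrable_integral wf(3) wg(3))
  then have "((\<lambda>x. g x - f x) has_integral (\<beta> * (b^2 - a^2) / 2 - Ig - (If + \<alpha> * (b^2 - a^2) / 2))) {a..b}"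
    by (simp add: f0_def g0_def)
  from area_by_slices[OF convex_bodies2D(2)[OF K] sl fg this]
  have A2: "area K = \<beta> * (b^2 - a^2) / 2 - Ig - (If + \<alpha> * (b^2 - a^2) / 2)" .
  have "((\<lambda>x. (c + \<beta> * x) - \<alpha> * x) has_integral (c * (w - 0) + \<beta> * (w^2 - 0^2) / 2 - \<alpha> * (w^2 - 0^2) / 2)) {0..w}"
    by (intro has_integral_diff has_integral_add has_integral_linear_real has_integral_constant_real wc)
  from area_by_slices[OF convex_bodies2D(2)[OF T] _ _ this] 
  have A3: "area T = c * w + \<beta> * w^2 / 2 - \<alpha> * w^2 / 2"
    using trapezoid_height[OF wc(2,3)] by (simp add: T_def vec2_trapezoid)
  have s1: "supp K (vec2 (w * \<alpha>) (- w)) = - (w * f0 m)"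
    using supp_scaleR[OF K wc(1), of "vec2 \<alpha> (-1)"] m(4) by (simp add: vec2_arith)
  have s2: "supp K (vec2 (- (w * \<beta>)) w) = - (w * g0 m')"
    using supp_scaleR[OF K wc(1), of "vec2 (-\<beta>) 1"] m'2 by (simp add: vec2_arith)
  \<comment> \<open>The integrals \<open>If\<close> and \<open>Ig\<close> occur in the areas of both
    \<open>K\<close> and the sum and cancel. What remains are the flat pieces
    \<open>w * f0 m\<close> and \<open>w * g0 m'\<close> and the integrals of the linear
    terms.\<close>
  show ?thesis
    unfolding mixed_area_def T_def[symmetric] A1 A2 A3 s1 s2 ab(2,3)
    by (simp add: field_simps power2_eq_square)
qed

lemma translation_image_eqI:
  fixes t :: "'a::ab_group_add"
  assumes "\<And>v. v \<in> A \<longleftrightarrow> v - t \<in> B" shows "A = (+) t ` B"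
proof
  show "A \<subseteq> (+) t ` B"
  proof
    fix v assume "v \<in> A"
    then have "v - t \<in> B" by (simp only: assms)
    then show "v \<in> (+) t ` B" by (rule rev_image_eqI) simp
  qed
  show "(+) t ` B \<subseteq> A" by (rule image_subsetI) (simp add: assms)
qed

subsection \<open>Cutting a body by a vertical line\<close>

lemma body_Int:
  "P \<in> convex_bodies2 \<Longrightarrow> closed H \<Longrightarrow> convex H \<Longrightarrow> P \<inter> H \<noteq> {} \<Longrightarrow> P \<inter> H \<in> convex_bodies2"
  by (auto simp: convex_bodies2_def compact_Int_closed convex_Int)

lemma vertical_halfspace:
  "closed {v::real^2. v$1 \<le> r}" "convex {v::real^2. v$1 \<le> r}"
  "closed {v::real^2. v$1 \<ge> r}" "convex {v::real^2. v$1 \<ge> r}"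
  "closed {v::real^2. v$1 = r}" "convex {v::real^2. v$1 = r}"
proof -
  have *: "v$1 = vec2 1 0 \<bullet> v" for v :: "real^2" by (simp add: inner_real2)
  show "closed {v::real^2. v$1 \<le> r}" "convex {v::real^2. v$1 \<le> r}"
    "closed {v::real^2. v$1 \<ge> r}" "convex {v::real^2. v$1 \<ge> r}"
    "closed {v::real^2. v$1 = r}" "convex {v::real^2. v$1 = r}"
    unfolding * by (rule closed_halfspace_le convex_halfspace_le closed_halfspace_ge convex_halfspace_ge
      closed_hyperplane convex_hyperplane)+
qed

lemma convex_crossing:
  fixes p q :: "real^2"
  assumes "p$1 \<le> r" "r \<le> q$1"
  obtains t where "0 \<le> t" "t \<le> 1" "((1 - t) *\<^sub>R p + t *\<^sub>R q)$1 = r"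
proof (cases "p$1 = q$1")
  case True
  then show ?thesis using that[of 0] assms by simp
next
  case False
  define t where "t = (r - p$1) / (q$1 - p$1)"
  have "t * (q$1 - p$1) = r - p$1" using False by (simp add: t_def)
  then have "((1 - t) *\<^sub>R p + t *\<^sub>R q)$1 = r" by (simp add: algebra_simps)
  moreover have "0 \<le> t" "t \<le> 1" using assms False by (auto simp: t_def divide_simps)
  ultimately show ?thesis by (intro that[of t])
qed

text \<open>Adding \<open>K\<close> respects the cut: a point \<open>k + p = l + q\<close> with
  \<open>p\<close> in \<open>A\<close> and \<open>q\<close> in \<open>B\<close> is also the convex
  combination of both representations for which the second summand lies on the cutting line. The
  identity is then inclusion-exclusion for areas.\<close>

lemma area_vertical_cut:
  assumes K: "K \<in> convex_bodies2" and P: "P \<in> convex_bodies2"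
    and A: "A = P \<inter> {v. v$1 \<le> r}" "A \<noteq> {}" and B: "B = P \<inter> {v. v$1 \<ge> r}" "B \<noteq> {}"
    and C: "C = P \<inter> {v. v$1 = r}"
  shows "area (minkowski_sum K P) + area (minkowski_sum K C) = area (minkowski_sum K A) + area (minkowski_sum K B)"
proof -
  have cross: "\<exists>t. 0 \<le> t \<and> t \<le> 1 \<and> (1 - t) *\<^sub>R p + t *\<^sub>R q \<in> C" if "p \<in> A" "q \<in> B" for p q
  proof -
    have pq: "p$1 \<le> r" "r \<le> q$1" using that A B by auto
    obtain t where t: "0 \<le> t" "t \<le> 1" "((1 - t) *\<^sub>R p + t *\<^sub>R q)$1 = r"
      by (rule convex_crossing[OF pq]) (rule that; assumption)
    moreover have "(1 - t) *\<^sub>R p + t *\<^sub>R q \<in> P"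
      using that A B t by (intro convexD_alt[OF convex_bodies2D(3)[OF P]]) auto
    ultimately show ?thesis using C by (intro exI[of _ t]) auto
  qed
  have Ab: "A \<in> convex_bodies2" using A(2) unfolding A(1) by (intro body_Int P vertical_halfspace)
  have Bb: "B \<in> convex_bodies2" using B(2) unfolding B(1) by (intro body_Int P vertical_halfspace)
  have "minkowski_sum K P = minkowski_sum K A \<union> minkowski_sum K B"
    unfolding minkowski_sum_def A B by (auto, metis linear)
  moreover have "minkowski_sum K A \<inter> minkowski_sum K B = minkowski_sum K C"
  proof
    show "minkowski_sum K C \<subseteq> minkowski_sum K A \<inter> minkowski_sum K B"
      unfolding minkowski_sum_def A B C by auto
    show "minkowski_sum K A \<inter> minkowski_sum K B \<subseteq> minkowski_sum K C"
    proof
      fix z assume "z \<in> minkowski_sum K A \<inter> minkowski_sum K B"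
      then have "z \<in> minkowski_sum K A" "z \<in> minkowski_sum K B" by auto
      then obtain k p l q where z: "z = k + p" "k \<in> K" "p \<in> A" "z = l + q" "l \<in> K" "q \<in> B"
        unfolding minkowski_sum_def by blast
      obtain t where t: "0 \<le> t" "t \<le> 1" "(1 - t) *\<^sub>R p + t *\<^sub>R q \<in> C" using cross z by blast
      have "(1 - t) *\<^sub>R k + t *\<^sub>R l \<in> K" using z t by (intro convexD_alt[OF convex_bodies2D(3)[OF K]]) auto
      from minkowski_sumI[OF this t(3)]
      have "(1 - t) *\<^sub>R (k + p) + t *\<^sub>R (l + q) \<in> minkowski_sum K C" by (simp add: algebra_simps)
      then show "z \<in> minkowski_sum K C" unfolding z(1)[symmetric] z(4)[symmetric] by (simp add: algebra_simps)
    qed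
  qed
  ultimately show "area (minkowski_sum K P) + area (minkowski_sum K C) = area (minkowski_sum K A) + area (minkowski_sum K B)"
    using measure_Un3[OF lmeasurable_body[OF minkowski_sum_body[OF K Ab]] lmeasurable_body[OF minkowski_sum_body[OF K Bb]]]
    by simp
qed

lemma zero_body: "{0} \<in> convex_bodies2"
  by (simp add: convex_bodies2_def)

lemma minkowski_sum_zero: "minkowski_sum {0} K = K" "minkowski_sum K {0} = K"
  by (auto simp: minkowski_sum_def)

lemma mixed_area_zero: "mixed_area K {0} = 0"
  by (simp add: mixed_area_def minkowski_sum_zero)

text \<open>The area identity is used for \<open>K\<close> and for \<open>{0}\<close>; the terms
  \<open>area K\<close> balance because they enter with total weight one on either side.\<close>

lemma mixed_area_vertical_cut:
  assumes K: "K \<in> convex_bodies2" and P: "P \<in> convex_bodies2"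
    and A: "A = P \<inter> {v. v$1 \<le> r}" "A \<noteq> {}" and B: "B = P \<inter> {v. v$1 \<ge> r}" "B \<noteq> {}"
    and C: "C = P \<inter> {v. v$1 = r}"
  shows "mixed_area K P = mixed_area K A + mixed_area K B - mixed_area K C"
proof -
  have ar: "(x - k - p) / 2 = (xa - k - a) / 2 + (xb - k - b) / 2 - (xc - k - c) / 2"
    if "x + xc = xa + xb" "p + c = a + b" for x xa xb xc k p a b c :: real
  proof -
    have *: "x = xa + xb - xc" "p = a + b - c" using that by auto
    show ?thesis unfolding * by argo
  qed
  show ?thesis
    unfolding mixed_area_def
    by (rule ar[OF area_vertical_cut[OF K P A B C] area_vertical_cut[OF zero_body P A B C, unfolded minkowski_sum_zero]])
qed

subsection \<open>Mixed areas with a polygon are sums of support values\<close>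

lemma polygon_body: "finite F \<Longrightarrow> F \<noteq> {} \<Longrightarrow> convex hull F \<in> convex_bodies2"
  by (simp add: convex_bodies2_def finite_imp_compact_convex_hull)

text \<open>With no vertex strictly inside the slab, \<open>p\<close> lies on a segment from the
  hull of the left vertices to the hull of the right ones. This segment crosses both bounding lines,
  and \<open>p\<close> is interpolated between the crossings.\<close>

lemma polygon_slab:
  fixes F :: "(real^2) set"
  assumes F: "F = F1 \<union> F2" "\<And>v. v \<in> F1 \<Longrightarrow> v$1 \<le> x0" "\<And>v. v \<in> F2 \<Longrightarrow> x1 \<le> v$1" "F1 \<noteq> {}" "F2 \<noteq> {}"
    and x: "x0 < x1" and p: "p \<in> convex hull F" "x0 \<le> p$1" "p$1 \<le> x1"
  obtains y0 y1 where "vec2 x0 y0 \<in> convex hull F" "vec2 x1 y1 \<in> convex hull F"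
    "p$2 = y0 + (y1 - y0) / (x1 - x0) * (p$1 - x0)"
proof -
  have H1: "convex hull F1 \<subseteq> {v. v$1 \<le> x0}" 
    by (rule hull_minimal) (use F vertical_halfspace in auto)
  have H2: "convex hull F2 \<subseteq> {v. v$1 \<ge> x1}" 
    by (rule hull_minimal) (use F vertical_halfspace in auto)
  have sub: "convex hull F1 \<subseteq> convex hull F" "convex hull F2 \<subseteq> convex hull F"
    using F(1) by (auto intro!: hull_mono)
  have "F \<subseteq> convex hull F1 \<union> convex hull F2" unfolding F(1) by (meson Un_mono hull_subset)
  then have "p \<in> convex hull (convex hull F1 \<union> convex hull F2)" using p(1) hull_mono by blast
  also have "\<dots> = {u *\<^sub>R s + v *\<^sub>R t | u v s t. u \<ge> 0 \<and> v \<ge> 0 \<and> u + v = 1 \<and> s \<in> convex hull F1 \<and> t \<in> convex hull F2}"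
    using F(4,5) by (intro convex_hull_union_two) auto
  finally obtain u' u s t where st': "0 \<le> u'" "0 \<le> u" "u' + u = 1" and st: "s \<in> convex hull F1" "t \<in> convex hull F2"
    and pst: "p = u' *\<^sub>R s + u *\<^sub>R t" by blast
  have u': "u' = 1 - u" using st' by simp
  have s: "s$1 \<le> x0" and t: "x1 \<le> t$1" using H1 H2 st by auto
  define D where "D = t$1 - s$1"
  have D: "D > 0" using s t x by (simp add: D_def)
  define z where "z = (\<lambda>r. (1 - r) *\<^sub>R s + r *\<^sub>R t)"
  have zP: "z r \<in> convex hull F" if "0 \<le> r" "r \<le> 1" for r
    unfolding z_def using that st sub by (intro convexD_alt[OF convex_convex_hull]) auto
  have z1: "z r $ 1 = s$1 + r * D" and z2: "z r $ 2 = s$2 + r * (t$2 - s$2)" for r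
    by (simp_all add: z_def D_def algebra_simps)
  define r0 r1 where "r0 = (x0 - s$1) / D" and "r1 = (x1 - s$1) / D"
  have rD: "r0 * D = x0 - s$1" "r1 * D = x1 - s$1" using D by (simp_all add: r0_def r1_def)
  have r: "0 \<le> r0" "r0 \<le> 1" "0 \<le> r1" "r1 \<le> 1"
    using s t x D by (auto simp: r0_def r1_def divide_simps D_def)
  have "vec2 x0 (z r0 $ 2) = z r0" "vec2 x1 (z r1 $ 2) = z r1"
    using z1[of r0] z1[of r1] rD by (auto simp: vec_eq_iff forall_2)
  then have "vec2 x0 (z r0 $ 2) \<in> convex hull F" "vec2 x1 (z r1 $ 2) \<in> convex hull F" using zP r by auto
  moreover have "p$2 = z r0 $ 2 + (z r1 $ 2 - z r0 $ 2) / (x1 - x0) * (p$1 - x0)"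
  proof -
    have "p = z u" using pst u' by (simp add: z_def)
    then have p1: "p$1 - x0 = (u - r0) * D" and p2: "p$2 = s$2 + u * (t$2 - s$2)" 
      using z1[of u] z2[of u] rD by (auto simp: algebra_simps)
    have x10: "x1 - x0 = (r1 - r0) * D" using rD by (simp add: algebra_simps)
    have "r1 - r0 \<noteq> 0" using x x10 by auto
    then have "(z r1 $ 2 - z r0 $ 2) / (x1 - x0) * (p$1 - x0) = (t$2 - s$2) * (u - r0)"
      unfolding p1 x10 z2 using D by (simp add: field_simps)
    then show ?thesis by (simp add: p2 z2 algebra_simps)
  qed
  ultimately show ?thesis using that by blast
qed

lemma mixed_area_vertical_segment:
  assumes "K \<in> convex_bodies2" "0 \<le> c"
  shows "2 * mixed_area K (trapezoid 0 c 0 0) = c * supp K (vec2 1 0) + c * supp K (vec2 (-1) 0)"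
proof -
  have "vec2 0 0 = 0" by (simp add: vec_eq_iff forall_2)
  then show ?thesis using mixed_area_trapezoid[OF assms(1), of 0 c 0 0] assms by (simp add: supp_zero)
qed

text \<open>Sweep a vertical line through the vertices: between consecutive ones the polygon is a trapezoid, and the
  contributions of the interior vertical edges cancel.\<close>

theorem mixed_area_polygon:
  fixes F :: "(real^2) set"
  assumes F: "finite F" "F \<noteq> {}"
  shows "\<exists>ns. \<forall>K\<in>convex_bodies2. 2 * mixed_area K (convex hull F) = (\<Sum>n\<leftarrow>ns. supp K n)"
proof -
  define P where "P = convex hull F"
  have P: "P \<in> convex_bodies2" unfolding P_def by (rule polygon_body[OF F])
  obtain a b f g where ab: "a \<le> b"
    and sl: "\<And>x y. vec2 x y \<in> P \<longleftrightarrow> a \<le> x \<and> x \<le> b \<and> f x \<le> y \<and> y \<le> g x"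
    and fg: "\<And>x. a \<le> x \<Longrightarrow> x \<le> b \<Longrightarrow> f x \<le> g x"
    and cv: "convex_on {a..b} f" "convex_on {a..b} (\<lambda>x. - g x)"
    by (rule body_slices[OF P]) (rule that; assumption)
  have sl': "v \<in> P \<longleftrightarrow> a \<le> v$1 \<and> v$1 \<le> b \<and> f (v$1) \<le> v$2 \<and> v$2 \<le> g (v$1)" for v
    using sl[of "v$1" "v$2"] by (simp add: vec2_eta)
  define X where "X = (\<lambda>v. v$1) ` F"
  have X: "finite X" "X \<noteq> {}" using F by (auto simp: X_def)
  have FP: "F \<subseteq> P" unfolding P_def by (rule hull_subset)
  have Xab: "a \<le> x \<and> x \<le> b" if "x \<in> X" for x using that FP sl' by (auto simp: X_def)
  define len where "len = (\<lambda>x. g x - f x)"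
  have len: "len x \<ge> 0" if "x \<in> X" for x using fg Xab[OF that] by (simp add: len_def)
  have seg: "P \<inter> {v. v$1 = x} = (+) (vec2 x (f x)) ` trapezoid 0 (len x) 0 0" if "x \<in> X" for x
  proof -
    have "v \<in> P \<inter> {v. v$1 = x} \<longleftrightarrow> v - vec2 x (f x) \<in> trapezoid 0 (len x) 0 0" for v
      using Xab[OF that] by (auto simp: sl' trapezoid_def len_def)
    then show ?thesis by (rule translation_image_eqI)
  qed
  have le_body: "P \<inter> {v. v$1 \<le> x} \<in> convex_bodies2" if "x \<in> X" for x
  proof -
    have "P \<inter> {v. v$1 \<le> x} \<noteq> {}" using that FP by (auto simp: X_def)
    then show ?thesis by (intro body_Int P vertical_halfspace)
  qed
  \<comment> \<open>The right edge of the part swept so far is kept apart from the list: unless it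
    is the last one, it becomes interior at the next vertex and must be removed again.\<close>
  have main: "\<exists>ns. \<forall>K\<in>convex_bodies2. 2 * mixed_area K (P \<inter> {v. v$1 \<le> x}) = (\<Sum>n\<leftarrow>ns. supp K n) + len x * supp K (vec2 1 0)"
    if "x \<in> X" for x
    using that
  proof (induction "card {y\<in>X. y < x}" arbitrary: x rule: less_induct)
    case less
    show ?case
    proof (cases "{y\<in>X. y < x} = {}")
      case True
      have "F \<subseteq> {v. v$1 \<ge> x}" using True by (auto simp: X_def not_less)
      then have "P \<subseteq> {v. v$1 \<ge> x}" unfolding P_def by (intro hull_minimal vertical_halfspace)
      then have eq: "P \<inter> {v. v$1 \<le> x} = (+) (vec2 x (f x)) ` trapezoid 0 (len x) 0 0"
        using seg[OF less.prems] by force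
      have "2 * mixed_area K (P \<inter> {v. v$1 \<le> x}) = (\<Sum>n\<leftarrow>[len x *\<^sub>R vec2 (-1) 0]. supp K n) + len x * supp K (vec2 1 0)"
        if K: "K \<in> convex_bodies2" for K
        using mixed_area_vertical_segment[OF K len[OF less.prems]] supp_scaleR[OF K len[OF less.prems]]
        unfolding eq mixed_area_translate by simp
      then show ?thesis by blast
    next
      case False
      define x0 where "x0 = Max {y\<in>X. y < x}"
      have x0: "x0 \<in> X" "x0 < x" using Max_in[of "{y\<in>X. y < x}"] False X(1) by (auto simp: x0_def)
      have mx: "y \<le> x0" if "y \<in> X" "y < x" for y unfolding x0_def using that X(1) by (intro Max_ge) auto
      have "card {y\<in>X. y < x0} < card {y\<in>X. y < x}"
        using x0 X(1) by (intro psubset_card_mono) auto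
      from less.hyps[OF this x0(1)] obtain ns where ns: "\<And>K. K \<in> convex_bodies2 \<Longrightarrow>
        2 * mixed_area K (P \<inter> {v. v$1 \<le> x0}) = (\<Sum>n\<leftarrow>ns. supp K n) + len x0 * supp K (vec2 1 0)" by blast
      define w where "w = x - x0"
      have w: "w > 0" using x0 by (simp add: w_def)
      define \<alpha> \<beta> where "\<alpha> = (f x - f x0) / w" and "\<beta> = (g x - g x0) / w"
      have ab0: "a \<le> x0" "x \<le> b" using Xab x0 less.prems by auto
      have split: "F = {v\<in>F. v$1 \<le> x0} \<union> {v\<in>F. x \<le> v$1}"
        using mx by (fastforce simp: X_def not_le)
      have ne: "{v\<in>F. v$1 \<le> x0} \<noteq> {}" "{v\<in>F. x \<le> v$1} \<noteq> {}"
        using x0(1) less.prems by (auto simp: X_def)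
      \<comment> \<open>Interpolation across the slab bounds \<open>P\<close> by the chords of
        \<open>f\<close> and \<open>g\<close>, and \<open>low\<close> gives the reverse bound from
        convexity. Hence both boundaries are affine between consecutive vertices.\<close>
      have up: "f x0 + \<alpha> * (p$1 - x0) \<le> p$2 \<and> p$2 \<le> g x0 + \<beta> * (p$1 - x0)"
        if p: "p \<in> P" "x0 \<le> p$1" "p$1 \<le> x" for p
      proof -
        obtain y0 y1 where y: "vec2 x0 y0 \<in> P" "vec2 x y1 \<in> P" "p$2 = y0 + (y1 - y0) / (x - x0) * (p$1 - x0)"
          unfolding P_def
          by (rule polygon_slab[OF split _ _ ne x0(2), of p]) (use p in \<open>auto simp: P_def intro: that\<close>)
        define \<mu> where "\<mu> = (p$1 - x0) / w"
        have \<mu>: "0 \<le> \<mu>" "\<mu> \<le> 1" using p w by (auto simp: \<mu>_def w_def)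
        have p2: "p$2 = (1 - \<mu>) * y0 + \<mu> * y1" using y(3) by (simp add: \<mu>_def w_def algebra_simps diff_divide_distrib)
        have e: "f x0 + \<alpha> * (p$1 - x0) = (1 - \<mu>) * f x0 + \<mu> * f x" "g x0 + \<beta> * (p$1 - x0) = (1 - \<mu>) * g x0 + \<mu> * g x"
          by (simp_all add: \<alpha>_def \<beta>_def \<mu>_def algebra_simps diff_divide_distrib)
        have "(1 - \<mu>) * f x0 \<le> (1 - \<mu>) * y0" "(1 - \<mu>) * y0 \<le> (1 - \<mu>) * g x0"
          "\<mu> * f x \<le> \<mu> * y1" "\<mu> * y1 \<le> \<mu> * g x"
          using y(1,2) \<mu> unfolding sl by (auto intro!: mult_left_mono)
        then show ?thesis unfolding e p2 by linarith
      qed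
      have low: "f r \<le> f x0 + \<alpha> * (r - x0) \<and> g x0 + \<beta> * (r - x0) \<le> g r" if r: "x0 \<le> r" "r \<le> x" for r
      proof -
        have "convex_on {x0..x} f" "convex_on {x0..x} (\<lambda>x. - g x)"
          using convex_on_subset[OF cv(1), of "{x0..x}"] convex_on_subset[OF cv(2), of "{x0..x}"] ab0 by auto
        from convex_onD_Icc'[OF this(1), of r] convex_onD_Icc'[OF this(2), of r] r
        have F: "f r \<le> (f x - f x0) / (x - x0) * (r - x0) + f x0" and G: "- g r \<le> (- g x - - g x0) / (x - x0) * (r - x0) + - g x0" by auto
        have "- g x - - g x0 = - (g x - g x0)" by simp
        then have "(- g x - - g x0) / (x - x0) = - \<beta>" unfolding \<beta>_def w_def by (simp only: minus_divide_left)
        then show ?thesis using F G unfolding \<alpha>_def w_def by simp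
      qed
      define B where "B = P \<inter> {v. v$1 \<le> x} \<inter> {v. v$1 \<ge> x0}"
      have "v \<in> B \<longleftrightarrow> v - vec2 x0 (f x0) \<in> trapezoid w (len x0) \<alpha> \<beta>" for v
      proof
        assume "v \<in> B"
        then show "v - vec2 x0 (f x0) \<in> trapezoid w (len x0) \<alpha> \<beta>"
          using up[of v] by (auto simp: B_def trapezoid_def len_def w_def)
      next
        assume "v - vec2 x0 (f x0) \<in> trapezoid w (len x0) \<alpha> \<beta>"
        then have v: "x0 \<le> v$1" "v$1 \<le> x" "f x0 + \<alpha> * (v$1 - x0) \<le> v$2" "v$2 \<le> g x0 + \<beta> * (v$1 - x0)"
          by (auto simp: trapezoid_def len_def w_def)
        then show "v \<in> B" using low[of "v$1"] ab0 by (auto simp: B_def sl')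
      qed
      then have B: "B = (+) (vec2 x0 (f x0)) ` trapezoid w (len x0) \<alpha> \<beta>"
        by (rule translation_image_eqI)
      have lenx: "len x0 + (\<beta> - \<alpha>) * w = len x" 
      proof -
        have "\<alpha> * w = f x - f x0" "\<beta> * w = g x - g x0" using w by (simp_all add: \<alpha>_def \<beta>_def)
        then show ?thesis by (simp add: len_def left_diff_distrib)
      qed
      have wl: "0 \<le> w" "0 \<le> len x0" "0 \<le> len x0 + (\<beta> - \<alpha>) * w"
        using w len[OF x0(1)] len[OF less.prems] unfolding lenx by simp_all
      define ns' where "ns' = ns @ [vec2 (w * \<alpha>) (- w), vec2 (- (w * \<beta>)) w]"
      have "2 * mixed_area K (P \<inter> {v. v$1 \<le> x}) = (\<Sum>n\<leftarrow>ns'. supp K n) + len x * supp K (vec2 1 0)"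
        if K: "K \<in> convex_bodies2" for K
      proof -
        have "mixed_area K (P \<inter> {v. v$1 \<le> x}) = mixed_area K (P \<inter> {v. v$1 \<le> x0}) + mixed_area K B - mixed_area K (P \<inter> {v. v$1 = x0})"
        proof (rule mixed_area_vertical_cut[OF K le_body[OF less.prems], where r = x0])
          show "P \<inter> {v. v$1 \<le> x0} \<noteq> {}" using convex_bodies2D(1)[OF le_body[OF x0(1)]] .
          have "trapezoid w (len x0) \<alpha> \<beta> \<in> convex_bodies2"
            by (rule trapezoid_body[OF wl])
          then show "B \<noteq> {}" unfolding B using convex_bodies2D(1) by blast
        qed (use x0 in \<open>auto simp: B_def\<close>)
        moreover have "2 * mixed_area K B = supp K (vec2 (w * \<alpha>) (- w)) + supp K (vec2 (- (w * \<beta>)) w) +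
             len x * supp K (vec2 1 0) + len x0 * supp K (vec2 (-1) 0)"
          unfolding B mixed_area_translate lenx[symmetric]
          by (rule mixed_area_trapezoid[OF K wl])
        moreover have "2 * mixed_area K (P \<inter> {v. v$1 = x0}) = len x0 * supp K (vec2 1 0) + len x0 * supp K (vec2 (-1) 0)"
          unfolding seg[OF x0(1)] mixed_area_translate by (rule mixed_area_vertical_segment[OF K len[OF x0(1)]])
        ultimately show ?thesis using ns[OF K] by (simp add: ns'_def)
      qed
      then show ?thesis by blast
    qed
  qed
  define M where "M = Max X"
  have M: "M \<in> X" unfolding M_def by (rule Max_in[OF X])
  have "F \<subseteq> {v. v$1 \<le> M}" using X by (auto simp: M_def X_def)
  then have "P \<subseteq> {v. v$1 \<le> M}" unfolding P_def by (intro hull_minimal vertical_halfspace)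
  then have PM: "P \<inter> {v. v$1 \<le> M} = P" by auto
  obtain ns where ns: "\<And>K. K \<in> convex_bodies2 \<Longrightarrow> 2 * mixed_area K P = (\<Sum>n\<leftarrow>ns. supp K n) + len M * supp K (vec2 1 0)"
    using main[OF M] unfolding PM by blast
  have "2 * mixed_area K P = (\<Sum>n\<leftarrow>ns @ [len M *\<^sub>R vec2 1 0]. supp K n)" if K: "K \<in> convex_bodies2" for K
    using ns[OF K] supp_scaleR[OF K len[OF M]] by simp
  then show ?thesis unfolding P_def by blast
qed

subsection \<open>Triangles\<close>

definition cross2 :: "real^2 \<Rightarrow> real^2 \<Rightarrow> real" where
  "cross2 u v = u$1 * v$2 - u$2 * v$1"

text \<open>The clockwise quarter turn, which takes an edge of a counterclockwise polygon to an
  outer normal of the same length.\<close>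

definition rot :: "real^2 \<Rightarrow> real^2" where
  "rot u = vec2 (u$2) (- u$1)"

definition lin2 :: "real^2 \<Rightarrow> real^2 \<Rightarrow> real^2 \<Rightarrow> real^2" where
  "lin2 u v x = x$1 *\<^sub>R u + x$2 *\<^sub>R v"

lemma linear_lin2: "linear (lin2 u v)"
  by (rule linearI) (simp_all add: lin2_def algebra_simps)

lemma linear_image_body:
  assumes "linear A" "K \<in> convex_bodies2" shows "A ` K \<in> convex_bodies2"
proof -
  have "continuous_on K A" using assms(1) by (simp add: linear_continuous_on linear_conv_bounded_linear)
  then show ?thesis using convex_bodies2D[OF assms(2)] convex_linear_image[OF assms(1)] compact_continuous_image
    by (auto simp: convex_bodies2_def)
qed

lemma minkowski_sum_linear_image:
  assumes "linear A" shows "minkowski_sum (A ` K) (A ` L) = A ` minkowski_sum K L"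
proof
  show "minkowski_sum (A ` K) (A ` L) \<subseteq> A ` minkowski_sum K L"
  proof
    fix z assume "z \<in> minkowski_sum (A ` K) (A ` L)"
    then obtain k l where "k \<in> K" "l \<in> L" "z = A k + A l" unfolding minkowski_sum_def by blast
    then show "z \<in> A ` minkowski_sum K L"
      using minkowski_sumI[of k K l L] by (intro image_eqI[of _ _ "k + l"]) (simp_all add: linear_add[OF assms])
  qed
  show "A ` minkowski_sum K L \<subseteq> minkowski_sum (A ` K) (A ` L)"
  proof
    fix z assume "z \<in> A ` minkowski_sum K L"
    then obtain k l where "k \<in> K" "l \<in> L" "z = A (k + l)" unfolding minkowski_sum_def by blast
    then show "z \<in> minkowski_sum (A ` K) (A ` L)"
      using minkowski_sumI[of "A k" "A ` K" "A l" "A ` L"] by (simp add: linear_add[OF assms])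
  qed
qed

lemma mixed_area_linear_image:
  assumes A: "linear A" and K: "K \<in> convex_bodies2" "L \<in> convex_bodies2"
  shows "mixed_area (A ` K) (A ` L) = \<bar>det (matrix A)\<bar> * mixed_area K L"
  unfolding mixed_area_def minkowski_sum_linear_image[OF A]
  using measure_linear_image[OF A lmeasurable_body] minkowski_sum_body K
  by (simp add: algebra_simps)

lemma det_lin2: "det (matrix (lin2 u v)) = cross2 u v"
  by (simp add: det_2 matrix_def lin2_def cross2_def axis_def)

lemma supp_lin2_image:
  assumes "K \<in> convex_bodies2"
  shows "supp (lin2 u v ` K) n = supp K (vec2 (u \<bullet> n) (v \<bullet> n))"
proof -
  have e: "lin2 u v x \<bullet> n = x \<bullet> vec2 (u \<bullet> n) (v \<bullet> n)" for x
    by (simp add: lin2_def inner_real2 algebra_simps)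
  obtain x where x: "x \<in> K" "x \<bullet> vec2 (u \<bullet> n) (v \<bullet> n) = supp K (vec2 (u \<bullet> n) (v \<bullet> n))"
     "\<And>y. y \<in> K \<Longrightarrow> y \<bullet> vec2 (u \<bullet> n) (v \<bullet> n) \<le> supp K (vec2 (u \<bullet> n) (v \<bullet> n))"
    by (rule supp_attained[OF assms]) (rule that; assumption)
  show ?thesis by (rule supp_eqI[of "lin2 u v x"]) (use x e in auto)
qed

text \<open>Pull \<open>K\<close> back to the coordinates in which the trapezoid is standard. The
  determinant by which mixed areas scale cancels the denominators of the inverse map, so the normals
  become integral combinations in \<open>rot u\<close>, \<open>rot v\<close> with the coefficients
  of the standard formula.\<close>

lemma mixed_area_lin2_trapezoid:
  assumes K: "K \<in> convex_bodies2" and d: "cross2 u v > 0" and c: "0 \<le> c" "0 \<le> c + \<beta>"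
  shows "2 * mixed_area K (lin2 u v ` trapezoid 1 c 0 \<beta>) =
    supp K (rot u) + supp K (- rot u - \<beta> *\<^sub>R rot v) + (c + \<beta>) * supp K (rot v) + c * supp K (- rot v)"
proof -
  define d where "d = cross2 u v"
  have d0: "d > 0" "d \<noteq> 0" using d by (auto simp: d_def)
  \<comment> \<open>Cramer's rule for the inverse of \<open>lin2 u v\<close>.\<close>
  define B where "B = (\<lambda>y. vec2 (cross2 y v / d) (cross2 u y / d))"
  have "linear B"
    by (rule linearI) (simp_all add: B_def vec2_arith cross2_def add_divide_distrib diff_divide_distrib algebra_simps)
  define K0 where "K0 = B ` K"
  have K0: "K0 \<in> convex_bodies2" unfolding K0_def by (rule linear_image_body[OF \<open>linear B\<close> K])
  have inv: "lin2 u v (B y) = y" for y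
  proof -
    have "d * y$1 = cross2 y v * u$1 + cross2 u y * v$1" "d * y$2 = cross2 y v * u$2 + cross2 u y * v$2"
      by (simp_all add: d_def cross2_def algebra_simps)
    then show ?thesis
      using d0 by (simp add: B_def lin2_def vec_eq_iff forall_2 divide_simps) (simp add: mult.commute)
  qed
  have K_eq: "K = lin2 u v ` K0" unfolding K0_def image_image inv by simp
  have sc: "d * supp K0 (vec2 p q) = supp K (p *\<^sub>R rot v - q *\<^sub>R rot u)" for p q
  proof -
    have "u \<bullet> (p *\<^sub>R rot v - q *\<^sub>R rot u) = d * p" "v \<bullet> (p *\<^sub>R rot v - q *\<^sub>R rot u) = d * q"
      by (simp_all add: d_def cross2_def rot_def inner_real2 algebra_simps)
    then have "supp K (p *\<^sub>R rot v - q *\<^sub>R rot u) = supp K0 (d *\<^sub>R vec2 p q)"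
      unfolding K_eq supp_lin2_image[OF K0] by (simp add: vec2_arith)
    then show ?thesis using supp_scaleR[OF K0] d0 by simp
  qed
  have "2 * mixed_area K (lin2 u v ` trapezoid 1 c 0 \<beta>) = d * (2 * mixed_area K0 (trapezoid 1 c 0 \<beta>))"
    unfolding K_eq using mixed_area_linear_image[OF linear_lin2 K0 trapezoid_body[of 1 c \<beta> 0]] c d0
    by (simp add: det_lin2 d_def)
  also have "2 * mixed_area K0 (trapezoid 1 c 0 \<beta>) = supp K0 (vec2 0 (-1)) + supp K0 (vec2 (-\<beta>) 1) +
      (c + \<beta>) * supp K0 (vec2 1 0) + c * supp K0 (vec2 (-1) 0)"
    using mixed_area_trapezoid[OF K0, of 1 c \<beta> 0] c by simp
  also have "d * \<dots> = d * supp K0 (vec2 0 (-1)) + d * supp K0 (vec2 (-\<beta>) 1) +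
      (c + \<beta>) * (d * supp K0 (vec2 1 0)) + c * (d * supp K0 (vec2 (-1) 0))"
    by (simp add: algebra_simps)
  finally have "2 * mixed_area K (lin2 u v ` trapezoid 1 c 0 \<beta>) =
      supp K (0 *\<^sub>R rot v - (-1) *\<^sub>R rot u) + supp K ((-\<beta>) *\<^sub>R rot v - 1 *\<^sub>R rot u) +
      (c + \<beta>) * supp K (1 *\<^sub>R rot v - 0 *\<^sub>R rot u) + c * supp K ((-1) *\<^sub>R rot v - 0 *\<^sub>R rot u)"
    unfolding sc .
  moreover have "0 *\<^sub>R rot v - (-1) *\<^sub>R rot u = rot u" "(-\<beta>) *\<^sub>R rot v - 1 *\<^sub>R rot u = - rot u - \<beta> *\<^sub>R rot v"
    "1 *\<^sub>R rot v - 0 *\<^sub>R rot u = rot v" "(-1) *\<^sub>R rot v - 0 *\<^sub>R rot u = - rot v" by simp_all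
  ultimately show ?thesis by (simp only:)
qed

text \<open>The standard triangle has vertices 0, (1,0), (1,1), so the edges of the image, in order,
  are \<open>u\<close>, \<open>v\<close> and \<open>- u - v\<close>.\<close>

definition tri :: "real^2 \<Rightarrow> real^2 \<Rightarrow> (real^2) set" where
  "tri u v = lin2 u v ` trapezoid 1 0 0 1"

text \<open>The triangle with vertices \<open>0\<close>, \<open>u\<close>, \<open>u + v\<close> is either counterclockwise or a segment traversed back and forth;
  in both cases the rotated edges are outer normals.\<close>

definition edge_pair :: "real^2 \<Rightarrow> real^2 \<Rightarrow> bool" where
  "edge_pair u v \<longleftrightarrow> cross2 u v > 0 \<or> v = - u"

lemma tri_body: "tri u v \<in> convex_bodies2"
  unfolding tri_def by (intro linear_image_body linear_lin2 trapezoid_body) auto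

lemma supp_tri: "supp (tri u v) n = max 0 (max (u \<bullet> n) ((u + v) \<bullet> n))"
proof -
  define p q where "p = u \<bullet> n" and "q = v \<bullet> n"
  define M where "M = max 0 (max p (p + q))"
  have b: "trapezoid 1 0 0 1 \<in> convex_bodies2" by (rule trapezoid_body) auto
  have ub: "y \<bullet> vec2 p q \<le> M" if "y \<in> trapezoid 1 0 0 1" for y
  proof -
    have y: "0 \<le> y$2" "y$2 \<le> y$1" "y$1 \<le> 1" using that by (auto simp: trapezoid_def)
    \<comment> \<open>The barycentric weights of \<open>y\<close> at the vertices 0, (1,0), (1,1)
      are \<open>1 - y$1\<close>, \<open>y$1 - y$2\<close> and \<open>y$2\<close>.\<close>
    have "(y$1 - y$2) * p \<le> (y$1 - y$2) * M" "y$2 * (p + q) \<le> y$2 * M" "0 \<le> (1 - y$1) * M"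
      using y by (auto intro!: mult_left_mono mult_nonneg_nonneg simp: M_def)
    then show ?thesis by (simp add: inner_real2 algebra_simps)
  qed
  have "M = 0 \<or> M = p \<or> M = p + q" by (auto simp: M_def max_def)
  then have "\<exists>y\<in>trapezoid 1 0 0 1. y \<bullet> vec2 p q = M"
  proof (elim disjE)
    assume "M = 0" then show ?thesis by (intro bexI[of _ "vec2 0 0"]) (auto simp: vec2_trapezoid inner_real2)
  next
    assume "M = p" then show ?thesis by (intro bexI[of _ "vec2 1 0"]) (auto simp: vec2_trapezoid inner_real2)
  next
    assume "M = p + q" then show ?thesis by (intro bexI[of _ "vec2 1 1"]) (auto simp: vec2_trapezoid inner_real2)
  qed
  then have "supp (trapezoid 1 0 0 1) (vec2 p q) = M" using ub supp_eqI by blast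
  then show ?thesis
    unfolding tri_def supp_lin2_image[OF b] p_def q_def M_def by (simp add: inner_add_left)
qed

lemma rot_uminus: "rot (- u) = - rot u"
  by (simp add: rot_def vec_eq_iff forall_2)

theorem mixed_area_tri:
  assumes K: "K \<in> convex_bodies2" and uv: "edge_pair u v"
  shows "2 * mixed_area K (tri u v) = supp K (rot u) + supp K (rot v) + supp K (- rot u - rot v)"
proof (cases "cross2 u v > 0")
  case True
  show ?thesis using mixed_area_lin2_trapezoid[OF K True, of 0 1] unfolding tri_def by simp
next
  case False
  then have v: "v = - u" using uv by (simp add: edge_pair_def)
  show ?thesis
  proof (cases "u = 0")
    case True
    have "rot 0 = 0" by (simp add: rot_def vec_eq_iff forall_2)
    moreover have "tri u v = {0}"
    proof
      show "tri u v \<subseteq> {0}" unfolding tri_def v True by (auto simp: lin2_def)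
      show "{0} \<subseteq> tri u v" unfolding tri_def v True
        using convex_bodies2D(1)[OF trapezoid_body[of 1 0 1 0]] by (auto simp: lin2_def)
    qed
    ultimately show ?thesis using K v True by (simp add: mixed_area_zero supp_zero)
  next
    case False
    \<comment> \<open>Here \<open>lin2 u v\<close> is singular. The segment is parametrised instead
      by \<open>u\<close> and its counterclockwise quarter turn, and is the image of a trapezoid of
      height 0.\<close>
    define w where "w = vec2 (- u$2) (u$1)"
    have w: "cross2 u w > 0"
    proof -
      have "cross2 u w = u \<bullet> u" by (simp add: w_def cross2_def inner_real2)
      then show ?thesis using False by simp
    qed
    have "tri u v = lin2 u w ` trapezoid 1 0 0 0"
    proof
      show "tri u v \<subseteq> lin2 u w ` trapezoid 1 0 0 0"
      proof
        fix z assume "z \<in> tri u v"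
        then obtain y where y: "y \<in> trapezoid 1 0 0 1" "z = lin2 u v y" unfolding tri_def by blast
        then have "z = lin2 u w (vec2 (y$1 - y$2) 0)" by (simp add: lin2_def v algebra_simps)
        moreover have "vec2 (y$1 - y$2) 0 \<in> trapezoid 1 0 0 0" using y(1) by (auto simp: trapezoid_def)
        ultimately show "z \<in> lin2 u w ` trapezoid 1 0 0 0" by blast
      qed
      show "lin2 u w ` trapezoid 1 0 0 0 \<subseteq> tri u v"
      proof
        fix z assume "z \<in> lin2 u w ` trapezoid 1 0 0 0"
        then obtain y where y: "y \<in> trapezoid 1 0 0 0" "z = lin2 u w y" by blast
        then have "y$2 = 0" by (auto simp: trapezoid_def)
        then have "z = lin2 u v (vec2 (y$1) 0)" using y by (simp add: lin2_def)
        moreover have "vec2 (y$1) 0 \<in> trapezoid 1 0 0 1" using y(1) by (auto simp: trapezoid_def)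
        ultimately show "z \<in> tri u v" unfolding tri_def by blast
      qed
    qed
    then show ?thesis using mixed_area_lin2_trapezoid[OF K w, of 0 0] K by (simp add: v rot_uminus supp_zero)
  qed
qed

text \<open>By the triangle formula the mixed area with \<open>tri u v\<close> is additive in the
  other body, since support functions are. Rewriting the area of \<open>K + L + tri u v\<close>
  turns this into additivity in the second argument.\<close>

lemma mixed_area_minkowski_sum_tri:
  assumes K: "K \<in> convex_bodies2" and L: "L \<in> convex_bodies2" and uv: "edge_pair u v"
  shows "mixed_area K (minkowski_sum (tri u v) L) = mixed_area K (tri u v) + mixed_area K L"
proof -
  have "2 * mixed_area (minkowski_sum K L) (tri u v) = 2 * mixed_area K (tri u v) + 2 * mixed_area L (tri u v)"
    unfolding mixed_area_tri[OF minkowski_sum_body[OF K L] uv] mixed_area_tri[OF K uv] mixed_area_tri[OF L uv]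
    by (simp add: supp_minkowski_sum K L)
  moreover have "minkowski_sum K (minkowski_sum (tri u v) L) = minkowski_sum (minkowski_sum K L) (tri u v)"
    by (metis minkowski_sum_assoc minkowski_sum_commute)
  moreover have "minkowski_sum (tri u v) L = minkowski_sum L (tri u v)" by (rule minkowski_sum_commute)
  ultimately show ?thesis by (simp add: mixed_area_def diff_divide_distrib)
qed

section \<open>Minkowski sums of triangles\<close>

definition tri_sum :: "((real^2) \<times> (real^2)) list \<Rightarrow> (real^2) set" where
  "tri_sum ts = foldr (\<lambda>(u, v) S. minkowski_sum (tri u v) S) ts {0}"

lemma tri_sum_simps [simp]: "tri_sum [] = {0}" "tri_sum ((u, v) # ts) = minkowski_sum (tri u v) (tri_sum ts)"
  by (simp_all add: tri_sum_def)

lemma tri_sum_body: "tri_sum ts \<in> convex_bodies2"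
  by (induction ts) (auto simp: zero_body intro!: minkowski_sum_body tri_body)

lemma mixed_area_tri_sum:
  "K \<in> convex_bodies2 \<Longrightarrow> (\<And>u v. (u, v) \<in> set ts \<Longrightarrow> edge_pair u v) \<Longrightarrow>
    mixed_area K (tri_sum ts) = (\<Sum>(u, v)\<leftarrow>ts. mixed_area K (tri u v))"
  by (induction ts) (auto simp: mixed_area_zero mixed_area_minkowski_sum_tri tri_sum_body)

lemma supp_tri_sum: "supp (tri_sum ts) n = (\<Sum>(u, v)\<leftarrow>ts. supp (tri u v) n)"
proof (induction ts)
  case Nil
  have "supp {0} n = 0" by (rule supp_eqI[of 0]) auto
  then show ?case by simp
qed (auto simp: supp_minkowski_sum tri_body tri_sum_body)

subsection \<open>Balanced normals decompose into triangles\<close>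

lemma rot_surj: obtains u where "rot u = a"
proof
  show "rot (vec2 (- a$2) (a$1)) = a" by (simp add: rot_def vec_eq_iff forall_2)
qed

lemma cross2_rot: "cross2 (rot u) (rot v) = cross2 u v"
  by (simp add: cross2_def rot_def)

lemma supp_scaleR_split:
  assumes "K \<in> convex_bodies2"
  shows "supp K (r *\<^sub>R m) = max r 0 * supp K m + max (- r) 0 * supp K (- m)"
proof (cases "r \<ge> 0")
  case True then show ?thesis using supp_scaleR[OF assms True] by (simp add: max_def)
next
  case False
  then show ?thesis using supp_scaleR[OF assms, of "- r" "- m"] by (simp add: max_def)
qed

lemma cross2_zero_parallel:
  assumes "cross2 a b = 0"
  obtains m r s where "a = r *\<^sub>R m" "b = s *\<^sub>R m"
proof (cases "a = 0")
  case True
  show ?thesis by (rule that[of 0 b 1]) (simp_all add: True)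
next
  case False
  have "b = ((a \<bullet> b) / (a \<bullet> a)) *\<^sub>R a"
  proof -
    have "(a \<bullet> a) *\<^sub>R b = (a \<bullet> b) *\<^sub>R a"
    proof -
      have ab: "a$1 * b$2 = a$2 * b$1" using assms by (simp add: cross2_def)
      have "(a \<bullet> a) * b$1 = (a \<bullet> b) * a$1" using ab by (simp add: inner_real2) algebra
      moreover have "(a \<bullet> a) * b$2 = (a \<bullet> b) * a$2" using ab by (simp add: inner_real2) algebra
      ultimately show ?thesis by (simp add: vec_eq_iff forall_2)
    qed
    then have "((1 / (a \<bullet> a)) * (a \<bullet> a)) *\<^sub>R b = ((1 / (a \<bullet> a)) * (a \<bullet> b)) *\<^sub>R a"
      by (metis scaleR_scaleR)
    then show ?thesis using False by simp
  qed
  then show ?thesis using that[of 1 a] by simp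
qed

text \<open>The normals are turned back into edges, ordered counterclockwise by the sign of the
  determinant. If they are parallel, the three support values amount to the width in one direction,
  which is the case of a segment.\<close>

lemma balanced_three:
  assumes "a + b + c = (0 :: real^2)"
  obtains u v where "edge_pair u v"
    "\<And>K. K \<in> convex_bodies2 \<Longrightarrow> supp K a + supp K b + supp K c = 2 * mixed_area K (tri u v)"
proof -
  have c: "c = - a - b" using assms by (simp add: algebra_simps eq_neg_iff_add_eq_0)
  obtain u where u: "rot u = a" by (rule rot_surj)
  obtain v where v: "rot v = b" by (rule rot_surj)
  have cr: "cross2 a b = cross2 u v" using cross2_rot[of u v] by (simp add: u v)
  consider "cross2 u v > 0" | "cross2 u v < 0" | "cross2 a b = 0" using cr by linarith
  then show ?thesis
  proof cases
    case 1
    then have "edge_pair u v" by (simp add: edge_pair_def)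
    then show ?thesis using that[of u v] mixed_area_tri by (simp add: u v c)
  next
    case 2
    then have "edge_pair v u" by (simp add: edge_pair_def cross2_def algebra_simps)
    have e: "- b - a = c" by (simp add: c)
    have "supp K a + supp K b + supp K c = 2 * mixed_area K (tri v u)" if "K \<in> convex_bodies2" for K
      using mixed_area_tri[OF that \<open>edge_pair v u\<close>] unfolding u v e by simp
    then show ?thesis using that \<open>edge_pair v u\<close> by blast
  next
    case 3
    then obtain m r s where m: "a = r *\<^sub>R m" "b = s *\<^sub>R m" by (rule cross2_zero_parallel)
    define q where "q = - r - s"
    have cq: "c = q *\<^sub>R m" by (simp add: c m q_def algebra_simps)
    \<comment> \<open>As \<open>r + s + q = 0\<close>, the positive parts and the negative parts
      have the same sum \<open>\<tau>\<close>.\<close>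
    define \<tau> where "\<tau> = max r 0 + max s 0 + max q 0"
    have \<tau>: "\<tau> = max (- r) 0 + max (- s) 0 + max (- q) 0" "\<tau> \<ge> 0" by (auto simp: \<tau>_def q_def max_def)
    obtain w where w: "rot w = \<tau> *\<^sub>R m" by (rule rot_surj)
    have ep: "edge_pair w (- w)" by (simp add: edge_pair_def)
    have "supp K a + supp K b + supp K c = 2 * mixed_area K (tri w (- w))" if K: "K \<in> convex_bodies2" for K
    proof -
      have "supp K a + supp K b + supp K c = \<tau> * supp K m + \<tau> * supp K (- m)"
        unfolding m cq supp_scaleR_split[OF K, of r] supp_scaleR_split[OF K, of s] supp_scaleR_split[OF K, of q]
        by (subst (2) \<tau>(1)) (simp add: \<tau>_def algebra_simps)
      also have "\<dots> = supp K (\<tau> *\<^sub>R m) + supp K (- (\<tau> *\<^sub>R m))"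
        using supp_scaleR[OF K \<tau>(2), of m] supp_scaleR[OF K \<tau>(2), of "- m"] by simp
      also have "\<dots> = 2 * mixed_area K (tri w (- w))"
        unfolding mixed_area_tri[OF K ep] rot_uminus w by (simp add: supp_zero K)
      finally show ?thesis .
    qed
    then show ?thesis using that ep by blast
  qed
qed

text \<open>Padding with zeros reaches exactly three summands, and \<open>h 0 = 0\<close> makes the
  padding harmless.\<close>

lemma sum_card_le_3:
  assumes "finite S" "card S \<le> 3"
  obtains a b c :: "'a::comm_monoid_add" where
    "\<And>h. h 0 = (0::real) \<Longrightarrow> (\<Sum>v\<in>S. h (w v)) = h a + h b + h c" "(\<Sum>v\<in>S. w v) = a + b + c"
proof -
  obtain xs where xs: "set xs = S" "distinct xs" using finite_distinct_list[OF assms(1)] by blast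
  then have len: "length xs \<le> 3" using assms(2) distinct_card by fastforce
  have sum: "(\<Sum>v\<in>S. h (w v)) = (\<Sum>v\<leftarrow>xs. h (w v))" for h :: "'a \<Rightarrow> real"
    using xs by (simp add: sum_list_distinct_conv_sum_set)
  have sum': "(\<Sum>v\<in>S. w v) = (\<Sum>v\<leftarrow>xs. w v)" using xs by (simp add: sum_list_distinct_conv_sum_set)
  consider "xs = []" | x where "xs = [x]" | x y where "xs = [x, y]" | x y z where "xs = [x, y, z]"
    using len by (auto simp: length_Suc_conv le_Suc_eq numeral_3_eq_3)
  then show ?thesis
  proof cases
    case 1 then show ?thesis using that[of 0 0 0] sum sum' by simp
  next
    case (2 x) then show ?thesis using that[of "w x" 0 0] sum sum' by simp
  next
    case (3 x y) then show ?thesis using that[of "w x" "w y" 0] sum sum' by simp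
  next
    case (4 x y z) then show ?thesis using that[of "w x" "w y" "w z"] sum sum' by (simp add: add.assoc)
  qed
qed

text \<open>Positive weights put 0 in the convex hull of the normals, and Caratheodory's theorem in
  the plane yields a nonnegative relation \<open>e\<close> among at most three of them. Subtracting
  the largest multiple of \<open>e\<close> that keeps all weights nonnegative splits off one
  triangle and removes at least one normal.\<close>

theorem balanced_normals_triangles:
  fixes c :: "real^2 \<Rightarrow> real"
  assumes "finite A" "\<And>v. v \<in> A \<Longrightarrow> c v \<ge> 0" "(\<Sum>v\<in>A. c v *\<^sub>R v) = 0"
  shows "\<exists>ts. (\<forall>(u, v)\<in>set ts. edge_pair u v) \<and>
    (\<forall>K\<in>convex_bodies2. (\<Sum>v\<in>A. c v * supp K v) = (\<Sum>(u, v)\<leftarrow>ts. 2 * mixed_area K (tri u v)))"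
  using assms
proof (induction "card A" arbitrary: A c rule: less_induct)
  case less
  have step: "\<exists>ts. (\<forall>(u, v)\<in>set ts. edge_pair u v) \<and>
    (\<forall>K\<in>convex_bodies2. (\<Sum>v\<in>A. c' v * supp K v) = (\<Sum>(u, v)\<leftarrow>ts. 2 * mixed_area K (tri u v)))"
    if "v0 \<in> A" "c' v0 = 0" "\<And>v. v \<in> A \<Longrightarrow> c' v \<ge> 0" "(\<Sum>v\<in>A. c' v *\<^sub>R v) = 0" for c' v0
  proof -
    have "card (A - {v0}) < card A" using less.prems(1) that(1) by (rule card_Diff1_less)
    moreover have "(\<Sum>v\<in>A. c' v *\<^sub>R v) = (\<Sum>v\<in>A - {v0}. c' v *\<^sub>R v)"
      using that(1,2) less.prems(1) by (simp add: sum.remove)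
    moreover have "(\<Sum>v\<in>A. c' v * supp K v) = (\<Sum>v\<in>A - {v0}. c' v * supp K v)" for K
      using that(1,2) less.prems(1) by (simp add: sum.remove)
    ultimately show ?thesis using less.hyps[of "A - {v0}" c'] that less.prems(1) by simp
  qed
  show ?case
  proof (cases "A = {} \<or> (\<exists>v\<in>A. c v = 0)")
    case True
    then show ?thesis
    proof
      assume "A = {}" then show ?thesis by (intro exI[of _ "[]"]) simp
    next
      assume "\<exists>v\<in>A. c v = 0" then show ?thesis using step[of _ c] less.prems by blast
    qed
  next
    case False
    then have pos: "c v > 0" if "v \<in> A" for v using less.prems(2)[OF that] that by (auto simp: less_le)
    have spos: "sum c A > 0" using False pos less.prems(1) by (intro sum_pos) auto
    have "0 \<in> convex hull A"
    proof -
      have "(\<Sum>v\<in>A. (c v / sum c A) *\<^sub>R v) = (1 / sum c A) *\<^sub>R (\<Sum>v\<in>A. c v *\<^sub>R v)"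
        by (simp add: scaleR_sum_right)
      then have "(\<Sum>v\<in>A. (c v / sum c A) *\<^sub>R v) = 0" using less.prems(3) by simp
      moreover have "(\<Sum>v\<in>A. c v / sum c A) = 1" using spos by (simp flip: sum_divide_distrib)
      ultimately show ?thesis
        unfolding convex_hull_finite[OF less.prems(1)]
        using pos spos by (auto intro!: exI[of _ "\<lambda>v. c v / sum c A"] less_imp_le)
    qed
    then obtain S where S: "finite S" "S \<subseteq> A" "card S \<le> 3" "0 \<in> convex hull S"
      using caratheodory[of A] by auto
    obtain e where e: "\<And>v. v \<in> S \<Longrightarrow> e v \<ge> 0" "sum e S = 1" "(\<Sum>v\<in>S. e v *\<^sub>R v) = 0"
      using S(4) unfolding convex_hull_finite[OF S(1)] by auto
    define R where "R = {v\<in>S. e v > 0}"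
    have "R \<noteq> {}"
    proof
      assume "R = {}"
      then have "sum e S \<le> 0" by (intro sum_nonpos) (auto simp: R_def not_less)
      then show False using e(2) by simp
    qed
    moreover have "finite R" using S(1) by (simp add: R_def)
    ultimately have "Min ((\<lambda>v. c v / e v) ` R) \<in> (\<lambda>v. c v / e v) ` R" by (intro Min_in) auto
    then obtain v0 where v0: "v0 \<in> R" "c v0 / e v0 = Min ((\<lambda>v. c v / e v) ` R)" by force
    define t where "t = c v0 / e v0"
    have v0': "v0 \<in> A" "v0 \<in> S" "e v0 > 0" using v0 S(2) by (auto simp: R_def)
    have t0: "t \<ge> 0" using pos[OF v0'(1)] v0' by (simp add: t_def)
    have tmin: "t * e v \<le> c v" if "v \<in> R" for v
    proof -
      have "t \<le> c v / e v" unfolding t_def v0(2) using that \<open>finite R\<close> by (intro Min_le) auto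
      then show ?thesis using that by (simp add: R_def pos_le_divide_eq)
    qed
    define e' where "e' = (\<lambda>v. if v \<in> S then t * e v else 0)"
    define c' where "c' = (\<lambda>v. c v - e' v)"
    have c'0: "c' v \<ge> 0" if "v \<in> A" for v
      using tmin[of v] e(1)[of v] pos[OF that] by (cases "v \<in> S"; cases "e v = 0") (auto simp: c'_def e'_def R_def less_le)
    have e'z: "(\<Sum>v\<in>A. e' v *\<^sub>R v) = 0"
    proof -
      have "(\<Sum>v\<in>A. e' v *\<^sub>R v) = (\<Sum>v\<in>S. (t * e v) *\<^sub>R v)" using S(2) less.prems(1)
        by (intro sum.mono_neutral_cong_right) (auto simp: e'_def)
      also have "\<dots> = t *\<^sub>R (\<Sum>v\<in>S. e v *\<^sub>R v)" by (simp add: scaleR_sum_right)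
      finally show ?thesis using e(3) by simp
    qed
    have c'z: "(\<Sum>v\<in>A. c' v *\<^sub>R v) = 0"
      using less.prems(3) e'z by (simp add: c'_def scaleR_diff_left sum_subtractf)
    have "c' v0 = 0" using v0' by (simp add: c'_def e'_def t_def)
    from step[of v0 c', OF v0'(1) this c'0 c'z] obtain ts where ts: "\<forall>(u, v)\<in>set ts. edge_pair u v"
      "\<And>K. K \<in> convex_bodies2 \<Longrightarrow> (\<Sum>v\<in>A. c' v * supp K v) = (\<Sum>(u, v)\<leftarrow>ts. 2 * mixed_area K (tri u v))"
      by blast
    obtain x y z where xyz: "\<And>h. h 0 = (0::real) \<Longrightarrow> (\<Sum>v\<in>S. h ((t * e v) *\<^sub>R v)) = h x + h y + h z"
      "(\<Sum>v\<in>S. (t * e v) *\<^sub>R v) = x + y + z"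
      by (rule sum_card_le_3[OF S(1,3), of "\<lambda>v. (t * e v) *\<^sub>R v"]) (rule that; assumption)
    have "x + y + z = t *\<^sub>R (\<Sum>v\<in>S. e v *\<^sub>R v)" unfolding xyz(2)[symmetric] by (simp add: scaleR_sum_right)
    then have "x + y + z = 0" using e(3) by simp
    then obtain u v where uv: "edge_pair u v"
      "\<And>K. K \<in> convex_bodies2 \<Longrightarrow> supp K x + supp K y + supp K z = 2 * mixed_area K (tri u v)"
      by (rule balanced_three) (rule that; assumption)
    have "(\<Sum>w\<in>A. c w * supp K w) = (\<Sum>(u, v)\<leftarrow>(u, v) # ts. 2 * mixed_area K (tri u v))" if K: "K \<in> convex_bodies2" for K
    proof -
      have "(\<Sum>w\<in>A. c w * supp K w) = (\<Sum>w\<in>A. c' w * supp K w) + (\<Sum>w\<in>A. e' w * supp K w)"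
        by (simp add: c'_def left_diff_distrib sum_subtractf)
      also have "(\<Sum>w\<in>A. e' w * supp K w) = (\<Sum>w\<in>S. (t * e w) * supp K w)" using S(2) less.prems(1)
        by (intro sum.mono_neutral_cong_right) (auto simp: e'_def)
      also have "\<dots> = (\<Sum>w\<in>S. supp K ((t * e w) *\<^sub>R w))"
        using e(1) t0 by (intro sum.cong refl supp_scaleR[OF K, symmetric]) auto
      also have "\<dots> = supp K x + supp K y + supp K z" using xyz(1)[of "supp K"] supp_zero[OF K] by simp
      finally show ?thesis using ts(2)[OF K] uv(2)[OF K] by simp
    qed
    then show ?thesis using ts(1) uv(1) by (intro exI[of _ "(u, v) # ts"]) auto
  qed
qed

lemma sum_list_count_list:
  fixes h :: "'a \<Rightarrow> 'b::real_vector"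
  assumes "finite B" "set xs \<subseteq> B"
  shows "(\<Sum>x\<leftarrow>xs. h x) = (\<Sum>v\<in>B. real (count_list xs v) *\<^sub>R h v)"
  using assms(2)
proof (induction xs)
  case (Cons x xs)
  have "(\<Sum>v\<in>B. real (count_list (x # xs) v) *\<^sub>R h v)
      = (\<Sum>v\<in>B. (if v = x then h v else 0) + real (count_list xs v) *\<^sub>R h v)"
    by (intro sum.cong refl) (auto simp: scaleR_add_left)
  also have "\<dots> = h x + (\<Sum>v\<in>B. real (count_list xs v) *\<^sub>R h v)"
    using Cons.prems assms(1) by (simp add: sum.distrib sum.delta)
  finally show ?case using Cons by simp
qed simp

theorem polygon_triangles:
  fixes F :: "(real^2) set"
  assumes F: "finite F" "F \<noteq> {}"
  shows "\<exists>ts. (\<forall>(u, v)\<in>set ts. edge_pair u v) \<and>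
    (\<forall>K\<in>convex_bodies2. mixed_area K (convex hull F) = (\<Sum>(u, v)\<leftarrow>ts. mixed_area K (tri u v)))"
proof -
  obtain ns where ns: "\<And>K. K \<in> convex_bodies2 \<Longrightarrow> 2 * mixed_area K (convex hull F) = (\<Sum>n\<leftarrow>ns. supp K n)"
    using mixed_area_polygon[OF F] by blast
  define s where "s = sum_list ns"
  have "s = 0"
  proof -
    \<comment> \<open>The normals balance because a point has mixed area 0 with every body: tested
      on the point \<open>s\<close>, the formula yields \<open>s \<bullet> s = 0\<close>.\<close>
    have sb: "{s} \<in> convex_bodies2" by (simp add: convex_bodies2_def)
    have "mixed_area (convex hull F) ((+) s ` {0}) = 0" unfolding mixed_area_translate mixed_area_zero ..
    then have "mixed_area {s} (convex hull F) = 0" by (simp add: mixed_area_commute)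
    then have "(\<Sum>n\<leftarrow>ns. supp {s} n) = 0" using ns[OF sb] by simp
    moreover have "supp {s} n = s \<bullet> n" for n by (rule supp_eqI[of s]) auto
    moreover have "(\<Sum>n\<leftarrow>ns. s \<bullet> n) = s \<bullet> sum_list ns" by (induction ns) (auto simp: inner_add_right)
    ultimately show ?thesis by (simp add: s_def)
  qed
  have "(\<Sum>v\<in>set ns. real (count_list ns v) *\<^sub>R v) = 0"
    using sum_list_count_list[of "set ns" ns "\<lambda>v. v"] \<open>s = 0\<close> by (simp add: s_def)
  from balanced_normals_triangles[OF _ _ this] obtain ts where ts: "\<forall>(u, v)\<in>set ts. edge_pair u v"
    "\<And>K. K \<in> convex_bodies2 \<Longrightarrow> (\<Sum>v\<in>set ns. real (count_list ns v) * supp K v) = (\<Sum>(u, v)\<leftarrow>ts. 2 * mixed_area K (tri u v))"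
    by auto
  have "mixed_area K (convex hull F) = (\<Sum>(u, v)\<leftarrow>ts. mixed_area K (tri u v))" if K: "K \<in> convex_bodies2" for K
  proof -
    have "(\<Sum>(u, v)\<leftarrow>ts. 2 * mixed_area K (tri u v)) = 2 * (\<Sum>(u, v)\<leftarrow>ts. mixed_area K (tri u v))"
      by (induction ts) auto
    then show ?thesis
      using ns[OF K] ts(2)[OF K] sum_list_count_list[of "set ns" ns "supp K"] by simp
  qed
  then show ?thesis using ts(1) by blast
qed

subsection \<open>Approximation by polygons\<close>

lemma supp_mono:
  assumes "K \<in> convex_bodies2" "L \<in> convex_bodies2" "K \<subseteq> L" shows "supp K u \<le> supp L u"
proof -
  obtain x where "x \<in> K" "x \<bullet> u = supp K u" using supp_attained[OF assms(1)] by metis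
  then show ?thesis using supp_ge[OF assms(2), of x u] assms(3) by auto
qed

text \<open>The sum of the two coordinate widths, which is twice the mixed area with the unit
  square. It governs the growth of area when a small square is added.\<close>

definition total_width :: "(real^2) set \<Rightarrow> real" where
  "total_width C = supp C (vec2 0 (-1)) + supp C (vec2 0 1) + supp C (vec2 1 0) + supp C (vec2 (-1) 0)"

lemma total_width_mono:
  "K \<in> convex_bodies2 \<Longrightarrow> L \<in> convex_bodies2 \<Longrightarrow> K \<subseteq> L \<Longrightarrow> total_width K \<le> total_width L"
  unfolding total_width_def by (intro add_mono supp_mono)

lemma area_square:
  assumes "0 \<le> w" shows "area (trapezoid w w 0 0) = w * w"
proof (rule area_by_slices)
  show "compact (trapezoid w w 0 0)" using convex_bodies2D(2) trapezoid_body[of w w 0 0] assms by simp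
  show "\<And>x y. vec2 x y \<in> trapezoid w w 0 0 \<longleftrightarrow> 0 \<le> x \<and> x \<le> w \<and> 0 \<le> y \<and> y \<le> w"
    by (simp add: vec2_trapezoid)
  show "((\<lambda>x. w - 0) has_integral w * w) {0..w}"
    using has_integral_constant_real[OF assms, of w] by simp
qed (use assms in auto)

lemma area_add_square:
  assumes C: "C \<in> convex_bodies2" and w: "0 \<le> w"
  shows "area (minkowski_sum C ((+) t ` trapezoid w w 0 0)) = area C + w * w + w * total_width C"
proof -
  have "2 * mixed_area C (trapezoid w w 0 0) = supp C (vec2 0 (- w)) + supp C (vec2 0 w) + w * supp C (vec2 1 0) + w * supp C (vec2 (-1) 0)"
    using mixed_area_trapezoid[OF C w w, of 0 0] w by simp
  also have "\<dots> = w * total_width C"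
    using supp_scaleR[OF C w, of "vec2 0 (-1)"] supp_scaleR[OF C w, of "vec2 0 1"]
    by (simp add: vec2_arith total_width_def algebra_simps)
  finally show ?thesis
    by (simp add: minkowski_sum_translate measure_translation mixed_area_def area_square[OF w])
qed

text \<open>The hull of the net lies in \<open>L\<close>, and \<open>L\<close> lies in that hull
  plus a square of side \<open>2 * r\<close> about the origin, since every point of \<open>L\<close>
  is within \<open>r\<close> of the net.\<close>

lemma area_net_bounds:
  assumes K: "K \<in> convex_bodies2" and L: "L \<in> convex_bodies2" and F: "finite F" "F \<noteq> {}" "F \<subseteq> L"
    and r: "0 < r" "L \<subseteq> (\<Union>x\<in>F. ball x r)"
  defines "P \<equiv> convex hull F"
  shows "area (minkowski_sum K P) \<le> area (minkowski_sum K L)"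
    and "area (minkowski_sum K L) \<le> area (minkowski_sum K P) + 2 * r * (2 * r) + 2 * r * total_width (minkowski_sum K L)"
proof -
  have P: "P \<in> convex_bodies2" unfolding P_def by (rule polygon_body[OF F(1,2)])
  have PL: "P \<subseteq> L" unfolding P_def using F(3) convex_bodies2D(3)[OF L] by (rule hull_minimal)
  note KP = minkowski_sum_body[OF K P] and KL = minkowski_sum_body[OF K L]
  have sub: "minkowski_sum K P \<subseteq> minkowski_sum K L" by (rule minkowski_sum_mono[OF subset_refl PL])
  show "area (minkowski_sum K P) \<le> area (minkowski_sum K L)"
    using sub lmeasurable_body[OF KP] lmeasurable_body[OF KL] by (intro measure_mono_fmeasurable) auto
  define Q where "Q = (+) (vec2 (-r) (-r)) ` trapezoid (2 * r) (2 * r) 0 0"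
  have Q: "Q \<in> convex_bodies2" unfolding Q_def by (intro body_translate trapezoid_body) (use r in auto)
  have "L \<subseteq> minkowski_sum P Q"
  proof
    fix l assume "l \<in> L"
    then obtain x where x: "x \<in> F" "dist x l < r" using r(2) by auto
    have xP: "x \<in> P" unfolding P_def using x(1) by (rule hull_inc)
    have "norm (l - x) < r" using x(2) by (simp add: dist_norm norm_minus_commute)
    then have "\<bar>(l - x)$1\<bar> < r" "\<bar>(l - x)$2\<bar> < r" using component_le_norm_cart[of "l - x"] le_less_trans by blast+
    then have "(l - x) - vec2 (-r) (-r) \<in> trapezoid (2 * r) (2 * r) 0 0" by (auto simp: trapezoid_def)
    then have "l - x \<in> Q" unfolding Q_def by (rule rev_image_eqI) simp
    from minkowski_sumI[OF xP this] show "l \<in> minkowski_sum P Q" by simp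
  qed
  then have "minkowski_sum K L \<subseteq> minkowski_sum (minkowski_sum K P) Q"
    unfolding minkowski_sum_assoc by (rule minkowski_sum_mono[OF subset_refl])
  then have "area (minkowski_sum K L) \<le> area (minkowski_sum (minkowski_sum K P) Q)"
    using lmeasurable_body[OF KL] lmeasurable_body[OF minkowski_sum_body[OF KP Q]]
    by (intro measure_mono_fmeasurable) auto
  also have "\<dots> = area (minkowski_sum K P) + 2 * r * (2 * r) + 2 * r * total_width (minkowski_sum K P)"
    unfolding Q_def using r by (intro area_add_square KP) auto
  also have "\<dots> \<le> area (minkowski_sum K P) + 2 * r * (2 * r) + 2 * r * total_width (minkowski_sum K L)"
    using total_width_mono[OF KP KL sub] r by simp
  finally show "area (minkowski_sum K L) \<le> area (minkowski_sum K P) + 2 * r * (2 * r) + 2 * r * total_width (minkowski_sum K L)" .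
qed

text \<open>For an inscribed polygon both the area of the sum with \<open>K j\<close> and the area
  of \<open>L\<close> itself decrease by an amount in \<open>[0, E]\<close>; the change of the mixed
  area is half the difference of the two.\<close>

lemma mixed_area_polygon_approx:
  assumes L: "L \<in> convex_bodies2" and J: "finite J" and K0: "\<forall>j\<in>J. K j \<in> convex_bodies2" and \<delta>: "\<delta> > 0"
  obtains F where "finite F" "F \<noteq> {}" "\<And>j. j \<in> J \<Longrightarrow> \<bar>mixed_area (K j) L - mixed_area (K j) (convex hull F)\<bar> < \<delta>"
proof -
  note K = bspec[OF K0]
  define M where "M = (\<Sum>j\<in>J. \<bar>total_width (minkowski_sum (K j) L)\<bar>) + \<bar>total_width L\<bar>"
  have "(\<Sum>j\<in>J. \<bar>total_width (minkowski_sum (K j) L)\<bar>) \<ge> 0" by (intro sum_nonneg) auto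
  then have M: "M \<ge> 0" "total_width L \<le> M" unfolding M_def by linarith+
  have MJ: "total_width (minkowski_sum (K j) L) \<le> M" if "j \<in> J" for j
  proof -
    have "\<bar>total_width (minkowski_sum (K j) L)\<bar> \<le> (\<Sum>j\<in>J. \<bar>total_width (minkowski_sum (K j) L)\<bar>)"
      using that J by (intro member_le_sum) auto
    then show ?thesis by (simp add: M_def)
  qed
  \<comment> \<open>With \<open>r \<le> 1\<close> the error \<open>E\<close> is at most
    \<open>r * (4 + 2 * M)\<close>; the 5 makes the final bound strict. \<open>M\<close> also bounds
    the total width of \<open>L\<close>, for the case of the body \<open>{0}\<close>.\<close>
  define r where "r = min 1 (\<delta> / (5 + 2 * M))"
  have r: "0 < r" "r \<le> 1" "r * (5 + 2 * M) \<le> \<delta>"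
  proof -
    show "0 < r" "r \<le> 1" using \<delta> M by (auto simp: r_def)
    have "r \<le> \<delta> / (5 + 2 * M)" by (simp add: r_def)
    then show "r * (5 + 2 * M) \<le> \<delta>" using M by (simp add: pos_le_divide_eq)
  qed
  have "\<exists>F. finite F \<and> F \<subseteq> L \<and> L \<subseteq> (\<Union>x\<in>F. ball x r)"
    using seq_compact_imp_totally_bounded[of L] convex_bodies2D(2)[OF L] r(1)
    by (metis compact_imp_seq_compact)
  then obtain F where F: "finite F" "F \<subseteq> L" "L \<subseteq> (\<Union>x\<in>F. ball x r)" by blast
  have F0: "F \<noteq> {}" using F(3) convex_bodies2D(1)[OF L] by auto
  define P where "P = convex hull F"
  define E where "E = 2 * r * (2 * r) + 2 * r * M"
  have "r * r \<le> r * 1" using r by (intro mult_left_mono) auto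
  then have "E \<le> r * (4 + 2 * M)" by (simp add: E_def algebra_simps)
  also have "\<dots> < r * (5 + 2 * M)" using r by simp
  finally have E: "E < \<delta>" using r by simp
  have bd: "0 \<le> area (minkowski_sum C L) - area (minkowski_sum C P) \<and> area (minkowski_sum C L) - area (minkowski_sum C P) \<le> E"
    if C: "C \<in> convex_bodies2" and W: "total_width (minkowski_sum C L) \<le> M" for C
  proof -
    have "2 * r * total_width (minkowski_sum C L) \<le> 2 * r * M" using W r by simp
    then show ?thesis
      using area_net_bounds[OF C L F(1) F0 F(2) r(1) F(3)] unfolding P_def E_def by linarith
  qed
  have b0: "0 \<le> area L - area P" "area L - area P \<le> E"
    using bd[OF zero_body] M(2) by (simp_all add: minkowski_sum_zero)
  have "\<bar>mixed_area (K j) L - mixed_area (K j) P\<bar> < \<delta>" if j: "j \<in> J" for j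
  proof -
    have "2 * (mixed_area (K j) L - mixed_area (K j) P) = (area (minkowski_sum (K j) L) - area (minkowski_sum (K j) P)) - (area L - area P)"
      by (simp add: mixed_area_def diff_divide_distrib)
    moreover have "0 \<le> area (minkowski_sum (K j) L) - area (minkowski_sum (K j) P)"
      "area (minkowski_sum (K j) L) - area (minkowski_sum (K j) P) \<le> E"
      using bd[OF K[OF j] MJ[OF j]] by auto
    moreover have "\<bar>D\<bar> < \<delta>" if "2 * D = X - Y" "0 \<le> X" "X \<le> E" "0 \<le> Y" "Y \<le> E" for D X Y :: real
      using that E by (simp add: abs_less_iff)
    ultimately show ?thesis using b0 by blast
  qed
  then show ?thesis using that F(1) F0 unfolding P_def by blast
qed

subsection \<open>Conic Caratheodory\<close>

text \<open>Gaussian elimination over the coordinates: with a pivot \<open>b\<close> at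
  \<open>j\<close>, clear coordinate \<open>j\<close> of the other vectors, and finally choose the
  coefficient of \<open>b\<close> so that coordinate \<open>j\<close> sums to 0.\<close>

lemma linear_dependence:
  fixes w :: "'a \<Rightarrow> 'b \<Rightarrow> real"
  assumes "finite J" "finite A" "card J < card A"
  shows "\<exists>e. (\<exists>a\<in>A. e a \<noteq> 0) \<and> (\<forall>j\<in>J. (\<Sum>a\<in>A. e a * w a j) = 0)"
  using assms
proof (induction J arbitrary: A w rule: finite_induct)
  case empty
  then have "A \<noteq> {}" by auto
  then show ?case by (intro exI[of _ "\<lambda>_. 1"]) auto
next
  case (insert j J)
  show ?case
  proof (cases "\<forall>a\<in>A. w a j = 0")
    case True
    have "card J < card A" using insert.hyps insert.prems by simp
    from insert.IH[OF insert.prems(1) this, of w] obtain e where "\<exists>a\<in>A. e a \<noteq> 0" "\<forall>i\<in>J. (\<Sum>a\<in>A. e a * w a i) = 0" by blast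
    then show ?thesis using True by (intro exI[of _ e]) auto
  next
    case False
    then obtain b where b: "b \<in> A" "w b j \<noteq> 0" by blast
    define A' where "A' = A - {b}"
    have A': "finite A'" "b \<notin> A'" "A = insert b A'" "card J < card A'"
      using insert.hyps insert.prems b by (auto simp: A'_def card_Diff_singleton)
    define w' where "w' = (\<lambda>a i. w a i - w a j / w b j * w b i)"
    obtain e where e: "\<exists>a\<in>A'. e a \<noteq> 0" "\<And>i. i \<in> J \<Longrightarrow> (\<Sum>a\<in>A'. e a * w' a i) = 0"
      using insert.IH[OF A'(1,4), of w'] by blast
    define S where "S = (\<Sum>a\<in>A'. e a * w a j) / w b j"
    define e' where "e' = e(b := - S)"
    have sum: "(\<Sum>a\<in>A. e' a * w a i) = (\<Sum>a\<in>A'. e a * w a i) - S * w b i" for i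
    proof -
      have "(\<Sum>a\<in>A'. e' a * w a i) = (\<Sum>a\<in>A'. e a * w a i)"
        using A'(2) by (intro sum.cong refl) (auto simp: e'_def)
      then show ?thesis using A'(1,2) by (simp add: A'(3) e'_def)
    qed
    have "(\<Sum>a\<in>A. e' a * w a j) = 0" using b(2) by (simp add: sum S_def)
    moreover have "(\<Sum>a\<in>A. e' a * w a i) = 0" if "i \<in> J" for i
    proof -
      have "(\<Sum>a\<in>A'. e a * w' a i) = (\<Sum>a\<in>A'. e a * w a i) - (\<Sum>a\<in>A'. e a * w a j * (w b i / w b j))"
        by (simp add: w'_def right_diff_distrib sum_subtractf mult.assoc mult.commute mult.left_commute)
      also have "(\<Sum>a\<in>A'. e a * w a j * (w b i / w b j)) = S * w b i"
        by (subst sum_distrib_right[symmetric]) (simp add: S_def)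
      finally show ?thesis using e(2)[OF that] sum by simp
    qed
    moreover have "\<exists>a\<in>A. e' a \<noteq> 0" using e(1) A' by (auto simp: e'_def)
    ultimately show ?thesis by (intro exI[of _ e']) auto
  qed
qed

text \<open>While there are more generators than coordinates, subtract a linear relation up to the
  point where a coefficient reaches 0. The coefficients need not sum to one, so
  \<open>card J\<close> generators suffice.\<close>

lemma conic_caratheodory:
  fixes w :: "'a \<Rightarrow> 'b \<Rightarrow> real"
  assumes "finite A" "finite J" "\<And>a. a \<in> A \<Longrightarrow> c a \<ge> 0"
  shows "\<exists>S c'. S \<subseteq> A \<and> card S \<le> card J \<and> (\<forall>a\<in>S. c' a \<ge> 0) \<and>
     (\<forall>j\<in>J. (\<Sum>a\<in>S. c' a * w a j) = (\<Sum>a\<in>A. c a * w a j))"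
  using assms(1,3)
proof (induction "card A" arbitrary: A c rule: less_induct)
  case less
  show ?case
  proof (cases "card A \<le> card J")
    case True
    then show ?thesis using less.prems by (intro exI[of _ A] exI[of _ c]) auto
  next
    case False
    then obtain e0 where e0: "\<exists>a\<in>A. e0 a \<noteq> 0" "\<forall>j\<in>J. (\<Sum>a\<in>A. e0 a * w a j) = 0"
      using linear_dependence[OF assms(2) less.prems(1)] by (meson not_le)
    have "\<exists>e. (\<exists>a\<in>A. e a > 0) \<and> (\<forall>j\<in>J. (\<Sum>a\<in>A. e a * w a j) = 0)"
    proof (cases "\<exists>a\<in>A. e0 a > 0")
      case True then show ?thesis using e0 by blast
    next
      case False
      then have "\<exists>a\<in>A. - e0 a > 0" using e0(1) by (metis linorder_neqE_linordered_idom neg_0_less_iff_less)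
      then show ?thesis using e0(2) by (intro exI[of _ "\<lambda>a. - e0 a"]) (auto simp: sum_negf)
    qed
    then obtain e where e: "\<exists>a\<in>A. e a > 0" "\<forall>j\<in>J. (\<Sum>a\<in>A. e a * w a j) = 0" by blast
    define R where "R = {a\<in>A. e a > 0}"
    have R: "finite R" "R \<noteq> {}" using less.prems(1) e(1) by (auto simp: R_def)
    then have "Min ((\<lambda>a. c a / e a) ` R) \<in> (\<lambda>a. c a / e a) ` R" by (intro Min_in) auto
    then obtain b where b: "b \<in> R" "c b / e b = Min ((\<lambda>a. c a / e a) ` R)" by force
    define t where "t = c b / e b"
    have b': "b \<in> A" "e b > 0" using b by (auto simp: R_def)
    have t0: "t \<ge> 0" using less.prems(2) b' by (simp add: t_def)
    define c' where "c' = (\<lambda>a. c a - t * e a)"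
    have c'0: "c' a \<ge> 0" if "a \<in> A" for a
    proof (cases "e a > 0")
      case True
      then have "t \<le> c a / e a" unfolding t_def b(2) using that R by (intro Min_le) (auto simp: R_def)
      then show ?thesis using True by (simp add: c'_def pos_le_divide_eq)
    next
      case False
      then have "t * e a \<le> 0" using t0 by (intro mult_nonneg_nonpos) auto
      then show ?thesis using less.prems(2)[OF that] by (simp add: c'_def)
    qed
    have cb: "c' b = 0" using b' by (simp add: c'_def t_def)
    have "card (A - {b}) < card A" using less.prems(1) b'(1) by (rule card_Diff1_less)
    from less.hyps[OF this, of c'] obtain S c'' where S: "S \<subseteq> A - {b}" "card S \<le> card J" "\<forall>a\<in>S. c'' a \<ge> 0"
      "\<forall>j\<in>J. (\<Sum>a\<in>S. c'' a * w a j) = (\<Sum>a\<in>A - {b}. c' a * w a j)"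
      using less.prems(1) c'0 by auto
    have "(\<Sum>a\<in>A - {b}. c' a * w a j) = (\<Sum>a\<in>A. c a * w a j)" if "j \<in> J" for j
    proof -
      have "(\<Sum>a\<in>A - {b}. c' a * w a j) = (\<Sum>a\<in>A. c' a * w a j)"
        using less.prems(1) b'(1) cb by (simp add: sum.remove)
      also have "\<dots> = (\<Sum>a\<in>A. c a * w a j) - t * (\<Sum>a\<in>A. e a * w a j)"
        by (simp add: c'_def left_diff_distrib sum_subtractf sum_distrib_left mult.assoc)
      finally show ?thesis using e(2) that by simp
    qed
    then show ?thesis using S by (intro exI[of _ S] exI[of _ c'']) auto
  qed
qed

lemma rot_scaleR: "rot (c *\<^sub>R u) = c *\<^sub>R rot u"
  by (simp add: rot_def vec_eq_iff forall_2)

lemma edge_pair_scaleR: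
  assumes "edge_pair u v" "c \<ge> 0" shows "edge_pair (c *\<^sub>R u) (c *\<^sub>R v)"
proof (cases "c = 0 \<or> v = - u")
  case True then show ?thesis by (auto simp: edge_pair_def)
next
  case False
  then have "cross2 u v > 0" "c * c > 0" using assms by (auto simp: edge_pair_def)
  moreover have "cross2 (c *\<^sub>R u) (c *\<^sub>R v) = c * c * cross2 u v" by (simp add: cross2_def algebra_simps)
  ultimately show ?thesis by (simp add: edge_pair_def)
qed

lemma mixed_area_tri_scaleR:
  assumes K: "K \<in> convex_bodies2" and uv: "edge_pair u v" and c: "c \<ge> 0"
  shows "mixed_area K (tri (c *\<^sub>R u) (c *\<^sub>R v)) = c * mixed_area K (tri u v)"
proof -
  have "- (c *\<^sub>R rot u) - c *\<^sub>R rot v = c *\<^sub>R (- rot u - rot v)" by (simp add: scaleR_diff_right)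
  then have "2 * mixed_area K (tri (c *\<^sub>R u) (c *\<^sub>R v)) = c * (2 * mixed_area K (tri u v))"
    unfolding mixed_area_tri[OF K uv] mixed_area_tri[OF K edge_pair_scaleR[OF uv c]] rot_scaleR
    by (simp only: supp_scaleR[OF K c] distrib_left)
  then show ?thesis by simp
qed

text \<open>A triangle is represented by its values at the bodies \<open>K j\<close>, a vector
  indexed by \<open>J\<close>. The conic coefficients are absorbed by scaling the triangles, and
  degenerate pairs \<open>(0, 0)\<close> pad the list to length exactly \<open>N\<close>, so that
  the number of parameters is fixed.\<close>

lemma few_triangles_approx:
  assumes L: "L \<in> convex_bodies2" and J: "finite J" "card J \<le> N"
    and K0: "\<forall>j\<in>J. K j \<in> convex_bodies2" and \<delta>: "\<delta> > 0"
  obtains ts where "length ts = N" "\<And>u v. (u, v) \<in> set ts \<Longrightarrow> edge_pair u v"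
    "\<And>j. j \<in> J \<Longrightarrow> \<bar>mixed_area (K j) L - mixed_area (K j) (tri_sum ts)\<bar> < \<delta>"
proof -
  note K = bspec[OF K0]
  obtain F where F: "finite F" "F \<noteq> {}" "\<And>j. j \<in> J \<Longrightarrow> \<bar>mixed_area (K j) L - mixed_area (K j) (convex hull F)\<bar> < \<delta>"
    by (rule mixed_area_polygon_approx[OF L J(1) K0 \<delta>]) (rule that; assumption)
  obtain ts where ts: "\<forall>(u, v)\<in>set ts. edge_pair u v"
    "\<And>K. K \<in> convex_bodies2 \<Longrightarrow> mixed_area K (convex hull F) = (\<Sum>(u, v)\<leftarrow>ts. mixed_area K (tri u v))"
    using polygon_triangles[OF F(1,2)] by blast
  define w where "w = (\<lambda>a j. mixed_area (K j) (tri (fst (ts ! a)) (snd (ts ! a))))"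
  have ep: "edge_pair (fst (ts ! a)) (snd (ts ! a))" if "a < length ts" for a
    using ts(1) nth_mem[OF that] by (metis case_prod_beta')
  obtain S c where S: "S \<subseteq> {..<length ts}" "card S \<le> card J" "\<forall>a\<in>S. c a \<ge> 0"
    "\<forall>j\<in>J. (\<Sum>a\<in>S. c a * w a j) = (\<Sum>a<length ts. 1 * w a j)"
    using conic_caratheodory[of "{..<length ts}" J "\<lambda>_. 1" w] J(1) by auto
  have finS: "finite S" using S(1) finite_subset by blast
  define g where "g = (\<lambda>a. (c a *\<^sub>R fst (ts ! a), c a *\<^sub>R snd (ts ! a)))"
  define us where "us = map g (sorted_list_of_set S) @ replicate (N - card S) (0, 0)"
  have len: "length us = N" using S(2) J(2) by (simp add: us_def)
  have us: "edge_pair u v" if uv: "(u, v) \<in> set us" for u v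
  proof -
    consider a where "a \<in> S" "(u, v) = g a" | "(u, v) = (0, 0)" using uv finS by (auto simp: us_def)
    then show ?thesis
    proof cases
      case 1
      then show ?thesis using edge_pair_scaleR[OF ep, of a "c a"] S(1,3) by (auto simp: g_def)
    next
      case 2 then show ?thesis by (simp add: edge_pair_def)
    qed
  qed
  have "mixed_area (K j) (tri_sum us) = mixed_area (K j) (convex hull F)" if j: "j \<in> J" for j
  proof -
    have z: "mixed_area (K j) (tri 0 0) = 0"
      using mixed_area_tri_scaleR[OF K[OF j], of 0 0 0] by (simp add: edge_pair_def)
    have "mixed_area (K j) (tri_sum us) = (\<Sum>(u, v)\<leftarrow>us. mixed_area (K j) (tri u v))"
      using us by (intro mixed_area_tri_sum K j)
    also have "\<dots> = (\<Sum>a\<leftarrow>sorted_list_of_set S. mixed_area (K j) (tri (c a *\<^sub>R fst (ts ! a)) (c a *\<^sub>R snd (ts ! a))))"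
      by (simp add: us_def g_def z o_def case_prod_beta' sum_list_replicate)
    also have "\<dots> = (\<Sum>a\<in>S. mixed_area (K j) (tri (c a *\<^sub>R fst (ts ! a)) (c a *\<^sub>R snd (ts ! a))))"
      using finS by (simp add: sum_list_distinct_conv_sum_set)
    also have "\<dots> = (\<Sum>a\<in>S. c a * w a j)"
      unfolding w_def using S(1,3) by (intro sum.cong refl mixed_area_tri_scaleR K j ep) auto
    also have "\<dots> = (\<Sum>a<length ts. w a j)" using S(4) j by simp
    also have "\<dots> = (\<Sum>(u, v)\<leftarrow>ts. mixed_area (K j) (tri u v))"
      by (simp add: w_def sum_list_sum_nth atLeast0LessThan case_prod_beta')
    finally show ?thesis using ts(2)[OF K[OF j]] by simp
  qed
  then show ?thesis using that[OF len us] F(3) by simp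
qed

text \<open>Replacing body \<open>k\<close> affects only the pairs containing \<open>k\<close>, and
  the approximation is made against the current family, including the bodies already replaced. Each
  replacement costs \<open>\<epsilon>\<close>, so the errors add up linearly.\<close>

theorem tri_sums_approx:
  fixes K :: "nat \<Rightarrow> (real^2) set"
  assumes K: "\<And>i. i \<in> {1..n} \<Longrightarrow> K i \<in> convex_bodies2" and \<delta>: "\<delta> > 0"
  obtains ts where "\<And>i. i \<in> {1..n} \<Longrightarrow> length (ts i) = n"
    "\<And>i u v. i \<in> {1..n} \<Longrightarrow> (u, v) \<in> set (ts i) \<Longrightarrow> edge_pair u v"
    "\<And>i j. i \<in> {1..n} \<Longrightarrow> j \<in> {1..n} \<Longrightarrow> i \<noteq> j \<Longrightarrow>
       \<bar>mixed_area (K i) (K j) - mixed_area (tri_sum (ts i)) (tri_sum (ts j))\<bar> < \<delta>"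
proof -
  \<comment> \<open>The denominator exceeds the number of replacements, which keeps the total error
    strictly below \<open>\<delta>\<close>.\<close>
  define \<epsilon> where "\<epsilon> = \<delta> / (real n + 1)"
  have \<epsilon>: "\<epsilon> > 0" "real n * \<epsilon> < \<delta>" using \<delta> by (auto simp: \<epsilon>_def field_simps)
  define good where "good = (\<lambda>C. \<exists>ts. length ts = n \<and> (\<forall>(u, v)\<in>set ts. edge_pair u v) \<and> C = tri_sum ts)"
  have "\<exists>K'. (\<forall>i\<in>{1..n}. K' i \<in> convex_bodies2) \<and> (\<forall>i\<in>{1..m}. good (K' i)) \<and>
      (\<forall>i\<in>{1..n}. \<forall>j\<in>{1..n}. i \<noteq> j \<longrightarrow> \<bar>mixed_area (K i) (K j) - mixed_area (K' i) (K' j)\<bar> \<le> real m * \<epsilon>)"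
    if "m \<le> n" for m
    using that
  proof (induction m)
    case 0
    show ?case by (rule exI[of _ K]) (use K in auto)
  next
    case (Suc m)
    then have "m \<le> n" by simp
    from Suc.IH[OF this] obtain K' where K'0: "\<forall>i\<in>{1..n}. K' i \<in> convex_bodies2" "\<forall>i\<in>{1..m}. good (K' i)"
      "\<forall>i\<in>{1..n}. \<forall>j\<in>{1..n}. i \<noteq> j \<longrightarrow> \<bar>mixed_area (K i) (K j) - mixed_area (K' i) (K' j)\<bar> \<le> real m * \<epsilon>"
      by blast
    note K' = K'0[rule_format]
    define k where "k = Suc m"
    have k: "k \<in> {1..n}" using Suc.prems by (simp add: k_def)
    define J where "J = {1..n} - {k}"
    have J: "finite J" "card J \<le> n" "\<forall>j\<in>J. K' j \<in> convex_bodies2"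
      using K'(1) k by (auto simp: J_def)
    obtain ts where ts: "length ts = n" "\<And>u v. (u, v) \<in> set ts \<Longrightarrow> edge_pair u v"
      "\<And>j. j \<in> J \<Longrightarrow> \<bar>mixed_area (K' j) (K' k) - mixed_area (K' j) (tri_sum ts)\<bar> < \<epsilon>"
      by (rule few_triangles_approx[OF K'(1)[OF k] J \<epsilon>(1)]) (rule that; assumption)
    define K'' where "K'' = K'(k := tri_sum ts)"
    have "good (tri_sum ts)" unfolding good_def using ts(1,2) by auto
    then have "\<forall>i\<in>{1..k}. good (K'' i)" using K'(2) by (auto simp: K''_def k_def)
    moreover have "\<forall>i\<in>{1..n}. K'' i \<in> convex_bodies2" using K'(1) tri_sum_body by (auto simp: K''_def)
    moreover have "\<bar>mixed_area (K i) (K j) - mixed_area (K'' i) (K'' j)\<bar> \<le> real k * \<epsilon>"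
      if ij: "i \<in> {1..n}" "j \<in> {1..n}" "i \<noteq> j" for i j
    proof -
      have "\<bar>mixed_area (K' i) (K' j) - mixed_area (K'' i) (K'' j)\<bar> \<le> \<epsilon>"
      proof -
        consider "i = k" "j \<in> J" | "j = k" "i \<in> J" | "i \<noteq> k" "j \<noteq> k" using ij by (auto simp: J_def)
        then show ?thesis
        proof cases
          case 1 
          then have "j \<noteq> k" by (simp add: J_def)
          then show ?thesis using ts(3)[of j] 1 
            by (simp add: K''_def mixed_area_commute[of _ "K' j"])
        next
          case 2
          then have "i \<noteq> k" by (simp add: J_def)
          then show ?thesis using ts(3)[of i] 2 by (simp add: K''_def)
        next
          case 3 then show ?thesis using \<epsilon>(1) by (simp add: K''_def)
        qed
      qed
      moreover have "real k * \<epsilon> = real m * \<epsilon> + \<epsilon>" by (simp add: k_def algebra_simps)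
      ultimately show ?thesis using K'(3)[OF ij] by linarith
    qed
    ultimately show ?case unfolding k_def[symmetric] by (intro exI[of _ K'']) auto
  qed
  from this[of n] obtain K' where K': "\<forall>i\<in>{1..n}. good (K' i)"
      "\<forall>i\<in>{1..n}. \<forall>j\<in>{1..n}. i \<noteq> j \<longrightarrow> \<bar>mixed_area (K i) (K j) - mixed_area (K' i) (K' j)\<bar> \<le> real n * \<epsilon>"
    by auto
  from bchoice[OF K'(1)[unfolded good_def]] obtain ts where
    ts: "\<forall>i\<in>{1..n}. length (ts i) = n \<and> (\<forall>(u, v)\<in>set (ts i). edge_pair u v) \<and> K' i = tri_sum (ts i)" by blast
  show ?thesis
  proof (rule that[of ts])
    fix i j assume ij: "i \<in> {1..n}" "j \<in> {1..n}" "i \<noteq> j"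
    then have "\<bar>mixed_area (K i) (K j) - mixed_area (K' i) (K' j)\<bar> \<le> real n * \<epsilon>" using K'(2) by blast
    then show "\<bar>mixed_area (K i) (K j) - mixed_area (tri_sum (ts i)) (tri_sum (ts j))\<bar> < \<delta>"
      using ts ij \<epsilon>(2) by simp
  qed (use ts in auto)
qed

subsection \<open>The closure as a first-order formula\<close>

text \<open>The function type carries the product topology. Off \<open>I\<close> all points of
  \<open>S\<close> are 0, so only the finitely many coordinates in \<open>I\<close> have to be
  approximated, and uniformly.\<close>

lemma closure_fun_finite_support:
  fixes S :: "('i \<Rightarrow> real) set"
  assumes I: "finite I" and S: "\<And>y i. y \<in> S \<Longrightarrow> i \<notin> I \<Longrightarrow> y i = 0"
  shows "x \<in> closure S \<longleftrightarrow> (\<forall>i. i \<notin> I \<longrightarrow> x i = 0) \<and> (\<forall>e>0. \<exists>y\<in>S. \<forall>i\<in>I. \<bar>x i - y i\<bar> < e)"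
proof
  assume x: "x \<in> closure S"
  have coord: "continuous_on UNIV (\<lambda>y::'i \<Rightarrow> real. y i)" for i by (rule continuous_on_product_coordinates)
  have "x i = 0" if "i \<notin> I" for i
  proof -
    have "closed {y::'i \<Rightarrow> real. y i = 0}" using coord by (intro closed_Collect_eq continuous_on_const)
    moreover have "S \<subseteq> {y. y i = 0}" using S that by blast
    ultimately show ?thesis using x closure_minimal by blast
  qed
  moreover have "\<exists>y\<in>S. \<forall>i\<in>I. \<bar>x i - y i\<bar> < e" if e: "e > 0" for e
  proof -
    have "open {y::'i \<Rightarrow> real. \<bar>x i - y i\<bar> < e}" for i
      using coord by (intro open_Collect_less continuous_intros)
    then have "open (\<Inter>i\<in>I. {y. \<bar>x i - y i\<bar> < e})" using I by (intro open_INT) auto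
    moreover have "x \<in> (\<Inter>i\<in>I. {y. \<bar>x i - y i\<bar> < e})" using e by auto
    ultimately have "S \<inter> (\<Inter>i\<in>I. {y. \<bar>x i - y i\<bar> < e}) \<noteq> {}" using x unfolding closure_iff_nhds_not_empty by blast
    then show ?thesis by auto
  qed
  ultimately show "(\<forall>i. i \<notin> I \<longrightarrow> x i = 0) \<and> (\<forall>e>0. \<exists>y\<in>S. \<forall>i\<in>I. \<bar>x i - y i\<bar> < e)" by blast
next
  assume x: "(\<forall>i. i \<notin> I \<longrightarrow> x i = 0) \<and> (\<forall>e>0. \<exists>y\<in>S. \<forall>i\<in>I. \<bar>x i - y i\<bar> < e)"
  show "x \<in> closure S"
  proof (rule ccontr)
    assume "x \<notin> closure S"
    then have "open (- closure S)" "x \<in> - closure S" by auto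
    then obtain X where X: "\<And>i. open (X i)" "x \<in> Pi\<^sub>E UNIV X" "Pi\<^sub>E UNIV X \<subseteq> - closure S"
      using product_topology_open_contains_basis[of "\<lambda>_. euclidean" UNIV "- closure S" x]
      unfolding open_fun_def by auto
    have "\<exists>e>0. \<forall>t. \<bar>x i - t\<bar> < e \<longrightarrow> t \<in> X i" for i
      using X(1)[of i] X(2) unfolding open_dist by (force simp: dist_real_def abs_minus_commute)
    then obtain e where e: "\<And>i. e i > 0" "\<And>i t. \<bar>x i - t\<bar> < e i \<Longrightarrow> t \<in> X i" by metis
    \<comment> \<open>The inserted 1 keeps the minimum meaningful when \<open>I\<close> is
      empty.\<close>
    define d where "d = Min (insert 1 (e ` I))"
    have d: "d > 0" "\<And>i. i \<in> I \<Longrightarrow> d \<le> e i" using I e(1) by (auto simp: d_def)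
    obtain y where y: "y \<in> S" "\<And>i. i \<in> I \<Longrightarrow> \<bar>x i - y i\<bar> < d" using x d(1) by blast
    have "y i \<in> X i" for i
    proof (cases "i \<in> I")
      case True then show ?thesis using e(2) y(2) d(2) by (meson less_le_trans)
    next
      case False
      then have "y i = x i" using S[OF y(1)] x by simp
      then show ?thesis using X(2) by auto
    qed
    then have "y \<in> - closure S" using X(3) by auto
    then show False using y(1) closure_subset by blast
  qed
qed

lemma sa_fun_var: "sa_fun (\<lambda>x. x i)"
  by (rule sa_fun_poly[OF poly_funs.var])

lemma sa_fun_const: "sa_fun (\<lambda>x. c)"
  by (rule sa_fun_poly[OF poly_funs.const])

lemma sa_fun_uminus:
  assumes "sa_fun f" shows "sa_fun (\<lambda>x. - f x)"
proof -
  have "sa_fun (\<lambda>x. 0 - f x)" by (rule sa_fun_diff[OF sa_fun_const assms])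
  then show ?thesis by (simp only: diff_0)
qed

section \<open>Piecewise polynomial vectors and support values\<close>

definition sa_vec :: "(('i \<Rightarrow> real) \<Rightarrow> real^2) \<Rightarrow> bool" where
  "sa_vec f \<longleftrightarrow> sa_fun (\<lambda>x. f x $ 1) \<and> sa_fun (\<lambda>x. f x $ 2)"

lemma sa_vec_vec2: "sa_fun f \<Longrightarrow> sa_fun g \<Longrightarrow> sa_vec (\<lambda>x. vec2 (f x) (g x))"
  by (simp add: sa_vec_def)

lemma sa_vec_add: "sa_vec f \<Longrightarrow> sa_vec g \<Longrightarrow> sa_vec (\<lambda>x. f x + g x)"
  unfolding sa_vec_def vector_add_component by (elim conjE, intro conjI sa_fun_add)

lemma sa_vec_diff: "sa_vec f \<Longrightarrow> sa_vec g \<Longrightarrow> sa_vec (\<lambda>x. f x - g x)"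
  unfolding sa_vec_def vector_minus_component by (elim conjE, intro conjI sa_fun_diff)

lemma sa_vec_uminus: "sa_vec f \<Longrightarrow> sa_vec (\<lambda>x. - f x)"
  unfolding sa_vec_def vector_uminus_component by (elim conjE, intro conjI sa_fun_uminus)

lemma sa_vec_rot: "sa_vec f \<Longrightarrow> sa_vec (\<lambda>x. rot (f x))"
  unfolding sa_vec_def rot_def vector_2 by (elim conjE, intro conjI sa_fun_uminus)

lemma sa_fun_inner: "sa_vec f \<Longrightarrow> sa_vec g \<Longrightarrow> sa_fun (\<lambda>x. f x \<bullet> g x)"
  unfolding inner_real2 by (intro sa_fun_add sa_fun_mult) (auto simp: sa_vec_def)

lemma sa_fun_cross2: "sa_vec f \<Longrightarrow> sa_vec g \<Longrightarrow> sa_fun (\<lambda>x. cross2 (f x) (g x))"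
  unfolding cross2_def by (intro sa_fun_diff sa_fun_mult) (auto simp: sa_vec_def)

lemma sa_fun_supp_tri: "sa_vec f \<Longrightarrow> sa_vec g \<Longrightarrow> sa_vec m \<Longrightarrow> sa_fun (\<lambda>x. supp (tri (f x) (g x)) (m x))"
  unfolding supp_tri by (intro sa_fun_max sa_fun_inner sa_vec_add sa_fun_const)

lemma sign_determined_edge_pair:
  assumes "sa_vec f" "sa_vec g"
  shows "sign_determined (\<lambda>x. edge_pair (f x) (g x))"
proof -
  have s: "sign_determined (\<lambda>x. sgn (cross2 (f x) (g x)))" "sign_determined (\<lambda>x. sgn ((f x + g x) $ 1))" 
    "sign_determined (\<lambda>x. sgn ((f x + g x) $ 2))"
    using assms sa_vec_add[OF assms] by (auto intro!: sign_determined_sgn_sa_fun sa_fun_cross2 simp: sa_vec_def)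
  have e: "edge_pair u v \<longleftrightarrow> sgn (cross2 u v) = 1 \<or> (sgn ((u + v) $ 1) = 0 \<and> sgn ((u + v) $ 2) = 0)" for u v
    by (auto simp: edge_pair_def sgn_1_pos sgn_0_0 vec_eq_iff forall_2)
  show ?thesis unfolding e
    by (rule sign_determined_comp2[OF s(1) sign_determined_comp2[OF s(2,3), of Pair],
         of "\<lambda>a p. a = 1 \<or> (fst p = 0 \<and> snd p = 0)", unfolded fst_conv snd_conv])
qed

text \<open>Only two-element sets index coordinates of \<open>PMV2 n\<close>. The singletons are free to carry the
  coordinates of the edge vectors of the triangles, and the empty set carries the distance from the point of the closure.\<close>

definition prm :: "nat \<Rightarrow> nat \<Rightarrow> nat \<Rightarrow> nat set" where
  "prm i a c = {prod_encode (i, prod_encode (a, c))}"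

definition prms :: "nat \<Rightarrow> nat set set" where
  "prms n = (\<lambda>(i, a, c). prm i a c) ` ({1..n} \<times> {..<n} \<times> {..<4})"

definition prm_tris :: "nat \<Rightarrow> (nat set \<Rightarrow> real) \<Rightarrow> nat \<Rightarrow> ((real^2) \<times> (real^2)) list" where
  "prm_tris n z i = map (\<lambda>a. (vec2 (z (prm i a 0)) (z (prm i a 1)), vec2 (z (prm i a 2)) (z (prm i a 3)))) [0..<n]"

text \<open>The quantifier-free part of the description of the closure, with all data packed into
  one \<open>z\<close>. The quantifiers over the distance \<open>z {}\<close> and over the triangles
  are added in \<open>closure_PMV2_iff\<close>.\<close>

definition near :: "nat \<Rightarrow> (nat set \<Rightarrow> real) \<Rightarrow> bool" where
  "near n z \<longleftrightarrow> (\<forall>i\<in>{1..n}. \<forall>(u, v)\<in>set (prm_tris n z i). edge_pair u v) \<and>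
     (\<forall>i\<in>{1..n}. \<forall>j\<in>{1..n}. i \<noteq> j \<longrightarrow>
        \<bar>z {i, j} - mixed_area (tri_sum (prm_tris n z i)) (tri_sum (prm_tris n z j))\<bar> < z {})"

lemma finite_pair_index: "finite (pair_index n)"
  by (rule finite_subset[of _ "Pow {1..n}"]) (auto simp: pair_index_def)

lemma finite_prms: "finite (prms n)"
  by (simp add: prms_def)

lemma pair_index_mem: "i \<in> {1..n} \<Longrightarrow> j \<in> {1..n} \<Longrightarrow> i \<noteq> j \<Longrightarrow> {i, j} \<in> pair_index n"
  by (simp add: pair_index_def)

lemma pair_index_cases:
  assumes "S \<in> pair_index n"
  obtains i j where "i \<in> {1..n}" "j \<in> {1..n}" "i \<noteq> j" "S = {i, j}"
  using assms by (auto simp: pair_index_def card_2_iff)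

lemma prm_not_pair: "{i, j} \<in> prms n \<Longrightarrow> i = j" "{} \<notin> prms n"
  by (auto simp: prms_def prm_def doubleton_eq_iff)

text \<open>The mixed area of two sums of triangles is a finite sum of support values of triangles,
  hence piecewise polynomial. This formula is valid only if the pairs are genuine edges, so the
  equivalence is split according to \<open>ep\<close>.\<close>

lemma sign_determined_near: "sign_determined (near n)"
proof -
  define u v where "u = (\<lambda>i a (z::nat set \<Rightarrow> real). vec2 (z (prm i a 0)) (z (prm i a 1)))"
    and "v = (\<lambda>i a (z::nat set \<Rightarrow> real). vec2 (z (prm i a 2)) (z (prm i a 3)))"
  have uv: "sa_vec (u i a)" "sa_vec (v i a)" for i a
    unfolding u_def v_def by (intro sa_vec_vec2 sa_fun_var)+
  define ep where "ep = (\<lambda>z. \<forall>i\<in>{1..n}. \<forall>a\<in>{..<n}. edge_pair (u i a z) (v i a z))"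
  have ep: "sign_determined ep"
    unfolding ep_def by (intro sign_determined_ball sign_determined_edge_pair uv) auto
  have ep_iff: "(\<forall>i\<in>{1..n}. \<forall>(u, v)\<in>set (prm_tris n z i). edge_pair u v) \<longleftrightarrow> ep z" for z
    by (auto simp: ep_def prm_tris_def u_def v_def)
  define H where "H = (\<lambda>i m (z::nat set \<Rightarrow> real). \<Sum>b<n. supp (tri (u i b z) (v i b z)) (m z))"
  have H: "sa_fun (H i m)" if "sa_vec m" for i m
    unfolding H_def by (intro sa_fun_sum sa_fun_supp_tri uv that) auto
  have H_eq: "supp (tri_sum (prm_tris n z i)) (m z) = H i m z" for z i m
    by (simp add: supp_tri_sum H_def prm_tris_def u_def v_def o_def sum_list_sum_nth atLeast0LessThan)
  define M where "M = (\<lambda>i j z. \<Sum>a<n. H i (\<lambda>z. rot (u j a z)) z + H i (\<lambda>z. rot (v j a z)) z + H i (\<lambda>z. - rot (u j a z) - rot (v j a z)) z)"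
  have M: "sa_fun (M i j)" for i j
    unfolding M_def by (intro sa_fun_sum sa_fun_add H sa_vec_rot sa_vec_diff sa_vec_uminus uv) auto
  have M_eq: "2 * mixed_area (tri_sum (prm_tris n z i)) (tri_sum (prm_tris n z j)) = M i j z" if "ep z" "j \<in> {1..n}" for z i j
  proof -
    have epj: "edge_pair u v" if "(u, v) \<in> set (prm_tris n z j)" for u v
      using ep_iff[of z] \<open>ep z\<close> \<open>j \<in> {1..n}\<close> that by blast
    have "2 * mixed_area (tri_sum (prm_tris n z i)) (tri_sum (prm_tris n z j))
       = 2 * (\<Sum>(u, v)\<leftarrow>prm_tris n z j. mixed_area (tri_sum (prm_tris n z i)) (tri u v))"
      using mixed_area_tri_sum[OF tri_sum_body epj] by simp
    also have "\<dots> = (\<Sum>a<n. 2 * mixed_area (tri_sum (prm_tris n z i)) (tri (u j a z) (v j a z)))"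
      by (simp add: prm_tris_def u_def v_def o_def sum_list_sum_nth atLeast0LessThan sum_distrib_left)
    also have "\<dots> = M i j z"
      unfolding M_def
    proof (intro sum.cong refl)
      fix a assume "a \<in> {..<n}"
      then have "edge_pair (u j a z) (v j a z)" using that by (simp add: ep_def)
      from mixed_area_tri[OF tri_sum_body this]
      show "2 * mixed_area (tri_sum (prm_tris n z i)) (tri (u j a z) (v j a z)) =
        H i (\<lambda>z. rot (u j a z)) z + H i (\<lambda>z. rot (v j a z)) z + H i (\<lambda>z. - rot (u j a z) - rot (v j a z)) z"
        unfolding H_eq[symmetric] .
    qed
    finally show ?thesis .
  qed
  \<comment> \<open>The inequality of \<open>near\<close>, doubled because \<open>M\<close> is twice
    a mixed area, and with the absolute value resolved into two conditions.\<close>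
  define cl where "cl = (\<lambda>z. \<forall>i\<in>{1..n}. \<forall>j\<in>{1..n}. i \<noteq> j \<longrightarrow> z {i, j} + z {i, j} - M i j z < z {} + z {} \<and> M i j z - (z {i, j} + z {i, j}) < z {} + z {})"
  have cl: "sign_determined cl"
    unfolding cl_def
    by (intro sign_determined_ball sign_determined_comp2[where H = "(\<longrightarrow>)"] sign_determined_const
      sign_determined_comp2[where H = "(\<and>)"] sign_determined_less_sa_fun sa_fun_add sa_fun_diff M sa_fun_var) auto
  have "near n z \<longleftrightarrow> ep z \<and> cl z" for z
  proof (cases "ep z")
    case True
    have key: "\<bar>z {i, j} - mixed_area (tri_sum (prm_tris n z i)) (tri_sum (prm_tris n z j))\<bar> < z {} \<longleftrightarrow>
      z {i, j} + z {i, j} - M i j z < z {} + z {} \<and> M i j z - (z {i, j} + z {i, j}) < z {} + z {}"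
      if "j \<in> {1..n}" for i j
      unfolding M_eq[OF True that, symmetric] by (auto simp: abs_less_iff)
    have "cl z \<longleftrightarrow> (\<forall>i\<in>{1..n}. \<forall>j\<in>{1..n}. i \<noteq> j \<longrightarrow>
        \<bar>z {i, j} - mixed_area (tri_sum (prm_tris n z i)) (tri_sum (prm_tris n z j))\<bar> < z {})"
      unfolding cl_def by (intro ball_cong refl imp_cong key[symmetric])
    then show ?thesis unfolding near_def ep_iff by simp
  next
    case False then show ?thesis unfolding near_def ep_iff by blast
  qed
  then have near_eq: "near n = (\<lambda>z. ep z \<and> cl z)" by (rule ext)
  show ?thesis unfolding near_eq by (rule sign_determined_comp2[OF ep cl])
qed

text \<open>From left to right half of \<open>e\<close> pays for a point of \<open>PMV2 n\<close>
  and half for replacing its bodies by sums of triangles. Conversely such sums are bodies, so they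
  give a point of \<open>PMV2 n\<close> directly.\<close>

lemma closure_PMV2_iff:
  "x \<in> closure (PMV2 n) \<longleftrightarrow> (\<forall>S. S \<notin> pair_index n \<longrightarrow> x S = 0) \<and>
     (\<forall>e>0. \<exists>z. (\<forall>S. S \<notin> prms n \<longrightarrow> z S = (x({} := e)) S) \<and> near n z)"
proof -
  have off: "y S = 0" if "y \<in> PMV2 n" "S \<notin> pair_index n" for y S using that by (auto simp: PMV2_def)
  have A: "\<exists>z. (\<forall>S. S \<notin> prms n \<longrightarrow> z S = (x({} := e)) S) \<and> near n z"
    if e: "e > 0" and ex: "\<And>e. e > 0 \<Longrightarrow> \<exists>y\<in>PMV2 n. \<forall>S\<in>pair_index n. \<bar>x S - y S\<bar> < e" for e
  proof -
    obtain y where y: "y \<in> PMV2 n" "\<forall>S\<in>pair_index n. \<bar>x S - y S\<bar> < e / 2" using ex[of "e / 2"] e by auto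
    obtain K where K: "\<And>i. i \<in> {1..n} \<Longrightarrow> K i \<in> convex_bodies2"
      "\<And>i j. i \<in> {1..n} \<Longrightarrow> j \<in> {1..n} \<Longrightarrow> i \<noteq> j \<Longrightarrow> y {i, j} = mixed_area (K i) (K j)"
      using y(1) unfolding PMV2_def by blast
    have "e / 2 > 0" using e by simp
    obtain ts where ts: "\<And>i. i \<in> {1..n} \<Longrightarrow> length (ts i) = n"
      "\<And>i u v. i \<in> {1..n} \<Longrightarrow> (u, v) \<in> set (ts i) \<Longrightarrow> edge_pair u v"
      "\<And>i j. i \<in> {1..n} \<Longrightarrow> j \<in> {1..n} \<Longrightarrow> i \<noteq> j \<Longrightarrow>
       \<bar>mixed_area (K i) (K j) - mixed_area (tri_sum (ts i)) (tri_sum (ts j))\<bar> < e / 2"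
      using tri_sums_approx[of n K "e / 2"] K(1) \<open>e / 2 > 0\<close> by blast
    \<comment> \<open>\<open>cmp\<close> and \<open>dec\<close> invert the encoding
      \<open>prm\<close>: they recover the body, the triangle and the coordinate from a
      singleton.\<close>
    define cmp where "cmp = (\<lambda>(c::nat) (p :: (real^2) \<times> (real^2)). if c = 0 then fst p $ 1 else if c = 1 then fst p $ 2 else if c = 2 then snd p $ 1 else snd p $ (2::2))"
    define dec where "dec = (\<lambda>S. case prod_decode (the_elem S) of (i, q) \<Rightarrow> case prod_decode q of (a, c) \<Rightarrow> cmp c (ts i ! a))"
    define z where "z = (\<lambda>S. if S \<in> prms n then dec S else (x({} := e)) S)"
    have zp: "z (prm i a c) = cmp c (ts i ! a)" if "i \<in> {1..n}" "a < n" "c < 4" for i a c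
    proof -
      have "prm i a c \<in> prms n" unfolding prms_def using that by force
      then show ?thesis by (simp add: z_def dec_def prm_def)
    qed
    have tz: "prm_tris n z i = ts i" if "i \<in> {1..n}" for i
    proof (rule nth_equalityI)
      show "length (prm_tris n z i) = length (ts i)" using ts(1)[OF that] by (simp add: prm_tris_def)
      fix a assume "a < length (prm_tris n z i)"
      then have "a < n" by (simp add: prm_tris_def)
      then show "prm_tris n z i ! a = ts i ! a"
        using that by (simp add: prm_tris_def zp cmp_def vec2_eta)
    qed
    have "near n z"
      unfolding near_def
    proof (intro conjI ballI impI)
      fix i p assume "i \<in> {1..n}" "p \<in> set (prm_tris n z i)"
      then show "case p of (u, v) \<Rightarrow> edge_pair u v" using tz ts(2) by (cases p) auto
    next
      fix i j assume ij: "i \<in> {1..n}" "j \<in> {1..n}" "i \<noteq> j"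
      have "{i, j} \<notin> prms n" using ij(3) prm_not_pair(1) by blast
      then have z1: "z {i, j} = x {i, j}" "z {} = e" using prm_not_pair(2) by (simp_all add: z_def)
      have "\<bar>x {i, j} - mixed_area (K i) (K j)\<bar> < e / 2" using y(2) K(2)[OF ij] pair_index_mem[OF ij] by metis
      then show "\<bar>z {i, j} - mixed_area (tri_sum (prm_tris n z i)) (tri_sum (prm_tris n z j))\<bar> < z {}"
        unfolding z1 tz[OF ij(1)] tz[OF ij(2)] using ts(3)[OF ij] by linarith
    qed
    then show ?thesis by (intro exI[of _ z]) (auto simp: z_def)
  qed
  have B: "\<exists>y\<in>PMV2 n. \<forall>S\<in>pair_index n. \<bar>x S - y S\<bar> < e"
    if z: "\<And>S. S \<notin> prms n \<Longrightarrow> z S = (x({} := e)) S" "near n z" for e z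
  proof -
    define T where "T = (\<lambda>i. tri_sum (prm_tris n z i))"
    \<comment> \<open>Minimum and maximum recover the two elements of \<open>S\<close>; their order
      is immaterial because mixed area is symmetric.\<close>
    define y where "y = (\<lambda>S. if S \<in> pair_index n then mixed_area (T (Min S)) (T (Max S)) else 0)"
    have yij: "y {i, j} = mixed_area (T i) (T j)" if "i \<in> {1..n}" "j \<in> {1..n}" "i \<noteq> j" for i j
      using pair_index_mem[OF that] mixed_area_commute[of "T i" "T j"] by (auto simp: y_def min_def max_def)
    have "y \<in> PMV2 n"
      unfolding PMV2_def using yij by (auto simp: T_def tri_sum_body y_def intro!: exI[of _ T])
    moreover have "\<bar>x S - y S\<bar> < e" if S: "S \<in> pair_index n" for S
    proof -
      obtain i j where ij: "i \<in> {1..n}" "j \<in> {1..n}" "i \<noteq> j" "S = {i, j}"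
        by (rule pair_index_cases[OF S])
      have "{i, j} \<notin> prms n" using ij(3) prm_not_pair(1) by blast
      then have ze: "z {i, j} = x {i, j}" "z {} = e"
        using z(1)[of "{i, j}"] z(1)[of "{}"] prm_not_pair(2) by simp_all
      have "\<bar>z {i, j} - mixed_area (T i) (T j)\<bar> < z {}"
        unfolding T_def by (rule mp[OF bspec[OF bspec[OF conjunct2[OF z(2)[unfolded near_def]] ij(1)] ij(2)] ij(3)])
      then show ?thesis unfolding ze ij(4) yij[OF ij(1-3)] .
    qed
    ultimately show ?thesis by blast
  qed
  have "(\<forall>e>0. \<exists>y\<in>PMV2 n. \<forall>S\<in>pair_index n. \<bar>x S - y S\<bar> < e) \<longleftrightarrow>
    (\<forall>e>0. \<exists>z. (\<forall>S. S \<notin> prms n \<longrightarrow> z S = (x({} := e)) S) \<and> near n z)" (is "?L \<longleftrightarrow> ?R")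
  proof
    assume L: ?L
    show ?R
    proof (intro allI impI)
      fix e :: real assume "e > 0"
      then show "\<exists>z. (\<forall>S. S \<notin> prms n \<longrightarrow> z S = (x({} := e)) S) \<and> near n z"
        by (rule A[OF _ mp[OF spec[OF L]]])
    qed
  next
    assume R: ?R
    show ?L
    proof (intro allI impI)
      fix e :: real assume "e > 0"
      from mp[OF spec[OF R] this] obtain z where z: "\<forall>S. S \<notin> prms n \<longrightarrow> z S = (x({} := e)) S" "near n z"
        by (elim exE conjE)
      show "\<exists>y\<in>PMV2 n. \<forall>S\<in>pair_index n. \<bar>x S - y S\<bar> < e"
        by (rule B[OF mp[OF spec[OF z(1)]] z(2)])
    qed
  qed
  then show ?thesis
    by (subst closure_fun_finite_support[OF finite_pair_index]) (rule off, assumption+, rule conj_cong[OF refl])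
qed

theorem mainTheorem16:
  fixes n :: nat
  assumes "n \<ge> 2"
  shows "semialgebraic_in (pair_index n) (closure (PMV2 n))"
proof -
  define D where "D = (\<lambda>x. \<exists>z. (\<forall>S. S \<notin> prms n \<longrightarrow> z S = x S) \<and> near n z)"
  have D: "sign_determined D"
    unfolding D_def by (rule sign_determined_ex_finite[OF finite_prms sign_determined_near])
  have pos: "sign_determined (\<lambda>x::nat set \<Rightarrow> real. 0 < x {})"
    by (rule sign_determined_less_sa_fun[OF sa_fun_const sa_fun_var])
  \<comment> \<open>The condition for all \<open>e > 0\<close> is the negation of an existential
    statement about the coordinate \<open>{}\<close>, so the same elimination applies to it.\<close>
  have "sign_determined (\<lambda>x. 0 < x {} \<and> \<not> D x)"
    by (rule sign_determined_comp2[OF pos D])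
  from sign_determined_comp[OF sign_determined_ex[OF this, of "{}"], of Not]
  have "sign_determined (\<lambda>x. \<forall>e>0. D (x({} := e)))" by simp
  from sign_determined_imp_semialgebraic[OF this, of "pair_index n"]
  show ?thesis
    unfolding D_def closure_PMV2_iff[symmetric] by simp
qed

end
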